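(* Let $k$ be a field and let $A$ be a finite-dimensional $k$-algebra. Then the stable degeneration relation $\leq_{\mathrm{st}}$ defines a partial order on the set of isomorphism classes of objects of the stable module category $A\text{-}\underline{\mathrm{mod}}$.
   Context: $A\text{-}\mathrm{mod}$ is the category of finite-dimensional left $A$-modules. $A\text{-}\underline{\mathrm{mod}}$ is the stable category: same objects, morphisms modulo those factoring through a projective module. For $X,Y\in A\text{-}\mathrm{mod}$, $X\leq_{\deg}Y$ means that there exist $Z\in A\text{-}\mathrm{mod}$ and an exact sequence $0\to Y\to X\oplus Z\to Z\to 0$ in $A\text{-}\mathrm{mod}$. $X\leq_{\mathrm{st}}Y$ means that there exist projective modules $P,Q\in A\text{-}\mathrm{mod}$ with $X\oplus P\leq_{\deg}Y\oplus Q$; this induces a relation, also denoted $\leq_{\mathrm{st}}$, on isomorphism classes of objects of $A\text{-}\underline{\mathrm{mod}}$. *)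

theory Defs
  imports "Jordan_Normal_Form.Missing_VectorSpace"
begin

section \<open>Finite-dimensional algebras and their modules\<close>

text \<open>
  The library locale \<^locale>\<open>algebra\<close> is restricted to commutative algebras, and
  \<^locale>\<open>module\<close> to modules over commutative rings. The two locales below are their
  noncommutative counterparts. A \<open>k\<close>-algebra is given by a single record \<open>A\<close> carrying both
  its ring structure and the scalar action of the field. As everywhere in the library, the slots
  \<^const>\<open>mult\<close> and \<^const>\<open>one\<close> of a module record are ignored.
\<close>

locale fd_algebra =
  fixes K :: "('k, 'q) ring_scheme" and A :: "('k, 'a, 'p) module_scheme"
  assumes vectorspace: "vectorspace K A"
    and ring: "ring A"
    and smult_mult_left: "\<lbrakk>c \<in> carrier K; a \<in> carrier A; b \<in> carrier A\<rbrakk> \<Longrightarrow>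
      (c \<odot>\<^bsub>A\<^esub> a) \<otimes>\<^bsub>A\<^esub> b = c \<odot>\<^bsub>A\<^esub> (a \<otimes>\<^bsub>A\<^esub> b)"
    and smult_mult_right: "\<lbrakk>c \<in> carrier K; a \<in> carrier A; b \<in> carrier A\<rbrakk> \<Longrightarrow>
      a \<otimes>\<^bsub>A\<^esub> (c \<odot>\<^bsub>A\<^esub> b) = c \<odot>\<^bsub>A\<^esub> (a \<otimes>\<^bsub>A\<^esub> b)"
    and fin_dim: "vectorspace.fin_dim K A"

locale left_module =
  fixes R :: "('a, 'q) ring_scheme" and M :: "('a, 'm, 'p) module_scheme"
  assumes ring: "ring R"
    and abelian_group: "abelian_group M"
    and smult_closed: "\<lbrakk>a \<in> carrier R; x \<in> carrier M\<rbrakk> \<Longrightarrow> a \<odot>\<^bsub>M\<^esub> x \<in> carrier M"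
    and smult_l_distr: "\<lbrakk>a \<in> carrier R; b \<in> carrier R; x \<in> carrier M\<rbrakk> \<Longrightarrow>
      (a \<oplus>\<^bsub>R\<^esub> b) \<odot>\<^bsub>M\<^esub> x = a \<odot>\<^bsub>M\<^esub> x \<oplus>\<^bsub>M\<^esub> b \<odot>\<^bsub>M\<^esub> x"
    and smult_r_distr: "\<lbrakk>a \<in> carrier R; x \<in> carrier M; y \<in> carrier M\<rbrakk> \<Longrightarrow>
      a \<odot>\<^bsub>M\<^esub> (x \<oplus>\<^bsub>M\<^esub> y) = a \<odot>\<^bsub>M\<^esub> x \<oplus>\<^bsub>M\<^esub> a \<odot>\<^bsub>M\<^esub> y"
    and smult_assoc: "\<lbrakk>a \<in> carrier R; b \<in> carrier R; x \<in> carrier M\<rbrakk> \<Longrightarrow>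
      (a \<otimes>\<^bsub>R\<^esub> b) \<odot>\<^bsub>M\<^esub> x = a \<odot>\<^bsub>M\<^esub> (b \<odot>\<^bsub>M\<^esub> x)"
    and smult_one: "x \<in> carrier M \<Longrightarrow> \<one>\<^bsub>R\<^esub> \<odot>\<^bsub>M\<^esub> x = x"

definition restrict_scalars ::
  "('k, 'a, 'p) module_scheme \<Rightarrow> ('a, 'm, 's) module_scheme \<Rightarrow> ('k, 'm) module" where
  "restrict_scalars A M = \<lparr>carrier = carrier M, mult = mult M, one = one M, zero = zero M,
     add = add M, smult = (\<lambda>c x. (c \<odot>\<^bsub>A\<^esub> \<one>\<^bsub>A\<^esub>) \<odot>\<^bsub>M\<^esub> x)\<rparr>"

definition fd_module ::
  "('k, 'q) ring_scheme \<Rightarrow> ('k, 'a, 'p) module_scheme \<Rightarrow> ('a, 'm, 's) module_scheme \<Rightarrow> bool" where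
  "fd_module K A M \<longleftrightarrow> left_module A M \<and> vectorspace.fin_dim K (restrict_scalars A M)"

text \<open>
  The set of objects of \<open>A\<close>-mod. To obtain a set, the carriers are taken inside the fixed
  type \<open>'k list\<close>. No isomorphism type is lost: see \<open>fd_module_iso_Amod\<close> below.
\<close>

definition Amod ::
  "('k, 'q) ring_scheme \<Rightarrow> ('k, 'a, 'p) module_scheme \<Rightarrow> ('a, 'k list) module set" where
  "Amod K A = {M. fd_module K A M}"

lemma restrict_scalars_vectorspace:
  assumes alg: "fd_algebra K A" and M: "left_module A M"
  shows "vectorspace K (restrict_scalars A M)"
proof -
  interpret alg: fd_algebra K A by (rule alg)
  interpret V: vectorspace K A by (rule alg.vectorspace)
  interpret A: ring A by (rule alg.ring)
  interpret M: left_module A M by (rule M)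
  interpret G: abelian_group M by (rule M.abelian_group)
  have "abelian_group (restrict_scalars A M)"
  proof (rule abelian_groupI)
    fix x assume "x \<in> carrier (restrict_scalars A M)"
    then show "\<exists>y\<in>carrier (restrict_scalars A M).
        y \<oplus>\<^bsub>restrict_scalars A M\<^esub> x = \<zero>\<^bsub>restrict_scalars A M\<^esub>"
      by (intro bexI[of _ "\<ominus>\<^bsub>M\<^esub> x"]) (auto simp: restrict_scalars_def G.l_neg)
  qed (auto simp: restrict_scalars_def G.a_ac)
  then have "module K (restrict_scalars A M)"
  proof (intro moduleI)
    fix c d x assume cd: "c \<in> carrier K" "d \<in> carrier K" and x: "x \<in> carrier (restrict_scalars A M)"
    have "(c \<odot>\<^bsub>A\<^esub> \<one>\<^bsub>A\<^esub>) \<otimes>\<^bsub>A\<^esub> (d \<odot>\<^bsub>A\<^esub> \<one>\<^bsub>A\<^esub>) = (c \<otimes>\<^bsub>K\<^esub> d) \<odot>\<^bsub>A\<^esub> \<one>\<^bsub>A\<^esub>"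
      using cd alg.smult_mult_left[of c "\<one>\<^bsub>A\<^esub>" "d \<odot>\<^bsub>A\<^esub> \<one>\<^bsub>A\<^esub>"] V.smult_assoc1[of c d "\<one>\<^bsub>A\<^esub>"]
      by simp
    then show "(c \<otimes>\<^bsub>K\<^esub> d) \<odot>\<^bsub>restrict_scalars A M\<^esub> x
        = c \<odot>\<^bsub>restrict_scalars A M\<^esub> (d \<odot>\<^bsub>restrict_scalars A M\<^esub> x)"
      using M.smult_assoc[of "c \<odot>\<^bsub>A\<^esub> \<one>\<^bsub>A\<^esub>" "d \<odot>\<^bsub>A\<^esub> \<one>\<^bsub>A\<^esub>" x] cd x by (simp add: restrict_scalars_def)
  qed (auto simp: restrict_scalars_def V.R.is_cring M.smult_closed M.smult_l_distr
      M.smult_r_distr M.smult_one V.smult_l_distr V.R.cring_axioms)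
  then show ?thesis
    by (simp add: vectorspace_def alg.vectorspace[unfolded vectorspace_def])
qed

lemma fd_module_iso_Amod:
  fixes K :: "('k, 'q) ring_scheme" and A :: "('k, 'a, 'p) module_scheme"
    and M :: "('a, 'm, 's) module_scheme"
  assumes alg: "fd_algebra K A" and fd: "fd_module K A M"
  shows "\<exists>N \<in> Amod K A. \<exists>f \<in> module_hom A M N. bij_betw f (carrier M) (carrier N)"
proof -
  have lm: "left_module A M" and fin: "vectorspace.fin_dim K (restrict_scalars A M)"
    using fd by (auto simp: fd_module_def)
  interpret alg: fd_algebra K A by (rule alg)
  interpret AV: vectorspace K A by (rule alg.vectorspace)
  interpret AR: ring A by (rule alg.ring)
  interpret M: left_module A M by (rule lm)
  interpret G: abelian_group M by (rule M.abelian_group)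
  interpret V: vectorspace K "restrict_scalars A M" by (rule restrict_scalars_vectorspace[OF alg lm])
  have cV: "carrier (restrict_scalars A M) = carrier M" by (simp add: restrict_scalars_def)
  obtain S where S: "finite S" "S \<subseteq> carrier M" "V.span S = carrier M"
    using fin unfolding V.fin_dim_def cV by auto
  obtain ss where ss: "set ss = S" using S(1) finite_list by blast
  have "\<exists>c. c \<in> S \<rightarrow> carrier K \<and> x = V.lincomb c S" if "x \<in> carrier M" for x
    using that S V.finite_span[of S] cV by blast
  then obtain c where c: "\<And>x. x \<in> carrier M \<Longrightarrow> c x \<in> S \<rightarrow> carrier K \<and> x = V.lincomb (c x) S"
    by metis
  define e where "e x = map (c x) ss" for x
  have inj: "inj_on e (carrier M)"
  proof (rule inj_onI)
    fix x y assume xy: "x \<in> carrier M" "y \<in> carrier M" "e x = e y"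
    then have eq: "c x s = c y s" if "s \<in> S" for s using that ss by (simp add: e_def)
    have "V.lincomb (c x) S = V.lincomb (c y) S"
      using c[OF xy(2)] by (intro V.lincomb_cong) (auto simp: eq cV S(2)[THEN subsetD])
    then show "x = y" using c xy by metis
  qed
  define d where "d = inv_into (carrier M) e"
  have de: "d (e x) = x" if "x \<in> carrier M" for x using inj that by (simp add: d_def)
  define N :: "('a, 'k list) module" where
    "N = \<lparr>carrier = e ` carrier M, mult = undefined, one = undefined, zero = e \<zero>\<^bsub>M\<^esub>,
       add = (\<lambda>x y. e (d x \<oplus>\<^bsub>M\<^esub> d y)), smult = (\<lambda>a x. e (a \<odot>\<^bsub>M\<^esub> d x))\<rparr>"
  have cN: "carrier N = e ` carrier M" by (simp add: N_def)
  have addN: "e x \<oplus>\<^bsub>N\<^esub> e y = e (x \<oplus>\<^bsub>M\<^esub> y)" if "x \<in> carrier M" "y \<in> carrier M" for x y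
    using that by (simp add: N_def de)
  have smN: "a \<odot>\<^bsub>N\<^esub> e x = e (a \<odot>\<^bsub>M\<^esub> x)" if "x \<in> carrier M" for a x
    using that by (simp add: N_def de)
  have zN: "\<zero>\<^bsub>N\<^esub> = e \<zero>\<^bsub>M\<^esub>" by (simp add: N_def)
  have agN: "abelian_group N"
  proof (rule abelian_groupI)
    fix y assume "y \<in> carrier N"
    then obtain x where x: "x \<in> carrier M" "y = e x" using cN by auto
    then show "\<exists>z\<in>carrier N. z \<oplus>\<^bsub>N\<^esub> y = \<zero>\<^bsub>N\<^esub>"
      by (intro bexI[of _ "e (\<ominus>\<^bsub>M\<^esub> x)"]) (auto simp: cN addN zN G.l_neg)
  qed (auto simp: cN addN zN G.a_ac)
  have lmN: "left_module A N"
    by (rule left_module.intro)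
      (auto simp: cN addN smN agN alg.ring M.smult_closed M.smult_l_distr M.smult_r_distr
        M.smult_assoc M.smult_one)
  have hom: "e \<in> module_hom A M N"
    by (auto simp: module_hom_def cN addN smN)
  interpret W: vectorspace K "restrict_scalars A N" by (rule restrict_scalars_vectorspace[OF alg lmN])
  have cW: "carrier (restrict_scalars A N) = e ` carrier M" by (simp add: restrict_scalars_def cN)
  interpret mh: mod_hom K "restrict_scalars A M" "restrict_scalars A N" e
    by unfold_locales (auto simp: module_hom_def restrict_scalars_def cN addN smN)
  have eS: "e ` S \<subseteq> carrier (restrict_scalars A N)" using S(2) cW by auto
  interpret Sp: submodule K "W.span (e ` S)" "restrict_scalars A N"
    by (rule W.span_is_submodule[OF eS])
  have lin: "e (V.lincomb a F) \<in> W.span (e ` S)"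
    if "finite F" "F \<subseteq> S" "a \<in> S \<rightarrow> carrier K" for a F
    using that
  proof (induction F rule: finite_induct)
    case empty
    then show ?case by (simp add: V.lincomb_def)
  next
    case (insert x F)
    then have x: "x \<in> carrier (restrict_scalars A M)" "F \<subseteq> carrier (restrict_scalars A M)"
      and a: "a \<in> F \<rightarrow> carrier K" "a x \<in> carrier K"
      using S(2) cV by auto
    have "V.lincomb a (insert x F) = (a x \<odot>\<^bsub>restrict_scalars A M\<^esub> x)
        \<oplus>\<^bsub>restrict_scalars A M\<^esub> V.lincomb a F"
      using V.lincomb_insert[of F a x] insert x a by auto
    moreover have "e x \<in> W.span (e ` S)"
      using W.in_own_span[OF eS] insert.prems by auto
    ultimately show ?case
      using insert x a V.lincomb_closed[OF x(2) a(1)] by simp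
  qed
  have "carrier (restrict_scalars A N) \<subseteq> W.span (e ` S)"
  proof
    fix y assume "y \<in> carrier (restrict_scalars A N)"
    then obtain x where x: "x \<in> carrier M" "y = e x" using cW by blast
    show "y \<in> W.span (e ` S)"
      using lin[OF S(1) subset_refl, of "c x"] c[OF x(1)] x(2) by metis
  qed
  then have "W.span (e ` S) = carrier (restrict_scalars A N)"
    using Sp.subset by (rule subset_antisym[rotated])
  then have "W.fin_dim"
    unfolding W.fin_dim_def using S(1) eS by blast
  then have "N \<in> Amod K A" using lmN by (simp add: Amod_def fd_module_def)
  moreover have "bij_betw e (carrier M) (carrier N)" using inj cN by (simp add: bij_betw_def)
  ultimately show ?thesis using hom by blast
qed

section \<open>Degeneration and stable degeneration\<close>

text \<open>
  Projectivity is the lifting property against epimorphisms of finite-dimensional modules. For a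
  finite-dimensional module this already gives lifting against all epimorphisms, because \<open>A\<close>-mod
  contains the free modules of finite rank. The library operations \<^const>\<open>module_hom\<close> and
  \<^const>\<open>direct_sum\<close> do not require the ring of scalars to be commutative.
\<close>

definition projective ::
  "('k, 'q) ring_scheme \<Rightarrow> ('k, 'a, 'p) module_scheme \<Rightarrow> ('a, 'm, 's) module_scheme \<Rightarrow> bool" where
  "projective K A P \<longleftrightarrow> fd_module K A P \<and>
     (\<forall>M \<in> Amod K A. \<forall>N \<in> Amod K A. \<forall>g \<in> module_hom A M N. \<forall>h \<in> module_hom A P N.
        g ` carrier M = carrier N \<longrightarrow>
        (\<exists>l \<in> module_hom A P M. \<forall>x \<in> carrier P. g (l x) = h x))"

definition short_exact ::
  "('a, 'q) ring_scheme \<Rightarrow> ('a, 'l, 'r) module_scheme \<Rightarrow> ('l \<Rightarrow> 'm) \<Rightarrow>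
   ('a, 'm, 's) module_scheme \<Rightarrow> ('m \<Rightarrow> 'n) \<Rightarrow> ('a, 'n, 't) module_scheme \<Rightarrow> bool" where
  "short_exact R L f M g N \<longleftrightarrow> f \<in> module_hom R L M \<and> g \<in> module_hom R M N \<and>
     inj_on f (carrier L) \<and> f ` carrier L = {x \<in> carrier M. g x = \<zero>\<^bsub>N\<^esub>} \<and>
     g ` carrier M = carrier N"

definition deg_le ::
  "('k, 'q) ring_scheme \<Rightarrow> ('k, 'a, 'p) module_scheme \<Rightarrow>
   ('a, 'm, 's) module_scheme \<Rightarrow> ('a, 'n, 't) module_scheme \<Rightarrow> bool" where
  "deg_le K A X Y \<longleftrightarrow> (\<exists>Z \<in> Amod K A. \<exists>f g. short_exact A Y f (direct_sum X Z) g Z)"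

definition st_le ::
  "('k, 'q) ring_scheme \<Rightarrow> ('k, 'a, 'p) module_scheme \<Rightarrow>
   ('a, 'm, 's) module_scheme \<Rightarrow> ('a, 'n, 't) module_scheme \<Rightarrow> bool" where
  "st_le K A X Y \<longleftrightarrow> (\<exists>P \<in> Amod K A. \<exists>Q \<in> Amod K A. projective K A P \<and> projective K A Q \<and>
     deg_le K A (direct_sum X P) (direct_sum Y Q))"

section \<open>The stable category\<close>

text \<open>Morphisms are extensional functions, so that equality of morphisms is equality of functions.\<close>

definition Hom ::
  "('a, 'q) ring_scheme \<Rightarrow> ('a, 'm, 's) module_scheme \<Rightarrow> ('a, 'n, 't) module_scheme \<Rightarrow>
   ('m \<Rightarrow> 'n) set" where
  "Hom R X Y = module_hom R X Y \<inter> extensional (carrier X)"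

text \<open>The morphisms that factor through a projective module.\<close>

definition proj_maps ::
  "('k, 'q) ring_scheme \<Rightarrow> ('k, 'a, 'p) module_scheme \<Rightarrow>
   ('a, 'm, 's) module_scheme \<Rightarrow> ('a, 'n, 't) module_scheme \<Rightarrow> ('m \<Rightarrow> 'n) set" where
  "proj_maps K A X Y = {f \<in> Hom A X Y. \<exists>P \<in> Amod K A. projective K A P \<and>
     (\<exists>g \<in> Hom A X P. \<exists>h \<in> Hom A P Y. f = compose (carrier X) h g)}"

definition stable_eq ::
  "('k, 'q) ring_scheme \<Rightarrow> ('k, 'a, 'p) module_scheme \<Rightarrow>
   ('a, 'm, 's) module_scheme \<Rightarrow> ('a, 'n, 't) module_scheme \<Rightarrow> ('m \<Rightarrow> 'n) rel" where
  "stable_eq K A X Y = {(f, g). f \<in> Hom A X Y \<and> g \<in> Hom A X Y \<and>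
     (\<lambda>x \<in> carrier X. f x \<ominus>\<^bsub>Y\<^esub> g x) \<in> proj_maps K A X Y}"

definition stable_Hom ::
  "('k, 'q) ring_scheme \<Rightarrow> ('k, 'a, 'p) module_scheme \<Rightarrow>
   ('a, 'm, 's) module_scheme \<Rightarrow> ('a, 'n, 't) module_scheme \<Rightarrow> ('m \<Rightarrow> 'n) set set" where
  "stable_Hom K A X Y = Hom A X Y // stable_eq K A X Y"

text \<open>Composition of stable morphisms, from \<open>X\<close> to \<open>Z\<close>, is induced by composition of
  representatives. The intermediate object does not enter the formula.\<close>

definition stable_comp ::
  "('k, 'q) ring_scheme \<Rightarrow> ('k, 'a, 'p) module_scheme \<Rightarrow>
   ('a, 'l, 'r) module_scheme \<Rightarrow> ('a, 'n, 't) module_scheme \<Rightarrow>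
   ('m \<Rightarrow> 'n) set \<Rightarrow> ('l \<Rightarrow> 'm) set \<Rightarrow> ('l \<Rightarrow> 'n) set" where
  "stable_comp K A X Z \<psi> \<phi> =
     (\<Union>g \<in> \<psi>. \<Union>f \<in> \<phi>. stable_eq K A X Z `` {compose (carrier X) g f})"

definition stable_id ::
  "('k, 'q) ring_scheme \<Rightarrow> ('k, 'a, 'p) module_scheme \<Rightarrow>
   ('a, 'm, 's) module_scheme \<Rightarrow> ('m \<Rightarrow> 'm) set" where
  "stable_id K A X = stable_eq K A X X `` {\<lambda>x \<in> carrier X. x}"

definition stable_iso ::
  "('k, 'q) ring_scheme \<Rightarrow> ('k, 'a, 'p) module_scheme \<Rightarrow>
   ('a, 'm, 's) module_scheme \<Rightarrow> ('a, 'n, 't) module_scheme \<Rightarrow> bool" where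
  "stable_iso K A X Y \<longleftrightarrow> (\<exists>\<phi> \<in> stable_Hom K A X Y. \<exists>\<psi> \<in> stable_Hom K A Y X.
     stable_comp K A X X \<psi> \<phi> = stable_id K A X \<and>
     stable_comp K A Y Y \<phi> \<psi> = stable_id K A Y)"

definition stable_iso_rel ::
  "('k, 'q) ring_scheme \<Rightarrow> ('k, 'a, 'p) module_scheme \<Rightarrow> ('a, 'k list) module rel" where
  "stable_iso_rel K A = {(X, Y). X \<in> Amod K A \<and> Y \<in> Amod K A \<and> stable_iso K A X Y}"

definition stable_classes ::
  "('k, 'q) ring_scheme \<Rightarrow> ('k, 'a, 'p) module_scheme \<Rightarrow> ('a, 'k list) module set set" where
  "stable_classes K A = Amod K A // stable_iso_rel K A"

text \<open>The relation induced on isomorphism classes. That it does not depend on the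
  representatives is the statement \<^prop>\<open>st_le K A respects2 stable_iso_rel K A\<close>.\<close>

definition stable_deg_rel ::
  "('k, 'q) ring_scheme \<Rightarrow> ('k, 'a, 'p) module_scheme \<Rightarrow> ('a, 'k list) module set rel" where
  "stable_deg_rel K A = {(C, D). C \<in> stable_classes K A \<and> D \<in> stable_classes K A \<and>
     (\<exists>X \<in> C. \<exists>Y \<in> D. st_le K A X Y)}"

end

theory Submission
  imports Defs
begin

text \<open>
  Reflexivity is clear. The other properties are reduced to statements about degeneration and about
  dimensions of homomorphism spaces, for which \<open>[U, M]\<close> is written below.

  \<^bold>\<open>Antisymmetry.\<close> A sequence \<open>0 \<rightarrow> Y \<rightarrow> X \<oplus> Z \<rightarrow> Z \<rightarrow> 0\<close> gives \<open>[U, X] \<le> [U, Y]\<close> for all \<open>U\<close>, with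
  equality when \<open>U\<close> is projective (\<open>deg_le_hom_dim\<close>). The key result is
  \<open>mod_iso_if_hom_dim_le\<close>: if \<open>[U, M] \<le> [U, N]\<close> for all \<open>U\<close> and \<open>[N, N] = [N, M]\<close>, then \<open>M \<cong> N\<close>.
  Its proof approximates \<open>M\<close> by a power \<open>N\<^sup>r\<close>, counts dimensions to see that \<open>M\<close> is a summand of
  \<open>N\<^sup>r\<close> (\<open>summand_of_power\<close>), and splits off a common indecomposable summand, using
  that indecomposable modules have local endomorphism rings (\<open>indecomposable_local\<close>). Suppose now
  \<open>X \<oplus> P \<le> Y \<oplus> Q\<close> and \<open>Y \<oplus> P' \<le> X \<oplus> Q'\<close> for projective \<open>P\<close>, \<open>Q\<close>, \<open>P'\<close>, \<open>Q'\<close>. Adding the two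
  inequalities gives \<open>[U, P \<oplus> P'] \<le> [U, Q \<oplus> Q']\<close>, with equality for projective \<open>U\<close>, so that the key
  result yields \<open>P \<oplus> P' \<cong> Q \<oplus> Q'\<close>. Hence both inequalities are equalities for every \<open>U\<close>, and the
  key result yields \<open>X \<oplus> P \<oplus> P' \<cong> Y \<oplus> Q \<oplus> P'\<close> (\<open>st_le_antisym\<close>).

  \<^bold>\<open>Transitivity.\<close> A degeneration of \<open>X\<close> to \<open>Y\<close> is the same as an endomorphism \<open>t\<close> of a module \<open>G\<close>
  with kernel \<open>Y\<close> and cokernel \<open>X\<close> such that \<open>G \<rightarrow> X\<close> splits; think of multiplication by the
  parameter of a one-parameter family. Let \<open>u\<close> on \<open>H\<close> be a second such endomorphism, with
  kernel \<open>W\<close> and split cokernel \<open>Y\<close>; by Fitting's lemma \<open>u\<^sup>N = 0\<close> may be assumed. The two families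
  are glued by adjoining an \<open>N\<close>-th root of \<open>t\<close>: shifting \<open>G\<^sup>N\<close> cyclically, with \<open>t\<close> applied at the
  wrap-around, induces on the pushout of \<open>G\<^sup>N\<close> and \<open>H\<close> over \<open>Y\<^sup>N\<close> an endomorphism with kernel \<open>W\<close>
  and split cokernel \<open>X\<close> (\<open>deg_le_trans_nilpotent\<close>).

  \<^bold>\<open>Stable isomorphism.\<close> Two modules are isomorphic in the stable category if and only if they become
  isomorphic after adding projective summands (\<open>proj_equiv_if_stable_iso\<close> and
  \<open>stable_iso_if_proj_equiv\<close>). Modules related in this way are stably below each other, so
  that transitivity also makes the relation independent of representatives.
\<close>

section \<open>Finite-dimensional vector spaces\<close>

lemma (in vectorspace) subspace_finite_dimensional:
  assumes fd: "fin_dim" and W: "subspace K W V"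
  shows subspace_fin_dim: "vectorspace.fin_dim K (vs W)"
    and subspace_dim_le: "vectorspace.dim K (vs W) \<le> dim"
    and subspace_dim_eq: "vectorspace.dim K (vs W) = dim \<Longrightarrow> W = carrier V"
proof -
  interpret W: vectorspace K "vs W" by (rule subspace_is_vs[OF W])
  have sub: "submodule K W V" using W by (rule is_module)
  then have WV: "W \<subseteq> carrier V" by (simp add: submodule_def)
  let ?P = "\<lambda>S. S \<subseteq> W \<and> W.lin_indpt S"
  have ind: "lin_indpt S" if "?P S" for S
    using span_li_not_depend(2)[OF _ sub, of S] that by simp
  have le: "finite S \<and> card S \<le> dim" if "?P S" for S
    using li_le_dim[OF fd _ ind[OF that]] that WV by blast
  have "?P {}" by (simp add: W.lin_dep_def)
  then obtain S where S: "finite S" "maximal S ?P"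
    using maximal_exists[of ?P dim "{}"] le by blast
  then have P: "?P S" by (simp add: maximal_def)
  have bas: "W.basis S"
    by (rule W.max_li_is_basis) (use S(2) in simp)
  then have dimW: "W.dim = card S" using S(1) by (intro W.dim_basis)
  show "W.fin_dim"
    unfolding W.fin_dim_def using S(1) bas by (auto simp: W.basis_def)
  show "W.dim \<le> dim" using dimW le[OF P] by simp
  assume "W.dim = dim"
  then have "basis S"
    using S(1) P WV ind[OF P] dimW by (intro dim_li_is_basis[OF fd]) auto
  then have "carrier V = span S" by (simp add: basis_def)
  also have "\<dots> = W.span S" using P span_li_not_depend(1)[OF _ sub, of S] by simp
  finally show "W = carrier V" using bas by (simp add: W.basis_def)
qed

lemma mod_hom_image_submodule: "mod_hom R M N f \<Longrightarrow> submodule R (f ` carrier M) N"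
  using mod_hom.im_is_submodule[of R M N f] mod_hom.im_def[of R M N f] by simp

lemma (in linear_map) fin_dim_of_kernel:
  assumes ker: "vectorspace.fin_dim K (V.vs kerT)" and fdW: "W.fin_dim"
  shows "V.fin_dim"
proof -
  interpret ker: vectorspace K "V.vs kerT" by (rule V.subspace_is_vs[OF kerT_is_subspace])
  interpret im: vectorspace K "W.vs imT" by (rule W.subspace_is_vs[OF imT_is_subspace])
  have "im.fin_dim" by (rule W.subspace_fin_dim[OF fdW imT_is_subspace])
  then obtain B where B: "finite B" "B \<subseteq> imT" "im.span B = imT"
    unfolding im.fin_dim_def by auto
  obtain B' where B': "finite B'" "B' \<subseteq> carrier V" "B = T ` B'"
    using B(1,2) finite_subset_image[of B T "carrier V"] unfolding im_def by blast
  obtain C where C: "finite C" "C \<subseteq> kerT" "ker.span C = kerT"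
    using ker unfolding ker.fin_dim_def by auto
  have sub: "B' \<union> C \<subseteq> carrier V" using B'(2) C(2) by (auto simp: ker_def)
  define S where "S = V.module.span (B' \<union> C)"
  have S: "submodule K S V" unfolding S_def by (rule V.module.span_is_submodule[OF sub])
  then interpret S: submodule K S V .
  have inS: "B' \<union> C \<subseteq> S" unfolding S_def by (rule V.module.in_own_span[OF sub])
  have "T \<in> module_hom K (V.vs S) W"
    using T_hom S.subset unfolding module_hom_def by (simp add: Pi_iff subset_iff)
  then have TS_hom: "mod_hom K (V.vs S) W T"
    by (intro mod_hom.intro mod_hom_axioms.intro V.module.submodule_is_module[OF S] W.module.module_axioms)
  have TS: "submodule K (T ` S) W"
    using mod_hom_image_submodule[OF TS_hom] by simp
  have "imT = W.module.span B"
    using W.module.span_li_not_depend(1)[OF B(2) W.is_module[OF imT_is_subspace]] B(3) by simp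
  also have "\<dots> \<subseteq> T ` S"
    by (rule W.module.span_is_subset[OF _ TS]) (use B' inS in auto)
  finally have im: "imT \<subseteq> T ` S" .
  have "kerT = V.module.span C"
    using V.module.span_li_not_depend(1)[OF C(2) V.is_module[OF kerT_is_subspace]] C(3) by simp
  also have "\<dots> \<subseteq> S" by (rule V.module.span_is_subset[OF _ S]) (use inS in auto)
  finally have kerS: "kerT \<subseteq> S" .
  have "carrier V \<subseteq> S"
  proof
    fix v assume v: "v \<in> carrier V"
    then obtain s where s: "s \<in> S" "T v = T s" using im by (auto simp: im_def)
    then have sV: "s \<in> carrier V" using S.subset by auto
    have "v \<ominus>\<^bsub>V\<^esub> s \<in> kerT"
      using v sV s(2) by (simp add: ker_def W.module.M.r_neg a_minus_def)
    then have "(v \<ominus>\<^bsub>V\<^esub> s) \<oplus>\<^bsub>V\<^esub> s \<in> S" using kerS s by auto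
    then show "v \<in> S" using v sV by (simp add: a_minus_def V.module.M.a_assoc V.module.M.l_neg)
  qed
  then have "S = carrier V" using S.subset by auto
  then show ?thesis unfolding V.fin_dim_def using B'(1) C(1) sub S_def by blast
qed

text \<open>For a left exact sequence \<open>0 \<rightarrow> U \<rightarrow> V \<rightarrow> W\<close> of vector spaces, equality of dimensions detects
  exactness at \<open>W\<close>.\<close>

lemma left_exact_dim:
  assumes f: "linear_map K U V f" and g: "linear_map K V W g"
    and fdU: "vectorspace.fin_dim K U" and fdV: "vectorspace.fin_dim K V"
    and fdW: "vectorspace.fin_dim K W"
    and inj: "inj_on f (carrier U)"
    and exact: "f ` carrier U = {x \<in> carrier V. g x = \<zero>\<^bsub>W\<^esub>}"
  shows left_exact_dim_le:
      "vectorspace.dim K V \<le> vectorspace.dim K U + vectorspace.dim K W"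
    and left_exact_dim_eq_iff:
      "vectorspace.dim K V = vectorspace.dim K U + vectorspace.dim K W \<longleftrightarrow>
        g ` carrier V = carrier W"
proof -
  interpret f: linear_map K U V f by (rule f)
  interpret g: linear_map K V W g by (rule g)
  have im: "f.im = g.ker" using exact by (simp add: f.im_def g.ker_def)
  have 1: "vectorspace.dim K (V\<lparr>carrier := f.im\<rparr>) = vectorspace.dim K U"
    using f.rank_nullity_main(1)[OF fdU] f.inj_imp_dim_ker0[OF inj] by simp
  have 2: "vectorspace.dim K (W\<lparr>carrier := g.im\<rparr>) + vectorspace.dim K (V\<lparr>carrier := g.ker\<rparr>)
      = vectorspace.dim K V"
    by (rule g.rank_nullity_main(1)[OF fdV])
  have le: "vectorspace.dim K (W\<lparr>carrier := g.im\<rparr>) \<le> vectorspace.dim K W"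
    by (rule g.W.subspace_dim_le[OF fdW g.imT_is_subspace])
  show "vectorspace.dim K V \<le> vectorspace.dim K U + vectorspace.dim K W"
    using 1 2 le im by simp
  have "vectorspace.dim K V = vectorspace.dim K U + vectorspace.dim K W \<longleftrightarrow>
      vectorspace.dim K (W\<lparr>carrier := g.im\<rparr>) = vectorspace.dim K W"
    using 1 2 im by auto
  also have "\<dots> \<longleftrightarrow> g.im = carrier W"
    using g.W.subspace_dim_eq[OF fdW g.imT_is_subspace] by auto
  finally show "vectorspace.dim K V = vectorspace.dim K U + vectorspace.dim K W \<longleftrightarrow>
        g ` carrier V = carrier W"
    by (simp add: g.im_def)
qed

section \<open>Modules over a ring and their homomorphisms\<close>

sublocale left_module \<subseteq> abelian_group M
  by (rule abelian_group)

context left_module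
begin

declare smult_closed [simp]

lemma smult_zero_right [simp]:
  assumes "a \<in> carrier R" shows "a \<odot>\<^bsub>M\<^esub> \<zero>\<^bsub>M\<^esub> = \<zero>\<^bsub>M\<^esub>"
proof -
  have "a \<odot>\<^bsub>M\<^esub> \<zero>\<^bsub>M\<^esub> \<oplus>\<^bsub>M\<^esub> a \<odot>\<^bsub>M\<^esub> \<zero>\<^bsub>M\<^esub> = a \<odot>\<^bsub>M\<^esub> \<zero>\<^bsub>M\<^esub>"
    using smult_r_distr[of a "\<zero>\<^bsub>M\<^esub>" "\<zero>\<^bsub>M\<^esub>"] assms by simp
  then show ?thesis using smult_closed[of a "\<zero>\<^bsub>M\<^esub>"] assms by (simp add: add.l_cancel_one)
qed

lemma smult_minus_right:
  assumes a: "a \<in> carrier R" and x: "x \<in> carrier M"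
  shows "a \<odot>\<^bsub>M\<^esub> (\<ominus>\<^bsub>M\<^esub> x) = \<ominus>\<^bsub>M\<^esub> (a \<odot>\<^bsub>M\<^esub> x)"
proof -
  have "a \<odot>\<^bsub>M\<^esub> (\<ominus>\<^bsub>M\<^esub> x) \<oplus>\<^bsub>M\<^esub> a \<odot>\<^bsub>M\<^esub> x = \<zero>\<^bsub>M\<^esub>"
    using smult_r_distr[of a "\<ominus>\<^bsub>M\<^esub> x" x] a x by (simp add: l_neg smult_zero_right)
  then show ?thesis using a x by (intro minus_equality[symmetric]) (auto simp: smult_closed)
qed

lemma smult_diff:
  "\<lbrakk>a \<in> carrier R; x \<in> carrier M; y \<in> carrier M\<rbrakk> \<Longrightarrow>
    a \<odot>\<^bsub>M\<^esub> (x \<ominus>\<^bsub>M\<^esub> y) = a \<odot>\<^bsub>M\<^esub> x \<ominus>\<^bsub>M\<^esub> a \<odot>\<^bsub>M\<^esub> y"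
  by (simp add: a_minus_def smult_r_distr smult_minus_right)

lemma diff_eq_zero_iff:
  "\<lbrakk>x \<in> carrier M; y \<in> carrier M\<rbrakk> \<Longrightarrow> x \<ominus>\<^bsub>M\<^esub> y = \<zero>\<^bsub>M\<^esub> \<longleftrightarrow> x = y"
  by (metis a_minus_def add.inv_closed minus_equality minus_minus r_neg)

lemma diff_add_cancel:
  "\<lbrakk>x \<in> carrier M; y \<in> carrier M\<rbrakk> \<Longrightarrow> (x \<ominus>\<^bsub>M\<^esub> y) \<oplus>\<^bsub>M\<^esub> y = x"
  by (simp add: a_minus_def a_assoc l_neg)

lemma add_diff_cancel:
  "\<lbrakk>x \<in> carrier M; y \<in> carrier M\<rbrakk> \<Longrightarrow> (x \<oplus>\<^bsub>M\<^esub> y) \<ominus>\<^bsub>M\<^esub> y = x"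
  by (simp add: a_minus_def a_assoc r_neg)

lemma diff_self: "x \<in> carrier M \<Longrightarrow> x \<ominus>\<^bsub>M\<^esub> x = \<zero>\<^bsub>M\<^esub>"
  by (simp add: a_minus_def r_neg)

lemma diff_zero: "x \<in> carrier M \<Longrightarrow> x \<ominus>\<^bsub>M\<^esub> \<zero>\<^bsub>M\<^esub> = x"
  by (simp add: a_minus_def)

end

text \<open>A homomorphism of left modules together with its source and target.\<close>

locale left_module_hom = M: left_module R M + N: left_module R N
  for R :: "('a, 'q) ring_scheme" and M :: "('a, 'm, 's) module_scheme"
    and N :: "('a, 'n, 't) module_scheme" +
  fixes f :: "'m \<Rightarrow> 'n"
  assumes hom: "f \<in> module_hom R M N"
begin

lemma closed [simp]: "x \<in> carrier M \<Longrightarrow> f x \<in> carrier N"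
  using module_hom_closed[OF hom] by auto

lemmas add [simp] = module_hom_add[OF hom]
lemmas smult [simp] = module_hom_smult[OF hom]

lemma zero [simp]: "f \<zero>\<^bsub>M\<^esub> = \<zero>\<^bsub>N\<^esub>"
proof -
  have "f \<zero>\<^bsub>M\<^esub> \<oplus>\<^bsub>N\<^esub> f \<zero>\<^bsub>M\<^esub> = f \<zero>\<^bsub>M\<^esub>" using add[of "\<zero>\<^bsub>M\<^esub>" "\<zero>\<^bsub>M\<^esub>"] by simp
  then show ?thesis by (simp add: N.add.l_cancel_one)
qed

lemma neg [simp]: "x \<in> carrier M \<Longrightarrow> f (\<ominus>\<^bsub>M\<^esub> x) = \<ominus>\<^bsub>N\<^esub> f x"
  using add[of "\<ominus>\<^bsub>M\<^esub> x" x] by (intro N.minus_equality[symmetric]) (auto simp: M.l_neg)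

lemma diff [simp]:
  "\<lbrakk>x \<in> carrier M; y \<in> carrier M\<rbrakk> \<Longrightarrow> f (x \<ominus>\<^bsub>M\<^esub> y) = f x \<ominus>\<^bsub>N\<^esub> f y"
  by (simp add: a_minus_def)

lemma inj_iff: "inj_on f (carrier M) \<longleftrightarrow> (\<forall>x\<in>carrier M. f x = \<zero>\<^bsub>N\<^esub> \<longrightarrow> x = \<zero>\<^bsub>M\<^esub>)"
proof
  assume "\<forall>x\<in>carrier M. f x = \<zero>\<^bsub>N\<^esub> \<longrightarrow> x = \<zero>\<^bsub>M\<^esub>"
  then show "inj_on f (carrier M)"
    by (intro inj_onI) (metis M.minus_closed M.diff_eq_zero_iff N.diff_eq_zero_iff closed diff)
qed (metis M.zero_closed inj_onD zero)

end

lemma left_module_homI: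
  "\<lbrakk>left_module R M; left_module R N; f \<in> module_hom R M N\<rbrakk> \<Longrightarrow> left_module_hom R M N f"
  by (simp add: left_module_hom_def left_module_hom_axioms_def)

lemma module_homI:
  assumes "\<And>x. x \<in> carrier M \<Longrightarrow> f x \<in> carrier N"
    and "\<And>x y. \<lbrakk>x \<in> carrier M; y \<in> carrier M\<rbrakk> \<Longrightarrow> f (x \<oplus>\<^bsub>M\<^esub> y) = f x \<oplus>\<^bsub>N\<^esub> f y"
    and "\<And>a x. \<lbrakk>a \<in> carrier R; x \<in> carrier M\<rbrakk> \<Longrightarrow> f (a \<odot>\<^bsub>M\<^esub> x) = a \<odot>\<^bsub>N\<^esub> f x"
  shows "f \<in> module_hom R M N"
  using assms by (simp add: module_hom_def)

lemma hom_closed: "\<lbrakk>f \<in> module_hom R M N; x \<in> carrier M\<rbrakk> \<Longrightarrow> f x \<in> carrier N"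
  by (auto simp: module_hom_def)

lemma hom_cong:
  "\<lbrakk>left_module R M; f \<in> module_hom R M N; \<And>x. x \<in> carrier M \<Longrightarrow> f x = g x\<rbrakk> \<Longrightarrow> g \<in> module_hom R M N"
proof -
  assume M: "left_module R M" and f: "f \<in> module_hom R M N"
    and eq: "\<And>x. x \<in> carrier M \<Longrightarrow> f x = g x"
  interpret M: left_module R M by fact
  show "g \<in> module_hom R M N"
    using f eq[symmetric] by (auto simp: module_hom_def M.smult_closed)
qed

lemma hom_id: "(\<lambda>x. x) \<in> module_hom R M M"
  by (simp add: module_hom_def)

lemma hom_comp:
  "\<lbrakk>g \<in> module_hom R M N; f \<in> module_hom R L M\<rbrakk> \<Longrightarrow> (\<lambda>x. g (f x)) \<in> module_hom R L N"
  by (auto simp: module_hom_def Pi_def)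

lemma hom_zero:
  assumes "left_module R N"
  shows "(\<lambda>x. \<zero>\<^bsub>N\<^esub>) \<in> module_hom R M N"
proof -
  interpret left_module R N by fact
  show ?thesis by (simp add: module_hom_def smult_zero_right)
qed

lemma hom_add:
  assumes "left_module R M" "left_module R N" "f \<in> module_hom R M N" "g \<in> module_hom R M N"
  shows "(\<lambda>x. f x \<oplus>\<^bsub>N\<^esub> g x) \<in> module_hom R M N"
proof -
  interpret f: left_module_hom R M N f by (intro left_module_homI assms)
  interpret g: left_module_hom R M N g by (intro left_module_homI assms)
  show ?thesis by (rule module_homI) (simp_all add: f.N.smult_r_distr f.N.a_ac)
qed

lemma hom_diff:
  assumes "left_module R M" "left_module R N" "f \<in> module_hom R M N" "g \<in> module_hom R M N"
  shows "(\<lambda>x. f x \<ominus>\<^bsub>N\<^esub> g x) \<in> module_hom R M N"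
proof -
  interpret f: left_module_hom R M N f by (intro left_module_homI assms)
  interpret g: left_module_hom R M N g by (intro left_module_homI assms)
  show ?thesis
    by (rule module_homI)
      (simp_all add: a_minus_def f.N.smult_r_distr f.N.smult_minus_right f.N.minus_add f.N.a_ac)
qed

lemma direct_sum_simps [simp]:
  "carrier (direct_sum M N) = carrier M \<times> carrier N"
  "\<zero>\<^bsub>direct_sum M N\<^esub> = (\<zero>\<^bsub>M\<^esub>, \<zero>\<^bsub>N\<^esub>)"
  "u \<oplus>\<^bsub>direct_sum M N\<^esub> v = (fst u \<oplus>\<^bsub>M\<^esub> fst v, snd u \<oplus>\<^bsub>N\<^esub> snd v)"
  "a \<odot>\<^bsub>direct_sum M N\<^esub> u = (a \<odot>\<^bsub>M\<^esub> fst u, a \<odot>\<^bsub>N\<^esub> snd u)"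
  by (simp_all add: direct_sum_def)

lemma left_module_direct_sum:
  assumes "left_module R M" "left_module R N"
  shows "left_module R (direct_sum M N)"
proof -
  interpret M: left_module R M by fact
  interpret N: left_module R N by fact
  have "abelian_group (direct_sum M N)"
  proof (rule abelian_groupI)
    fix x assume "x \<in> carrier (direct_sum M N)"
    then show "\<exists>y\<in>carrier (direct_sum M N). y \<oplus>\<^bsub>direct_sum M N\<^esub> x = \<zero>\<^bsub>direct_sum M N\<^esub>"
      by (intro bexI[of _ "(\<ominus>\<^bsub>M\<^esub> fst x, \<ominus>\<^bsub>N\<^esub> snd x)"]) (auto simp: M.l_neg N.l_neg)
  qed (auto simp: M.a_ac N.a_ac)
  then show ?thesis
    by (intro left_module.intro M.ring)
      (auto simp: M.smult_closed N.smult_closed M.smult_l_distr N.smult_l_distr M.smult_r_distr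
        N.smult_r_distr M.smult_assoc N.smult_assoc M.smult_one N.smult_one)
qed

lemma hom_fst: "fst \<in> module_hom R (direct_sum M N) M"
  and hom_snd: "snd \<in> module_hom R (direct_sum M N) N"
  by (auto simp: module_hom_def)

lemma hom_pair:
  "\<lbrakk>f \<in> module_hom R L M; g \<in> module_hom R L N\<rbrakk> \<Longrightarrow>
    (\<lambda>x. (f x, g x)) \<in> module_hom R L (direct_sum M N)"
  by (auto simp: module_hom_def)

lemma hom_inl: "left_module R N \<Longrightarrow> (\<lambda>x. (x, \<zero>\<^bsub>N\<^esub>)) \<in> module_hom R M (direct_sum M N)"
  by (intro hom_pair hom_id hom_zero)

lemma hom_inr: "left_module R M \<Longrightarrow> (\<lambda>x. (\<zero>\<^bsub>M\<^esub>, x)) \<in> module_hom R N (direct_sum M N)"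
  by (intro hom_pair hom_id hom_zero)

lemma hom_copair:
  assumes "left_module R M" "left_module R N" "left_module R L"
    and f: "f \<in> module_hom R M L" and g: "g \<in> module_hom R N L"
  shows "(\<lambda>z. f (fst z) \<oplus>\<^bsub>L\<^esub> g (snd z)) \<in> module_hom R (direct_sum M N) L"
  using assms by (intro hom_add left_module_direct_sum hom_comp[OF f hom_fst] hom_comp[OF g hom_snd])

text \<open>Factoring homomorphisms through monomorphisms and epimorphisms.\<close>

lemma hom_factor_inj:
  assumes "left_module R L" "left_module R M" "left_module R N"
    and j: "j \<in> module_hom R L M" "inj_on j (carrier L)"
    and f: "f \<in> module_hom R N M" and im: "\<And>x. x \<in> carrier N \<Longrightarrow> f x \<in> j ` carrier L"
  obtains g where "g \<in> module_hom R N L" "\<And>x. x \<in> carrier N \<Longrightarrow> j (g x) = f x"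
proof -
  interpret j: left_module_hom R L M j by (intro left_module_homI assms)
  interpret f: left_module_hom R N M f by (intro left_module_homI assms)
  define g where "g x = inv_into (carrier L) j (f x)" for x
  have g: "g x \<in> carrier L" "j (g x) = f x" if "x \<in> carrier N" for x
    using im[OF that] by (simp_all add: g_def inv_into_into f_inv_into_f)
  have "g \<in> module_hom R N L"
  proof (rule module_homI)
    fix x y assume xy: "x \<in> carrier N" "y \<in> carrier N"
    show "g (x \<oplus>\<^bsub>N\<^esub> y) = g x \<oplus>\<^bsub>L\<^esub> g y"
      by (rule inj_onD[OF j(2)]) (use g xy in simp_all)
  next
    fix a x assume ax: "a \<in> carrier R" "x \<in> carrier N"
    show "g (a \<odot>\<^bsub>N\<^esub> x) = a \<odot>\<^bsub>L\<^esub> g x"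
      by (rule inj_onD[OF j(2)]) (use g ax in \<open>simp_all add: f.M.smult_closed j.M.smult_closed\<close>)
  qed (rule g)
  then show ?thesis using g(2) by (rule that)
qed

lemma hom_factor_surj:
  assumes "left_module R M" "left_module R Q" "left_module R N"
    and p: "p \<in> module_hom R M Q" "p ` carrier M = carrier Q"
    and f: "f \<in> module_hom R M N"
    and ker: "\<And>x. \<lbrakk>x \<in> carrier M; p x = \<zero>\<^bsub>Q\<^esub>\<rbrakk> \<Longrightarrow> f x = \<zero>\<^bsub>N\<^esub>"
  obtains g where "g \<in> module_hom R Q N" "\<And>x. x \<in> carrier M \<Longrightarrow> g (p x) = f x"
proof -
  interpret p: left_module_hom R M Q p by (intro left_module_homI assms)
  interpret f: left_module_hom R M N f by (intro left_module_homI assms)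
  define g where "g y = f (inv_into (carrier M) p y)" for y
  have g: "g (p x) = f x" if x: "x \<in> carrier M" for x
  proof -
    define z where "z = inv_into (carrier M) p (p x)"
    have z: "z \<in> carrier M" "p z = p x"
      using x by (simp_all add: z_def inv_into_into f_inv_into_f)
    then have "f (z \<ominus>\<^bsub>M\<^esub> x) = \<zero>\<^bsub>N\<^esub>" using x by (intro ker) (simp_all add: p.N.diff_self)
    then show ?thesis using z x by (simp add: g_def z_def[symmetric] f.N.diff_eq_zero_iff)
  qed
  have ex: "\<exists>x\<in>carrier M. y = p x" if "y \<in> carrier Q" for y using that p(2) by auto
  have "g \<in> module_hom R Q N"
  proof (rule module_homI)
    fix y assume "y \<in> carrier Q"
    then show "g y \<in> carrier N" using ex g by force
  next
    fix x y assume "x \<in> carrier Q" "y \<in> carrier Q"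
    then obtain x' y' where "x' \<in> carrier M" "y' \<in> carrier M" "x = p x'" "y = p y'" using ex by meson
    then show "g (x \<oplus>\<^bsub>Q\<^esub> y) = g x \<oplus>\<^bsub>N\<^esub> g y" using g[of "x' \<oplus>\<^bsub>M\<^esub> y'"] by (simp add: g)
  next
    fix a x assume "a \<in> carrier R" "x \<in> carrier Q"
    moreover then obtain x' where "x' \<in> carrier M" "x = p x'" using ex by meson
    ultimately show "g (a \<odot>\<^bsub>Q\<^esub> x) = a \<odot>\<^bsub>N\<^esub> g x"
      using g[of "a \<odot>\<^bsub>M\<^esub> x'"] by (simp add: g)
  qed
  then show ?thesis using g by (rule that)
qed

section \<open>Isomorphisms\<close>

text \<open>Isomorphism of left modules, given by a pair of mutually inverse homomorphisms.\<close>

definition mod_iso ::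
  "('a, 'q) ring_scheme \<Rightarrow> ('a, 'm, 's) module_scheme \<Rightarrow> ('a, 'n, 't) module_scheme \<Rightarrow> bool" where
  "mod_iso R M N \<longleftrightarrow> (\<exists>f\<in>module_hom R M N. \<exists>g\<in>module_hom R N M.
     (\<forall>x\<in>carrier M. g (f x) = x) \<and> (\<forall>y\<in>carrier N. f (g y) = y))"

lemma mod_isoI:
  "\<lbrakk>f \<in> module_hom R M N; g \<in> module_hom R N M; \<And>x. x \<in> carrier M \<Longrightarrow> g (f x) = x;
    \<And>y. y \<in> carrier N \<Longrightarrow> f (g y) = y\<rbrakk> \<Longrightarrow> mod_iso R M N"
  unfolding mod_iso_def by blast

lemma mod_isoE:
  assumes "mod_iso R M N"
  obtains f g where "f \<in> module_hom R M N" "g \<in> module_hom R N M"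
    "\<And>x. x \<in> carrier M \<Longrightarrow> g (f x) = x" "\<And>y. y \<in> carrier N \<Longrightarrow> f (g y) = y"
  using assms unfolding mod_iso_def by blast

lemma mod_iso_bij:
  assumes "left_module R M" "left_module R N" and f: "f \<in> module_hom R M N"
    and bij: "inj_on f (carrier M)" "f ` carrier M = carrier N"
  shows "mod_iso R M N"
proof -
  obtain g where g: "g \<in> module_hom R N M" "\<And>x. x \<in> carrier N \<Longrightarrow> f (g x) = x"
    using hom_factor_inj[OF assms(1,2,2) f bij(1) hom_id] bij(2) by blast
  have "g (f x) = x" if "x \<in> carrier M" for x
    by (rule inj_onD[OF bij(1)]) (use that g hom_closed[OF f] hom_closed[OF g(1)] in auto)
  then show ?thesis using f g by (intro mod_isoI)
qed

lemma mod_iso_refl: "mod_iso R M M"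
  by (rule mod_isoI[OF hom_id hom_id]) auto

lemma mod_iso_sym: "mod_iso R M N \<Longrightarrow> mod_iso R N M"
  unfolding mod_iso_def by blast

lemma mod_iso_trans [trans]:
  assumes "mod_iso R L M" "mod_iso R M N" shows "mod_iso R L N"
proof -
  obtain f g where f: "f \<in> module_hom R L M" "g \<in> module_hom R M L"
    "\<And>x. x \<in> carrier L \<Longrightarrow> g (f x) = x" "\<And>y. y \<in> carrier M \<Longrightarrow> f (g y) = y"
    using mod_isoE[OF assms(1)] by blast
  obtain f' g' where f': "f' \<in> module_hom R M N" "g' \<in> module_hom R N M"
    "\<And>x. x \<in> carrier M \<Longrightarrow> g' (f' x) = x" "\<And>y. y \<in> carrier N \<Longrightarrow> f' (g' y) = y"
    using mod_isoE[OF assms(2)] by blast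
  show ?thesis
    by (rule mod_isoI[OF hom_comp[OF f'(1) f(1)] hom_comp[OF f(2) f'(2)]])
      (auto simp: f f' hom_closed[OF f(1)] hom_closed[OF f'(2)])
qed

lemma mod_iso_direct_sum:
  assumes "mod_iso R M M'" "mod_iso R N N'"
  shows "mod_iso R (direct_sum M N) (direct_sum M' N')"
proof -
  obtain f g where f: "f \<in> module_hom R M M'" "g \<in> module_hom R M' M"
    "\<And>x. x \<in> carrier M \<Longrightarrow> g (f x) = x" "\<And>y. y \<in> carrier M' \<Longrightarrow> f (g y) = y"
    using mod_isoE[OF assms(1)] by blast
  obtain f' g' where f': "f' \<in> module_hom R N N'" "g' \<in> module_hom R N' N"
    "\<And>x. x \<in> carrier N \<Longrightarrow> g' (f' x) = x" "\<And>y. y \<in> carrier N' \<Longrightarrow> f' (g' y) = y"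
    using mod_isoE[OF assms(2)] by blast
  show ?thesis
    by (rule mod_isoI[OF hom_pair[OF hom_comp[OF f(1) hom_fst] hom_comp[OF f'(1) hom_snd]]
          hom_pair[OF hom_comp[OF f(2) hom_fst] hom_comp[OF f'(2) hom_snd]]])
      (auto simp: f f')
qed

lemma mod_iso_direct_sum_commute: "mod_iso R (direct_sum M N) (direct_sum N M)"
  by (rule mod_isoI[OF hom_pair[OF hom_snd hom_fst] hom_pair[OF hom_snd hom_fst]]) auto

lemma mod_iso_direct_sum_assoc:
  "mod_iso R (direct_sum (direct_sum L M) N) (direct_sum L (direct_sum M N))"
  by (rule mod_isoI[OF hom_pair[OF hom_comp[OF hom_fst hom_fst]
          hom_pair[OF hom_comp[OF hom_snd hom_fst] hom_snd]]
        hom_pair[OF hom_pair[OF hom_fst hom_comp[OF hom_fst hom_snd]]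
          hom_comp[OF hom_snd hom_snd]]]) auto

lemma mod_iso_direct_sum_zero:
  assumes "left_module R N" "carrier N = {\<zero>\<^bsub>N\<^esub>}"
  shows "mod_iso R (direct_sum M N) M"
  by (rule mod_isoI[OF hom_fst hom_inl]) (use assms in auto)

text \<open>A monomorphism with a retraction splits off its source as a direct summand.\<close>

lemma mod_iso_split:
  assumes "left_module R M" "left_module R N" "left_module R L"
    and i: "i \<in> module_hom R M N" and r: "r \<in> module_hom R N M"
    and ri: "\<And>x. x \<in> carrier M \<Longrightarrow> r (i x) = x"
    and k: "k \<in> module_hom R L N" "inj_on k (carrier L)"
      "k ` carrier L = {y \<in> carrier N. r y = \<zero>\<^bsub>M\<^esub>}"
  shows "mod_iso R (direct_sum M L) N"
proof -
  interpret i: left_module_hom R M N i by (intro left_module_homI assms)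
  interpret r: left_module_hom R N M r by (intro left_module_homI assms)
  interpret k: left_module_hom R L N k by (intro left_module_homI assms)
  let ?f = "\<lambda>z. i (fst z) \<oplus>\<^bsub>N\<^esub> k (snd z)"
  have f: "?f \<in> module_hom R (direct_sum M L) N" using assms by (intro hom_copair)
  interpret f: left_module_hom R "direct_sum M L" N ?f
    using f by (intro left_module_homI left_module_direct_sum assms)
  have rk: "r (k z) = \<zero>\<^bsub>M\<^esub>" if "z \<in> carrier L" for z using k(3) that by auto
  have rf: "r (?f z) = fst z" if "z \<in> carrier (direct_sum M L)" for z
    using that by (auto simp: ri rk)
  have "inj_on ?f (carrier (direct_sum M L))"
    unfolding f.inj_iff
  proof (intro ballI impI)
    fix z assume z: "z \<in> carrier (direct_sum M L)" and 0: "?f z = \<zero>\<^bsub>N\<^esub>"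
    then have "fst z = \<zero>\<^bsub>M\<^esub>" using rf[OF z] by simp
    moreover then have "k (snd z) = \<zero>\<^bsub>N\<^esub>" using 0 z by auto
    then have "snd z = \<zero>\<^bsub>L\<^esub>" using k(2) z unfolding k.inj_iff by auto
    ultimately show "z = \<zero>\<^bsub>direct_sum M L\<^esub>" by (simp add: prod_eq_iff)
  qed
  moreover have "?f ` carrier (direct_sum M L) = carrier N"
  proof (intro subset_antisym image_subsetI subsetI)
    fix y assume y: "y \<in> carrier N"
    then have "y \<ominus>\<^bsub>N\<^esub> i (r y) \<in> k ` carrier L" unfolding k(3) by (simp add: ri i.M.diff_self)
    then obtain z where z: "z \<in> carrier L" "k z = y \<ominus>\<^bsub>N\<^esub> i (r y)" by auto
    then have "y = ?f (r y, z)" using y by (simp add: i.N.diff_add_cancel i.N.a_comm[of "i (r y)"])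
    then show "y \<in> ?f ` carrier (direct_sum M L)" using y z by (intro image_eqI[of _ _ "(r y, z)"]) auto
  qed (use f.closed in blast)
  ultimately show ?thesis using f by (intro mod_iso_bij left_module_direct_sum assms)
qed

section \<open>Submodules and quotients\<close>

text \<open>The submodules of a left module, as subsets of its carrier. Unlike in the locale
  \<^locale>\<open>submodule\<close>, the ring need not be commutative.\<close>

definition left_submodule ::
  "('a, 'q) ring_scheme \<Rightarrow> 'm set \<Rightarrow> ('a, 'm, 's) module_scheme \<Rightarrow> bool" where
  "left_submodule R S M \<longleftrightarrow> S \<subseteq> carrier M \<and> \<zero>\<^bsub>M\<^esub> \<in> S \<and>
     (\<forall>x\<in>S. \<forall>y\<in>S. x \<oplus>\<^bsub>M\<^esub> y \<in> S) \<and> (\<forall>a\<in>carrier R. \<forall>x\<in>S. a \<odot>\<^bsub>M\<^esub> x \<in> S)"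

lemma (in left_module) smult_minus_one:
  assumes x: "x \<in> carrier M"
  shows "(\<ominus>\<^bsub>R\<^esub> \<one>\<^bsub>R\<^esub>) \<odot>\<^bsub>M\<^esub> x = \<ominus>\<^bsub>M\<^esub> x"
proof -
  interpret R: ring R by (rule ring)
  have "\<zero>\<^bsub>R\<^esub> \<odot>\<^bsub>M\<^esub> x \<oplus>\<^bsub>M\<^esub> \<zero>\<^bsub>R\<^esub> \<odot>\<^bsub>M\<^esub> x = \<zero>\<^bsub>R\<^esub> \<odot>\<^bsub>M\<^esub> x"
    using smult_l_distr[of "\<zero>\<^bsub>R\<^esub>" "\<zero>\<^bsub>R\<^esub>" x] x by simp
  then have "\<zero>\<^bsub>R\<^esub> \<odot>\<^bsub>M\<^esub> x = \<zero>\<^bsub>M\<^esub>" using x by (simp add: add.l_cancel_one)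
  then have "(\<ominus>\<^bsub>R\<^esub> \<one>\<^bsub>R\<^esub>) \<odot>\<^bsub>M\<^esub> x \<oplus>\<^bsub>M\<^esub> x = \<zero>\<^bsub>M\<^esub>"
    using smult_l_distr[of "\<ominus>\<^bsub>R\<^esub> \<one>\<^bsub>R\<^esub>" "\<one>\<^bsub>R\<^esub>" x] x by (simp add: R.l_neg smult_one)
  then show ?thesis using x by (intro minus_equality[symmetric]) auto
qed

lemma left_submodule_neg:
  assumes "left_module R M" "left_submodule R S M" "x \<in> S"
  shows "\<ominus>\<^bsub>M\<^esub> x \<in> S"
proof -
  interpret M: left_module R M by fact
  interpret R: ring R by (rule M.ring)
  have "(\<ominus>\<^bsub>R\<^esub> \<one>\<^bsub>R\<^esub>) \<odot>\<^bsub>M\<^esub> x \<in> S" using assms by (simp add: left_submodule_def)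
  moreover have "x \<in> carrier M" using assms by (auto simp: left_submodule_def)
  ultimately show ?thesis by (simp add: M.smult_minus_one)
qed

lemma left_module_submodule:
  assumes "left_module R M" and S: "left_submodule R S M"
  shows "left_module R (M\<lparr>carrier := S\<rparr>)"
proof -
  interpret M: left_module R M by fact
  have in_M: "x \<in> carrier M" if "x \<in> S" for x using S that by (auto simp: left_submodule_def)
  have "abelian_group (M\<lparr>carrier := S\<rparr>)"
  proof (rule abelian_groupI)
    fix x assume x: "x \<in> carrier (M\<lparr>carrier := S\<rparr>)"
    then show "\<exists>y\<in>carrier (M\<lparr>carrier := S\<rparr>). y \<oplus>\<^bsub>M\<lparr>carrier := S\<rparr>\<^esub> x = \<zero>\<^bsub>M\<lparr>carrier := S\<rparr>\<^esub>"
      using left_submodule_neg[OF assms]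
      by (intro bexI[of _ "\<ominus>\<^bsub>M\<^esub> x"]) (auto simp: M.l_neg in_M)
  qed (use S in \<open>auto simp: left_submodule_def in_M M.a_ac\<close>)
  then show ?thesis
    using S by (intro left_module.intro M.ring)
      (auto simp: in_M left_submodule_def M.smult_l_distr M.smult_r_distr M.smult_assoc M.smult_one)
qed

lemma left_submodule_kernel:
  assumes "left_module R M" "left_module R N" "f \<in> module_hom R M N"
  shows "left_submodule R {x \<in> carrier M. f x = \<zero>\<^bsub>N\<^esub>} M"
proof -
  interpret f: left_module_hom R M N f by (intro left_module_homI assms)
  show ?thesis by (auto simp: left_submodule_def)
qed

lemma left_submodule_image:
  assumes "left_module R M" "left_module R N" "f \<in> module_hom R M N"
  shows "left_submodule R (f ` carrier M) N"
proof -
  interpret f: left_module_hom R M N f by (intro left_module_homI assms)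
  show ?thesis
    unfolding left_submodule_def
  proof (intro conjI ballI)
    show "\<zero>\<^bsub>N\<^esub> \<in> f ` carrier M" by (rule image_eqI[of _ _ "\<zero>\<^bsub>M\<^esub>"]) simp_all
  next
    fix x y assume "x \<in> f ` carrier M" "y \<in> f ` carrier M"
    then obtain u v where "u \<in> carrier M" "v \<in> carrier M" "x = f u" "y = f v" by auto
    then show "x \<oplus>\<^bsub>N\<^esub> y \<in> f ` carrier M" by (intro image_eqI[of _ _ "u \<oplus>\<^bsub>M\<^esub> v"]) simp_all
  next
    fix a x assume "a \<in> carrier R" "x \<in> f ` carrier M"
    then obtain u where "u \<in> carrier M" "x = f u" by auto
    then show "a \<odot>\<^bsub>N\<^esub> x \<in> f ` carrier M"
      using \<open>a \<in> carrier R\<close> by (intro image_eqI[of _ _ "a \<odot>\<^bsub>M\<^esub> u"]) simp_all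
  qed auto
qed

text \<open>The quotient module is realised on a system of representatives of the cosets.\<close>

lemma left_module_quotient:
  fixes M :: "('a, 'm, 's) module_scheme"
  assumes M: "left_module R M" and S: "left_submodule R S M"
  obtains Q :: "('a, 'm) module" and p where "left_module R Q" "p \<in> module_hom R M Q"
    "p ` carrier M = carrier Q" "\<And>x. x \<in> carrier M \<Longrightarrow> p x = \<zero>\<^bsub>Q\<^esub> \<longleftrightarrow> x \<in> S"
proof -
  interpret M: left_module R M by fact
  interpret R: ring R by (rule M.ring)
  have in_M: "x \<in> carrier M" if "x \<in> S" for x using S that by (auto simp: left_submodule_def)
  have S0: "\<zero>\<^bsub>M\<^esub> \<in> S" and Sadd: "\<And>x y. \<lbrakk>x \<in> S; y \<in> S\<rbrakk> \<Longrightarrow> x \<oplus>\<^bsub>M\<^esub> y \<in> S"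
    and Ssmult: "\<And>a x. \<lbrakk>a \<in> carrier R; x \<in> S\<rbrakk> \<Longrightarrow> a \<odot>\<^bsub>M\<^esub> x \<in> S"
    using S by (auto simp: left_submodule_def)
  note Sneg = left_submodule_neg[OF M S]
  define p where "p x = (SOME y. y \<in> carrier M \<and> x \<ominus>\<^bsub>M\<^esub> y \<in> S)" for x
  have p: "p x \<in> carrier M" "x \<ominus>\<^bsub>M\<^esub> p x \<in> S" if "x \<in> carrier M" for x
    using someI[of "\<lambda>y. y \<in> carrier M \<and> x \<ominus>\<^bsub>M\<^esub> y \<in> S" x] that S0
    by (auto simp: p_def M.diff_self)
  have p_cong: "p x = p y" if xy: "x \<in> carrier M" "y \<in> carrier M" "x \<ominus>\<^bsub>M\<^esub> y \<in> S" for x y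
  proof -
    have "x \<ominus>\<^bsub>M\<^esub> z \<in> S \<longleftrightarrow> y \<ominus>\<^bsub>M\<^esub> z \<in> S" if z: "z \<in> carrier M" for z
    proof
      assume "y \<ominus>\<^bsub>M\<^esub> z \<in> S"
      then have "(x \<ominus>\<^bsub>M\<^esub> y) \<oplus>\<^bsub>M\<^esub> (y \<ominus>\<^bsub>M\<^esub> z) \<in> S" using xy by (intro Sadd)
      also have "(x \<ominus>\<^bsub>M\<^esub> y) \<oplus>\<^bsub>M\<^esub> (y \<ominus>\<^bsub>M\<^esub> z) = x \<ominus>\<^bsub>M\<^esub> z"
        using xy z by (metis M.minus_closed M.diff_add_cancel M.a_assoc a_minus_def M.add.inv_closed)
      finally show "x \<ominus>\<^bsub>M\<^esub> z \<in> S" .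
    next
      assume "x \<ominus>\<^bsub>M\<^esub> z \<in> S"
      then have "\<ominus>\<^bsub>M\<^esub> (x \<ominus>\<^bsub>M\<^esub> y) \<oplus>\<^bsub>M\<^esub> (x \<ominus>\<^bsub>M\<^esub> z) \<in> S" using xy by (intro Sadd Sneg)
      also have "\<ominus>\<^bsub>M\<^esub> (x \<ominus>\<^bsub>M\<^esub> y) \<oplus>\<^bsub>M\<^esub> (x \<ominus>\<^bsub>M\<^esub> z) = y \<ominus>\<^bsub>M\<^esub> z"
        using xy z by (simp add: a_minus_def M.minus_add M.a_assoc M.r_neg1 M.a_lcomm[of "\<ominus>\<^bsub>M\<^esub> x" y])
      finally show "y \<ominus>\<^bsub>M\<^esub> z \<in> S" .
    qed
    then have "(\<lambda>z. z \<in> carrier M \<and> x \<ominus>\<^bsub>M\<^esub> z \<in> S) = (\<lambda>z. z \<in> carrier M \<and> y \<ominus>\<^bsub>M\<^esub> z \<in> S)" by auto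
    then show ?thesis by (simp add: p_def)
  qed
  have p_p: "p (p x) = p x" if "x \<in> carrier M" for x
    using p_cong[of x "p x"] p[OF that] that by simp
  define Q :: "('a, 'm) module" where
    "Q = \<lparr>carrier = p ` carrier M, mult = undefined, one = undefined, zero = p \<zero>\<^bsub>M\<^esub>,
       add = (\<lambda>x y. p (x \<oplus>\<^bsub>M\<^esub> y)), smult = (\<lambda>a x. p (a \<odot>\<^bsub>M\<^esub> x))\<rparr>"
  have cQ: "carrier Q = p ` carrier M" and zQ: "\<zero>\<^bsub>Q\<^esub> = p \<zero>\<^bsub>M\<^esub>" by (simp_all add: Q_def)
  have addQ: "p x \<oplus>\<^bsub>Q\<^esub> p y = p (x \<oplus>\<^bsub>M\<^esub> y)" if "x \<in> carrier M" "y \<in> carrier M" for x y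
  proof -
    have "(x \<ominus>\<^bsub>M\<^esub> p x) \<oplus>\<^bsub>M\<^esub> (y \<ominus>\<^bsub>M\<^esub> p y) \<in> S" using that p by (intro Sadd)
    also have "(x \<ominus>\<^bsub>M\<^esub> p x) \<oplus>\<^bsub>M\<^esub> (y \<ominus>\<^bsub>M\<^esub> p y) = (x \<oplus>\<^bsub>M\<^esub> y) \<ominus>\<^bsub>M\<^esub> (p x \<oplus>\<^bsub>M\<^esub> p y)"
      using that p by (simp add: a_minus_def M.minus_add M.a_ac)
    finally show ?thesis using that p by (simp add: Q_def) (intro p_cong[symmetric], auto)
  qed
  have smQ: "a \<odot>\<^bsub>Q\<^esub> p x = p (a \<odot>\<^bsub>M\<^esub> x)" if "a \<in> carrier R" "x \<in> carrier M" for a x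
  proof -
    have "a \<odot>\<^bsub>M\<^esub> (x \<ominus>\<^bsub>M\<^esub> p x) \<in> S" using that p by (intro Ssmult)
    then have "a \<odot>\<^bsub>M\<^esub> x \<ominus>\<^bsub>M\<^esub> a \<odot>\<^bsub>M\<^esub> p x \<in> S" using that p by (simp add: M.smult_diff)
    then show ?thesis using that p by (simp add: Q_def) (intro p_cong[symmetric], auto)
  qed
  have "abelian_group Q"
  proof (rule abelian_groupI)
    fix y assume "y \<in> carrier Q"
    then obtain x where "x \<in> carrier M" "y = p x" using cQ by auto
    then show "\<exists>z\<in>carrier Q. z \<oplus>\<^bsub>Q\<^esub> y = \<zero>\<^bsub>Q\<^esub>"
      by (intro bexI[of _ "p (\<ominus>\<^bsub>M\<^esub> x)"]) (auto simp: cQ addQ zQ M.l_neg)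
  qed (auto simp: cQ addQ zQ M.a_ac)
  then have "left_module R Q"
    by (intro left_module.intro M.ring)
      (auto simp: cQ addQ smQ M.smult_l_distr M.smult_r_distr M.smult_assoc M.smult_one)
  moreover have "p \<in> module_hom R M Q" by (rule module_homI) (auto simp: cQ addQ smQ)
  moreover have "p ` carrier M = carrier Q" by (simp add: cQ)
  moreover have "p x = \<zero>\<^bsub>Q\<^esub> \<longleftrightarrow> x \<in> S" if x: "x \<in> carrier M" for x
  proof
    assume "p x = \<zero>\<^bsub>Q\<^esub>"
    then have "p x \<in> S" using p(2)[of "\<zero>\<^bsub>M\<^esub>"] p(1)[of "\<zero>\<^bsub>M\<^esub>"] Sneg[of "\<zero>\<^bsub>M\<^esub> \<ominus>\<^bsub>M\<^esub> p \<zero>\<^bsub>M\<^esub>"]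
      by (simp add: zQ a_minus_def)
    then show "x \<in> S" using Sadd[OF p(2)[OF x], of "p x"] p(1)[OF x] x by (simp add: M.diff_add_cancel)
  next
    assume "x \<in> S"
    then show "p x = \<zero>\<^bsub>Q\<^esub>" unfolding zQ using x by (intro p_cong) (simp_all add: M.diff_zero)
  qed
  ultimately show ?thesis by (rule that)
qed

section \<open>Finite-dimensional modules\<close>

lemma (in vectorspace) fin_dim_zero: "carrier V = {\<zero>\<^bsub>V\<^esub>} \<Longrightarrow> fin_dim"
  unfolding fin_dim_def using span_empty by auto

lemma fin_dim_exact:
  assumes f: "linear_map K U V f" and g: "linear_map K V W g"
    and fdU: "vectorspace.fin_dim K U" and fdW: "vectorspace.fin_dim K W"
    and exact: "f ` carrier U = {x \<in> carrier V. g x = \<zero>\<^bsub>W\<^esub>}"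
  shows "vectorspace.fin_dim K V"
proof -
  interpret f: linear_map K U V f by (rule f)
  interpret g: linear_map K V W g by (rule g)
  have ker: "g.ker = f ` carrier U" using exact by (simp add: g.ker_def)
  have "vectorspace K (V\<lparr>carrier := g.ker\<rparr>)"
    by (rule f.W.subspace_is_vs[OF g.kerT_is_subspace])
  moreover have "f \<in> module_hom K U (V\<lparr>carrier := g.ker\<rparr>)"
    using f.T_hom by (auto simp: module_hom_def ker)
  ultimately have "linear_map K U (V\<lparr>carrier := g.ker\<rparr>) f"
    using f by (simp add: linear_map_def mod_hom_def mod_hom_axioms_def vectorspace_def)
  from linear_map.surj_fin_dim[OF this fdU]
  have "vectorspace.fin_dim K (V\<lparr>carrier := g.ker\<rparr>)" by (simp add: ker)
  then show ?thesis by (rule g.fin_dim_of_kernel[OF _ fdW])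
qed

lemma linear_mapI:
  "\<lbrakk>vectorspace K V; vectorspace K W; f \<in> module_hom K V W\<rbrakk> \<Longrightarrow> linear_map K V W f"
  by (simp add: linear_map_def mod_hom_def mod_hom_axioms_def vectorspace_def)

lemma restrict_scalars_simps [simp]:
  "carrier (restrict_scalars A M) = carrier M"
  "\<zero>\<^bsub>restrict_scalars A M\<^esub> = \<zero>\<^bsub>M\<^esub>"
  "x \<oplus>\<^bsub>restrict_scalars A M\<^esub> y = x \<oplus>\<^bsub>M\<^esub> y"
  "c \<odot>\<^bsub>restrict_scalars A M\<^esub> x = (c \<odot>\<^bsub>A\<^esub> \<one>\<^bsub>A\<^esub>) \<odot>\<^bsub>M\<^esub> x"
  by (simp_all add: restrict_scalars_def)

lemma fd_module_left_module: "fd_module K A M \<Longrightarrow> left_module A M"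
  by (simp add: fd_module_def)

lemma Amod_fd_module: "M \<in> Amod K A \<Longrightarrow> fd_module K A M"
  by (simp add: Amod_def)

context fd_algebra
begin

lemma scalar_closed: "c \<in> carrier K \<Longrightarrow> c \<odot>\<^bsub>A\<^esub> \<one>\<^bsub>A\<^esub> \<in> carrier A"
proof -
  interpret V: vectorspace K A by (rule vectorspace)
  interpret R: ring A by (rule ring)
  show "c \<in> carrier K \<Longrightarrow> c \<odot>\<^bsub>A\<^esub> \<one>\<^bsub>A\<^esub> \<in> carrier A" by simp
qed

lemma scalar_central:
  assumes "c \<in> carrier K" "a \<in> carrier A"
  shows "(c \<odot>\<^bsub>A\<^esub> \<one>\<^bsub>A\<^esub>) \<otimes>\<^bsub>A\<^esub> a = a \<otimes>\<^bsub>A\<^esub> (c \<odot>\<^bsub>A\<^esub> \<one>\<^bsub>A\<^esub>)"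
proof -
  interpret R: ring A by (rule ring)
  show ?thesis using assms by (simp add: smult_mult_left smult_mult_right)
qed

lemma restrict_scalars_vs: "left_module A M \<Longrightarrow> vectorspace K (restrict_scalars A M)"
  by (rule restrict_scalars_vectorspace[OF fd_algebra_axioms])

lemma restrict_scalars_linear_map:
  assumes "left_module A M" "left_module A N" "f \<in> module_hom A M N"
  shows "linear_map K (restrict_scalars A M) (restrict_scalars A N) f"
  using assms by (intro linear_mapI restrict_scalars_vs) (auto simp: module_hom_def scalar_closed)

lemma fd_module_exact:
  assumes "left_module A M" and L: "fd_module K A L" and N: "fd_module K A N"
    and "f \<in> module_hom A L M" "g \<in> module_hom A M N"
    and "f ` carrier L = {x \<in> carrier M. g x = \<zero>\<^bsub>N\<^esub>}"
  shows "fd_module K A M"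
  unfolding fd_module_def
proof (intro conjI)
  show "vectorspace.fin_dim K (restrict_scalars A M)"
    by (rule fin_dim_exact[of K "restrict_scalars A L" _ f "restrict_scalars A N" g])
      (use assms in \<open>auto simp: fd_module_def intro!: restrict_scalars_linear_map\<close>)
qed fact

lemma fd_module_inj:
  assumes "left_module A M" and N: "fd_module K A N"
    and f: "f \<in> module_hom A M N" "inj_on f (carrier M)"
  shows "fd_module K A M"
  unfolding fd_module_def
proof (intro conjI)
  interpret f: left_module_hom A M N f
    using assms by (intro left_module_homI) (auto simp: fd_module_def)
  interpret lf: linear_map K "restrict_scalars A M" "restrict_scalars A N" f
    by (intro restrict_scalars_linear_map f) (auto intro: f.M.left_module_axioms f.N.left_module_axioms)
  have "lf.ker = {\<zero>\<^bsub>restrict_scalars A M\<^esub>}"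
    using f(2) unfolding f.inj_iff by (auto simp: lf.ker_def)
  moreover have "vectorspace K (restrict_scalars A M\<lparr>carrier := lf.ker\<rparr>)"
    by (rule lf.V.subspace_is_vs[OF lf.kerT_is_subspace])
  ultimately have "vectorspace.fin_dim K (restrict_scalars A M\<lparr>carrier := lf.ker\<rparr>)"
    using vectorspace.fin_dim_zero by fastforce
  then show "vectorspace.fin_dim K (restrict_scalars A M)"
    by (rule lf.fin_dim_of_kernel) (use N in \<open>simp add: fd_module_def\<close>)
qed fact

lemma fd_module_surj:
  assumes "left_module A N" and M: "fd_module K A M"
    and f: "f \<in> module_hom A M N" "f ` carrier M = carrier N"
  shows "fd_module K A N"
  unfolding fd_module_def
proof (intro conjI)
  interpret lf: linear_map K "restrict_scalars A M" "restrict_scalars A N" f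
    using assms by (intro restrict_scalars_linear_map) (auto simp: fd_module_def)
  show "vectorspace.fin_dim K (restrict_scalars A N)"
    using lf.surj_fin_dim f(2) M by (simp add: fd_module_def)
qed fact

lemma fd_module_direct_sum:
  assumes M: "fd_module K A M" and N: "fd_module K A N"
  shows "fd_module K A (direct_sum M N)"
proof (rule fd_module_exact[OF _ M N])
  show "left_module A (direct_sum M N)" using M N by (intro left_module_direct_sum fd_module_left_module)
  show "(\<lambda>x. (x, \<zero>\<^bsub>N\<^esub>)) \<in> module_hom A M (direct_sum M N)"
    using N by (intro hom_inl fd_module_left_module)
  interpret N: left_module A N using N by (rule fd_module_left_module)
  show "(\<lambda>x. (x, \<zero>\<^bsub>N\<^esub>)) ` carrier M = {x \<in> carrier (direct_sum M N). snd x = \<zero>\<^bsub>N\<^esub>}" by auto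
qed (rule hom_snd)

lemma obtain_Amod_iso:
  assumes M: "fd_module K A M"
  obtains N where "N \<in> Amod K A" "mod_iso A M N"
proof -
  obtain N f where N: "N \<in> Amod K A" "f \<in> module_hom A M N" "bij_betw f (carrier M) (carrier N)"
    using fd_module_iso_Amod[OF fd_algebra_axioms M] by blast
  then have "mod_iso A M N" using M
    by (intro mod_iso_bij[of A M N f]) (auto simp: bij_betw_def fd_module_def Amod_def)
  then show ?thesis using N(1) that by blast
qed

text \<open>Submodules and quotients are replaced by isomorphic objects of \<open>A\<close>-mod, given by a monomorphism
  and an epimorphism respectively.\<close>

lemma obtain_submodule:
  assumes M: "fd_module K A M" and S: "left_submodule A S M"
  obtains L j where "L \<in> Amod K A" "j \<in> module_hom A L M" "inj_on j (carrier L)" "j ` carrier L = S"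
proof -
  let ?L = "M\<lparr>carrier := S\<rparr>"
  have lm: "left_module A ?L" using left_module_submodule[OF fd_module_left_module[OF M] S] .
  have inc: "(\<lambda>x. x) \<in> module_hom A ?L M" using S by (auto simp: module_hom_def left_submodule_def)
  have "fd_module K A ?L" by (rule fd_module_inj[OF lm M inc]) simp
  then obtain L where L: "L \<in> Amod K A" "mod_iso A ?L L" by (rule obtain_Amod_iso)
  obtain f g where fg: "f \<in> module_hom A ?L L" "g \<in> module_hom A L ?L"
    "\<And>x. x \<in> carrier ?L \<Longrightarrow> g (f x) = x" "\<And>y. y \<in> carrier L \<Longrightarrow> f (g y) = y"
    using mod_isoE[OF L(2)] by blast
  show ?thesis
  proof (rule that[OF L(1)])
    show "g \<in> module_hom A L M" using hom_comp[OF inc fg(2)] .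
    show "inj_on g (carrier L)" using fg(4) by (rule inj_on_inverseI)
    have "x \<in> g ` carrier L" if "x \<in> S" for x
      by (rule image_eqI[of _ _ "f x"]) (use that fg(3) hom_closed[OF fg(1)] in simp_all)
    moreover have "g ` carrier L \<subseteq> S" using hom_closed[OF fg(2)] by auto
    ultimately show "g ` carrier L = S" by blast
  qed
qed

lemma obtain_quotient:
  fixes M :: "('a, 'm, 's) module_scheme"
  assumes M: "fd_module K A M" and S: "left_submodule A S M"
  obtains Q p where "Q \<in> Amod K A" "p \<in> module_hom A M Q" "p ` carrier M = carrier Q"
    "\<And>x. x \<in> carrier M \<Longrightarrow> p x = \<zero>\<^bsub>Q\<^esub> \<longleftrightarrow> x \<in> S"
proof (rule left_module_quotient[OF fd_module_left_module[OF M] S])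
  fix Q' :: "('a, 'm) module" and p'
  assume Q': "left_module A Q'" "p' \<in> module_hom A M Q'"
    "p' ` carrier M = carrier Q'" "\<And>x. x \<in> carrier M \<Longrightarrow> p' x = \<zero>\<^bsub>Q'\<^esub> \<longleftrightarrow> x \<in> S"
  have "fd_module K A Q'" by (rule fd_module_surj[OF Q'(1) M Q'(2,3)])
  then obtain Q where Q: "Q \<in> Amod K A" "mod_iso A Q' Q" by (rule obtain_Amod_iso)
  obtain f g where fg: "f \<in> module_hom A Q' Q" "g \<in> module_hom A Q Q'"
    "\<And>x. x \<in> carrier Q' \<Longrightarrow> g (f x) = x" "\<And>y. y \<in> carrier Q \<Longrightarrow> f (g y) = y"
    using mod_isoE[OF Q(2)] by blast
  have lmQ: "left_module A Q" using Q(1) by (simp add: Amod_def fd_module_def)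
  interpret f: left_module_hom A Q' Q f by (intro left_module_homI Q'(1) fg(1,2) lmQ)
  interpret g: left_module_hom A Q Q' g by (intro left_module_homI Q'(1) fg(1,2) lmQ)
  show thesis
  proof (rule that[OF Q(1) hom_comp[OF fg(1) Q'(2)]])
    have "y \<in> f ` carrier Q'" if "y \<in> carrier Q" for y
      by (rule image_eqI[of _ _ "g y"]) (simp_all add: that fg(4))
    then have "f ` carrier Q' = carrier Q" by auto
    then show "(\<lambda>x. f (p' x)) ` carrier M = carrier Q" using Q'(3) by (simp flip: image_image)
    fix x assume x: "x \<in> carrier M"
    then have "p' x \<in> carrier Q'" by (rule hom_closed[OF Q'(2)])
    then have "f (p' x) = \<zero>\<^bsub>Q\<^esub> \<longleftrightarrow> p' x = \<zero>\<^bsub>Q'\<^esub>"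
      by (metis fg(3) f.zero g.zero)
    then show "f (p' x) = \<zero>\<^bsub>Q\<^esub> \<longleftrightarrow> x \<in> S" using Q'(4)[OF x] by simp
  qed
qed

lemma obtain_zero_module:
  obtains Z where "Z \<in> Amod K A" "carrier Z = {\<zero>\<^bsub>Z\<^esub>}"
proof -
  define Z :: "('a, 'k list) module" where
    "Z = \<lparr>carrier = {[]}, mult = undefined, one = undefined, zero = [],
       add = (\<lambda>x y. []), smult = (\<lambda>a x. [])\<rparr>"
  have "abelian_group Z" by (rule abelian_groupI) (auto simp: Z_def)
  then have lm: "left_module A Z" by (intro left_module.intro ring) (auto simp: Z_def)
  then interpret V: vectorspace K "restrict_scalars A Z" by (rule restrict_scalars_vs)
  have "Z \<in> Amod K A" using lm V.fin_dim_zero by (simp add: Amod_def fd_module_def Z_def)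
  moreover have "carrier Z = {\<zero>\<^bsub>Z\<^esub>}" by (simp add: Z_def)
  ultimately show ?thesis by (rule that)
qed

lemma obtain_Amod_direct_sum:
  assumes "fd_module K A M" "fd_module K A N"
  obtains D where "D \<in> Amod K A" "mod_iso A (direct_sum M N) D"
  using obtain_Amod_iso[OF fd_module_direct_sum[OF assms]] by blast

end

section \<open>Dimensions of spaces of homomorphisms\<close>

text \<open>The \<open>k\<close>-vector space of homomorphisms. Its elements are extensional functions, which makes
  it a space with the expected dimension.\<close>

definition hom_space ::
  "('k, 'a, 'p) module_scheme \<Rightarrow> ('a, 'm, 's) module_scheme \<Rightarrow> ('a, 'n, 't) module_scheme \<Rightarrow>
   ('k, 'm \<Rightarrow> 'n) module" where
  "hom_space A U M = \<lparr>carrier = Hom A U M, mult = undefined, one = undefined,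
     zero = (\<lambda>x\<in>carrier U. \<zero>\<^bsub>M\<^esub>), add = (\<lambda>f g. \<lambda>x\<in>carrier U. f x \<oplus>\<^bsub>M\<^esub> g x),
     smult = (\<lambda>c f. \<lambda>x\<in>carrier U. (c \<odot>\<^bsub>A\<^esub> \<one>\<^bsub>A\<^esub>) \<odot>\<^bsub>M\<^esub> f x)\<rparr>"

lemma hom_space_simps [simp]:
  "carrier (hom_space A U M) = Hom A U M"
  "\<zero>\<^bsub>hom_space A U M\<^esub> = (\<lambda>x\<in>carrier U. \<zero>\<^bsub>M\<^esub>)"
  "f \<oplus>\<^bsub>hom_space A U M\<^esub> g = (\<lambda>x\<in>carrier U. f x \<oplus>\<^bsub>M\<^esub> g x)"
  "c \<odot>\<^bsub>hom_space A U M\<^esub> f = (\<lambda>x\<in>carrier U. (c \<odot>\<^bsub>A\<^esub> \<one>\<^bsub>A\<^esub>) \<odot>\<^bsub>M\<^esub> f x)"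
  by (simp_all add: hom_space_def)

lemma Hom_module_hom: "f \<in> Hom R U M \<Longrightarrow> f \<in> module_hom R U M"
  by (simp add: Hom_def)

lemma Hom_closed: "\<lbrakk>f \<in> Hom R U M; x \<in> carrier U\<rbrakk> \<Longrightarrow> f x \<in> carrier M"
  by (auto simp: Hom_def module_hom_def)

lemma restrict_Hom:
  assumes "left_module R U" "f \<in> module_hom R U M"
  shows "(\<lambda>x\<in>carrier U. f x) \<in> Hom R U M"
  unfolding Hom_def by (intro IntI hom_cong[OF assms]) auto

lemma Hom_eqI:
  "\<lbrakk>f \<in> Hom R U M; g \<in> Hom R U M; \<And>x. x \<in> carrier U \<Longrightarrow> f x = g x\<rbrakk> \<Longrightarrow> f = g"
  by (auto simp: Hom_def intro: extensionalityI)

context fd_algebra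
begin

lemma hom_scalar:
  assumes "left_module A U" "left_module A M" and c: "c \<in> carrier K" and f: "f \<in> module_hom A U M"
  shows "(\<lambda>x. (c \<odot>\<^bsub>A\<^esub> \<one>\<^bsub>A\<^esub>) \<odot>\<^bsub>M\<^esub> f x) \<in> module_hom A U M"
proof -
  interpret f: left_module_hom A U M f by (intro left_module_homI assms)
  interpret R: ring A by (rule ring)
  note c' = scalar_closed[OF c]
  show ?thesis
    by (rule module_homI)
      (simp_all add: c' f.N.smult_r_distr f.N.smult_assoc[symmetric] scalar_central[OF c])
qed

lemma vectorspace_hom_space:
  assumes U: "left_module A U" and M: "left_module A M"
  shows "vectorspace K (hom_space A U M)"
proof -
  interpret M: left_module A M by fact
  interpret VM: vectorspace K "restrict_scalars A M" by (rule restrict_scalars_vs[OF M])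
  interpret VA: vectorspace K A by (rule vectorspace)
  note sc = scalar_closed
  have dist: "((c \<oplus>\<^bsub>K\<^esub> d) \<odot>\<^bsub>A\<^esub> \<one>\<^bsub>A\<^esub>) \<odot>\<^bsub>M\<^esub> x
      = (c \<odot>\<^bsub>A\<^esub> \<one>\<^bsub>A\<^esub>) \<odot>\<^bsub>M\<^esub> x \<oplus>\<^bsub>M\<^esub> (d \<odot>\<^bsub>A\<^esub> \<one>\<^bsub>A\<^esub>) \<odot>\<^bsub>M\<^esub> x"
    if "c \<in> carrier K" "d \<in> carrier K" "x \<in> carrier M" for c d x
    using VM.smult_l_distr[of c d x] that by simp
  have assoc: "((c \<otimes>\<^bsub>K\<^esub> d) \<odot>\<^bsub>A\<^esub> \<one>\<^bsub>A\<^esub>) \<odot>\<^bsub>M\<^esub> x = (c \<odot>\<^bsub>A\<^esub> \<one>\<^bsub>A\<^esub>) \<odot>\<^bsub>M\<^esub> ((d \<odot>\<^bsub>A\<^esub> \<one>\<^bsub>A\<^esub>) \<odot>\<^bsub>M\<^esub> x)"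
    if "c \<in> carrier K" "d \<in> carrier K" "x \<in> carrier M" for c d x
    using VM.smult_assoc1[of c d x] that by simp
  have one: "(\<one>\<^bsub>K\<^esub> \<odot>\<^bsub>A\<^esub> \<one>\<^bsub>A\<^esub>) \<odot>\<^bsub>M\<^esub> x = x" if "x \<in> carrier M" for x
    using VM.smult_one[of x] that by simp
  have field: "field K" using vectorspace by (simp add: vectorspace_def)
  have one_K: "\<one>\<^bsub>K\<^esub> \<in> carrier K" using field by (simp add: field_def domain_def cring_def ring.ring_simprules)
  have add: "(\<lambda>x\<in>carrier U. f x \<oplus>\<^bsub>M\<^esub> g x) \<in> Hom A U M" if "f \<in> Hom A U M" "g \<in> Hom A U M" for f g
    using that by (intro restrict_Hom hom_add U M Hom_module_hom)
  have sm: "(\<lambda>x\<in>carrier U. (c \<odot>\<^bsub>A\<^esub> \<one>\<^bsub>A\<^esub>) \<odot>\<^bsub>M\<^esub> f x) \<in> Hom A U M"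
    if "c \<in> carrier K" "f \<in> Hom A U M" for c f
    using that by (intro restrict_Hom hom_scalar U M Hom_module_hom)
  have zero: "(\<lambda>x\<in>carrier U. \<zero>\<^bsub>M\<^esub>) \<in> Hom A U M" by (intro restrict_Hom hom_zero U M)
  have neg: "(\<lambda>x\<in>carrier U. \<zero>\<^bsub>M\<^esub> \<ominus>\<^bsub>M\<^esub> f x) \<in> Hom A U M" if "f \<in> Hom A U M" for f
    using that by (intro restrict_Hom hom_diff hom_zero U M Hom_module_hom)
  show ?thesis
  proof (rule vs_criteria[OF field]; (intro allI ballI impI)?; (elim conjE)?; unfold hom_space_simps)
    fix f assume f: "f \<in> Hom A U M"
    show "\<exists>g\<in>Hom A U M. (\<lambda>x\<in>carrier U. f x \<oplus>\<^bsub>M\<^esub> g x) = (\<lambda>x\<in>carrier U. \<zero>\<^bsub>M\<^esub>)"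
      using f by (intro bexI[OF _ neg[OF f]] restrict_ext) (simp add: a_minus_def Hom_closed M.r_neg)
  next
    fix f assume f: "f \<in> Hom A U M"
    show "(\<lambda>x\<in>carrier U. f x \<oplus>\<^bsub>M\<^esub> (\<lambda>x\<in>carrier U. \<zero>\<^bsub>M\<^esub>) x) = f"
      using f by (intro Hom_eqI[OF add[OF f zero] f]) (simp add: Hom_closed)
  next
    fix f assume f: "f \<in> Hom A U M"
    show "(\<lambda>x\<in>carrier U. (\<one>\<^bsub>K\<^esub> \<odot>\<^bsub>A\<^esub> \<one>\<^bsub>A\<^esub>) \<odot>\<^bsub>M\<^esub> f x) = f"
      using f by (intro Hom_eqI[OF sm[OF one_K f] f]) (simp add: Hom_closed one)
  qed (auto intro!: restrict_ext add sm zero simp: Hom_closed M.a_ac dist assoc sc M.smult_r_distr)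
qed

text \<open>A homomorphism is determined by its values on a finite spanning set of \<open>U\<close>. Evaluating at
  the elements \<open>s\<close> of this set one after the other, finite-dimensionality is pulled back from the
  zero space along the maps \<open>f \<mapsto> f s\<close>.\<close>

lemma fin_dim_hom_space:
  assumes U: "fd_module K A U" and M: "fd_module K A M"
  shows "vectorspace.fin_dim K (hom_space A U M)"
proof -
  have lU: "left_module A U" and lM: "left_module A M" using U M by (auto simp: fd_module_def)
  interpret H: vectorspace K "hom_space A U M" by (rule vectorspace_hom_space[OF lU lM])
  interpret VU: vectorspace K "restrict_scalars A U" by (rule restrict_scalars_vs[OF lU])
  interpret VM: vectorspace K "restrict_scalars A M" by (rule restrict_scalars_vs[OF lM])
  interpret LM: left_module A M by fact
  define Z where "Z ss = {f \<in> Hom A U M. \<forall>s\<in>set ss. f s = \<zero>\<^bsub>M\<^esub>}" for ss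
  have Z: "submodule K (Z ss) (hom_space A U M)" if "set ss \<subseteq> carrier U" for ss
  proof
    show "Z ss \<subseteq> carrier (hom_space A U M)" by (auto simp: Z_def)
  next
    fix f g assume fg: "f \<in> Z ss" "g \<in> Z ss"
    then have "f \<oplus>\<^bsub>hom_space A U M\<^esub> g \<in> carrier (hom_space A U M)"
      by (intro H.module.M.a_closed) (auto simp: Z_def)
    then show "f \<oplus>\<^bsub>hom_space A U M\<^esub> g \<in> Z ss" using fg that by (auto simp: Z_def)
  next
    show "\<zero>\<^bsub>hom_space A U M\<^esub> \<in> Z ss"
      using H.module.M.zero_closed that by (auto simp: Z_def)
  next
    fix c f assume cf: "c \<in> carrier K" "f \<in> Z ss"
    then have "c \<odot>\<^bsub>hom_space A U M\<^esub> f \<in> carrier (hom_space A U M)"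
      by (intro H.smult_closed) (auto simp: Z_def)
    then show "c \<odot>\<^bsub>hom_space A U M\<^esub> f \<in> Z ss" using cf that by (auto simp: Z_def scalar_closed)
  qed
  have induct: "vectorspace.fin_dim K (hom_space A U M\<lparr>carrier := Z ss\<rparr>) \<Longrightarrow> H.fin_dim"
    if "set ss \<subseteq> carrier U" for ss
    using that
  proof (induction ss)
    case Nil
    have "hom_space A U M\<lparr>carrier := Z []\<rparr> = hom_space A U M"
      by (simp add: Z_def hom_space_def)
    then show ?case using Nil by simp
  next
    case (Cons s ss)
    have vs: "vectorspace K (hom_space A U M\<lparr>carrier := Z ss\<rparr>)"
      using Cons.prems Z[of ss] by (intro H.subspace_is_vs) (simp add: subspace_def H.vectorspace_axioms)
    have "linear_map K (hom_space A U M\<lparr>carrier := Z ss\<rparr>) (restrict_scalars A M) (\<lambda>f. f s)"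
      by (rule linear_mapI[OF vs VM.vectorspace_axioms])
        (use Cons.prems(2) in \<open>auto simp: module_hom_def Z_def Hom_closed\<close>)
    then interpret ev: linear_map K "hom_space A U M\<lparr>carrier := Z ss\<rparr>" "restrict_scalars A M" "\<lambda>f. f s" .
    have "ev.ker = Z (s # ss)" unfolding ev.ker_def by (auto simp: Z_def)
    then have "ev.V.fin_dim"
      using Cons.prems M by (intro ev.fin_dim_of_kernel) (simp_all add: fd_module_def)
    then show ?case using Cons by simp
  qed
  obtain S where S: "finite S" "S \<subseteq> carrier U" "VU.span S = carrier U"
    using U by (auto simp: fd_module_def VU.fin_dim_def)
  obtain ss where ss: "set ss = S" using S(1) finite_list by blast
  have "f = (\<lambda>x\<in>carrier U. \<zero>\<^bsub>M\<^esub>)" if f: "f \<in> Z ss" for f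
  proof (rule Hom_eqI)
    show fH: "f \<in> Hom A U M" using f by (simp add: Z_def)
    show "(\<lambda>x\<in>carrier U. \<zero>\<^bsub>M\<^esub>) \<in> Hom A U M" by (intro restrict_Hom hom_zero lU lM)
    interpret lf: linear_map K "restrict_scalars A U" "restrict_scalars A M" f
      by (intro restrict_scalars_linear_map lU lM Hom_module_hom fH)
    have "S \<subseteq> lf.ker" using f S(2) ss by (auto simp: lf.ker_def Z_def)
    from VU.span_is_subset[OF this lf.ker_is_submodule]
    show "f x = (\<lambda>x\<in>carrier U. \<zero>\<^bsub>M\<^esub>) x" if "x \<in> carrier U" for x
      using that S(3) by (auto simp: lf.ker_def)
  qed
  moreover have "(\<lambda>x\<in>carrier U. \<zero>\<^bsub>M\<^esub>) \<in> Z ss"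
    using submodule.zero_closed[OF Z[of ss]] S ss by simp
  ultimately have "Z ss = {\<lambda>x\<in>carrier U. \<zero>\<^bsub>M\<^esub>}" by blast
  moreover have "vectorspace K (hom_space A U M\<lparr>carrier := Z ss\<rparr>)"
    using Z[of ss] S ss by (intro H.subspace_is_vs) (simp add: subspace_def H.vectorspace_axioms)
  ultimately have "vectorspace.fin_dim K (hom_space A U M\<lparr>carrier := Z ss\<rparr>)"
    by (intro vectorspace.fin_dim_zero) auto
  then show ?thesis using induct S ss by blast
qed

text \<open>The dimension \<open>[U, M]\<close> of the space of homomorphisms from \<open>U\<close> to \<open>M\<close>.\<close>

definition hom_dim :: "('a, 'm, 's) module_scheme \<Rightarrow> ('a, 'n, 't) module_scheme \<Rightarrow> nat" where
  "hom_dim U M = vectorspace.dim K (hom_space A U M)"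

lemma linear_map_postcompose:
  assumes "left_module A U" "left_module A M" "left_module A N" "g \<in> module_hom A M N"
  shows "linear_map K (hom_space A U M) (hom_space A U N) (\<lambda>f. \<lambda>x\<in>carrier U. g (f x))"
proof (intro linear_mapI vectorspace_hom_space assms module_homI; unfold hom_space_simps)
  interpret g: left_module_hom A M N g by (intro left_module_homI assms)
  interpret U: left_module A U by fact
  show "(\<lambda>x\<in>carrier U. g (f x)) \<in> Hom A U N" if "f \<in> Hom A U M" for f
    by (intro restrict_Hom hom_comp[OF assms(4) Hom_module_hom[OF that]] assms)
  show "(\<lambda>x\<in>carrier U. g ((\<lambda>x\<in>carrier U. f x \<oplus>\<^bsub>M\<^esub> h x) x)) =
      (\<lambda>x\<in>carrier U. (\<lambda>x\<in>carrier U. g (f x)) x \<oplus>\<^bsub>N\<^esub> (\<lambda>x\<in>carrier U. g (h x)) x)"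
    if "f \<in> Hom A U M" "h \<in> Hom A U M" for f h
    using that by (intro restrict_ext) (simp add: Hom_closed)
  show "(\<lambda>x\<in>carrier U. g ((\<lambda>x\<in>carrier U. (c \<odot>\<^bsub>A\<^esub> \<one>\<^bsub>A\<^esub>) \<odot>\<^bsub>M\<^esub> f x) x)) =
      (\<lambda>x\<in>carrier U. (c \<odot>\<^bsub>A\<^esub> \<one>\<^bsub>A\<^esub>) \<odot>\<^bsub>N\<^esub> (\<lambda>x\<in>carrier U. g (f x)) x)"
    if "c \<in> carrier K" "f \<in> Hom A U M" for c f
    using that by (intro restrict_ext) (simp add: Hom_closed scalar_closed)
qed

lemma linear_map_precompose:
  assumes "left_module A U" "left_module A W" "left_module A M" and h: "h \<in> module_hom A U W"
  shows "linear_map K (hom_space A W M) (hom_space A U M) (\<lambda>f. \<lambda>x\<in>carrier U. f (h x))"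
proof (intro linear_mapI vectorspace_hom_space assms module_homI; unfold hom_space_simps)
  show "(\<lambda>x\<in>carrier U. f (h x)) \<in> Hom A U M" if "f \<in> Hom A W M" for f
    by (intro restrict_Hom hom_comp[OF Hom_module_hom[OF that] h] assms)
  show "(\<lambda>x\<in>carrier U. (\<lambda>x\<in>carrier W. f x \<oplus>\<^bsub>M\<^esub> g x) (h x)) =
      (\<lambda>x\<in>carrier U. (\<lambda>x\<in>carrier U. f (h x)) x \<oplus>\<^bsub>M\<^esub> (\<lambda>x\<in>carrier U. g (h x)) x)" for f g
    by (intro restrict_ext) (simp add: hom_closed[OF h])
  show "(\<lambda>x\<in>carrier U. (\<lambda>x\<in>carrier W. (c \<odot>\<^bsub>A\<^esub> \<one>\<^bsub>A\<^esub>) \<odot>\<^bsub>M\<^esub> f x) (h x)) =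
      (\<lambda>x\<in>carrier U. (c \<odot>\<^bsub>A\<^esub> \<one>\<^bsub>A\<^esub>) \<odot>\<^bsub>M\<^esub> (\<lambda>x\<in>carrier U. f (h x)) x)" for c f
    by (intro restrict_ext) (simp add: hom_closed[OF h])
qed

text \<open>Left exactness of \<open>Hom(U, _)\<close>, in terms of dimensions: equality means that every homomorphism
  from \<open>U\<close> to \<open>N\<close> lifts along \<open>g\<close>.\<close>

lemma hom_dim_left_exact:
  assumes fd: "fd_module K A U" "fd_module K A L" "fd_module K A M" "fd_module K A N"
    and j: "j \<in> module_hom A L M" "inj_on j (carrier L)"
    and g: "g \<in> module_hom A M N" and exact: "j ` carrier L = {x \<in> carrier M. g x = \<zero>\<^bsub>N\<^esub>}"
  shows hom_dim_left_exact_le: "hom_dim U M \<le> hom_dim U L + hom_dim U N" (is ?le)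
    and hom_dim_left_exact_eq_iff: "hom_dim U M = hom_dim U L + hom_dim U N \<longleftrightarrow>
      (\<forall>h\<in>module_hom A U N. \<exists>l\<in>module_hom A U M. \<forall>x\<in>carrier U. g (l x) = h x)" (is "?eq \<longleftrightarrow> ?lift")
proof -
  note lm = fd[THEN fd_module_left_module]
  interpret j: left_module_hom A L M j by (intro left_module_homI lm j)
  interpret g: left_module_hom A M N g by (intro left_module_homI lm g)
  let ?j = "\<lambda>f. \<lambda>x\<in>carrier U. j (f x)" and ?g = "\<lambda>f. \<lambda>x\<in>carrier U. g (f x)"
  have lj: "linear_map K (hom_space A U L) (hom_space A U M) ?j"
    and lg: "linear_map K (hom_space A U M) (hom_space A U N) ?g"
    by (intro linear_map_postcompose lm j g)+
  interpret lj: linear_map K "hom_space A U L" "hom_space A U M" ?j by (rule lj)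
  interpret lg: linear_map K "hom_space A U M" "hom_space A U N" ?g by (rule lg)
  have gj: "g (j x) = \<zero>\<^bsub>N\<^esub>" if "x \<in> carrier L" for x using exact that by auto
  have inj: "inj_on ?j (carrier (hom_space A U L))"
  proof (rule inj_onI, unfold hom_space_simps)
    fix f h assume fh: "f \<in> Hom A U L" "h \<in> Hom A U L" "?j f = ?j h"
    show "f = h"
    proof (rule Hom_eqI[OF fh(1,2)])
      fix x assume x: "x \<in> carrier U"
      then have "j (f x) = j (h x)" using fun_cong[OF fh(3), of x] by simp
      then show "f x = h x" using inj_onD[OF j(2)] x fh by (meson Hom_closed)
    qed
  qed
  have im: "?j ` carrier (hom_space A U L) =
      {f \<in> carrier (hom_space A U M). ?g f = \<zero>\<^bsub>hom_space A U N\<^esub>}"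
  proof (intro subset_antisym subsetI)
    fix h assume "h \<in> ?j ` carrier (hom_space A U L)"
    then obtain f where f: "f \<in> Hom A U L" "h = ?j f" by auto
    moreover have "h \<in> Hom A U M" using lj.T_im[of f] f by simp
    ultimately show "h \<in> {f \<in> carrier (hom_space A U M). ?g f = \<zero>\<^bsub>hom_space A U N\<^esub>}"
      by (auto simp: gj Hom_closed intro!: restrict_ext)
  next
    fix h assume "h \<in> {f \<in> carrier (hom_space A U M). ?g f = \<zero>\<^bsub>hom_space A U N\<^esub>}"
    then have h: "h \<in> Hom A U M" "?g h = (\<lambda>x\<in>carrier U. \<zero>\<^bsub>N\<^esub>)" by auto
    have "h x \<in> j ` carrier L" if "x \<in> carrier U" for x
      using that h(1) fun_cong[OF h(2), of x] unfolding exact by (simp add: Hom_closed)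
    then obtain f where f: "f \<in> module_hom A U L" "\<And>x. x \<in> carrier U \<Longrightarrow> j (f x) = h x"
      using hom_factor_inj[OF lm(2,3,1) j Hom_module_hom[OF h(1)]] by blast
    have fH: "(\<lambda>x\<in>carrier U. f x) \<in> Hom A U L" by (intro restrict_Hom lm f)
    have eq: "?j (\<lambda>x\<in>carrier U. f x) = h"
      by (rule Hom_eqI[OF _ h(1)]) (use lj.T_im[of "\<lambda>x\<in>carrier U. f x"] fH f in auto)
    show "h \<in> ?j ` carrier (hom_space A U L)"
      by (rule rev_image_eqI[of "\<lambda>x\<in>carrier U. f x"], simp add: fH, rule eq[symmetric])
  qed
  show ?le unfolding hom_dim_def
    by (rule left_exact_dim_le[OF lj lg _ _ _ inj im]) (intro fin_dim_hom_space fd)+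
  have "?eq \<longleftrightarrow> ?g ` carrier (hom_space A U M) = carrier (hom_space A U N)"
    unfolding hom_dim_def
    by (rule left_exact_dim_eq_iff[OF lj lg _ _ _ inj im]) (intro fin_dim_hom_space fd)+
  also have "\<dots> \<longleftrightarrow> ?lift"
  proof
    assume surj: "?g ` carrier (hom_space A U M) = carrier (hom_space A U N)"
    show ?lift
    proof
      fix h assume "h \<in> module_hom A U N"
      then have "(\<lambda>x\<in>carrier U. h x) \<in> Hom A U N" by (intro restrict_Hom lm)
      then obtain l where l: "l \<in> Hom A U M" "(\<lambda>x\<in>carrier U. h x) = ?g l" using surj by auto
      have "g (l x) = h x" if "x \<in> carrier U" for x using fun_cong[OF l(2), of x] that by simp
      then show "\<exists>l\<in>module_hom A U M. \<forall>x\<in>carrier U. g (l x) = h x"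
        using Hom_module_hom[OF l(1)] by blast
    qed
  next
    assume lift: ?lift
    show "?g ` carrier (hom_space A U M) = carrier (hom_space A U N)"
    proof (intro subset_antisym subsetI)
      fix h assume "h \<in> ?g ` carrier (hom_space A U M)"
      then show "h \<in> carrier (hom_space A U N)" using lg.T_im by auto
    next
      fix h assume "h \<in> carrier (hom_space A U N)"
      then have h: "h \<in> Hom A U N" by simp
      then obtain l where l: "l \<in> module_hom A U M" "\<forall>x\<in>carrier U. g (l x) = h x"
        using lift Hom_module_hom by blast
      have lH: "(\<lambda>x\<in>carrier U. l x) \<in> Hom A U M" by (intro restrict_Hom lm l)
      have eq: "?g (\<lambda>x\<in>carrier U. l x) = h"
        by (rule Hom_eqI[OF _ h]) (use lg.T_im[of "\<lambda>x\<in>carrier U. l x"] lH l in auto)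
      show "h \<in> ?g ` carrier (hom_space A U M)"
        by (rule rev_image_eqI[of "\<lambda>x\<in>carrier U. l x"], simp add: lH, rule eq[symmetric])
    qed
  qed
  finally show "?eq \<longleftrightarrow> ?lift" .
qed

text \<open>Dually, for \<open>Hom(_, V)\<close> equality means that every homomorphism from \<open>M\<close> to \<open>V\<close> extends along
  \<open>f\<close>.\<close>

lemma hom_dim_right_exact:
  assumes fd: "fd_module K A V" "fd_module K A M" "fd_module K A W" "fd_module K A C"
    and f: "f \<in> module_hom A M W"
    and p: "p \<in> module_hom A W C" "p ` carrier W = carrier C"
    and exact: "f ` carrier M = {x \<in> carrier W. p x = \<zero>\<^bsub>C\<^esub>}"
  shows hom_dim_right_exact_le: "hom_dim W V \<le> hom_dim C V + hom_dim M V" (is ?le)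
    and hom_dim_right_exact_eq_iff: "hom_dim W V = hom_dim C V + hom_dim M V \<longleftrightarrow>
      (\<forall>h\<in>module_hom A M V. \<exists>l\<in>module_hom A W V. \<forall>x\<in>carrier M. l (f x) = h x)" (is "?eq \<longleftrightarrow> ?ext")
proof -
  note lm = fd[THEN fd_module_left_module]
  interpret f: left_module_hom A M W f by (intro left_module_homI lm f)
  interpret p: left_module_hom A W C p by (intro left_module_homI lm p)
  let ?p = "\<lambda>h. \<lambda>x\<in>carrier W. h (p x)" and ?f = "\<lambda>h. \<lambda>x\<in>carrier M. h (f x)"
  have lp: "linear_map K (hom_space A C V) (hom_space A W V) ?p"
    and lf: "linear_map K (hom_space A W V) (hom_space A M V) ?f"
    by (intro linear_map_precompose lm f p)+
  interpret lp: linear_map K "hom_space A C V" "hom_space A W V" ?p by (rule lp)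
  interpret lf: linear_map K "hom_space A W V" "hom_space A M V" ?f by (rule lf)
  interpret V: left_module A V by (rule lm)
  have pf: "p (f x) = \<zero>\<^bsub>C\<^esub>" if "x \<in> carrier M" for x using exact that by auto
  have inj: "inj_on ?p (carrier (hom_space A C V))"
  proof (rule inj_onI, unfold hom_space_simps)
    fix g h assume gh: "g \<in> Hom A C V" "h \<in> Hom A C V" "?p g = ?p h"
    show "g = h"
    proof (rule Hom_eqI[OF gh(1,2)])
      fix y assume "y \<in> carrier C"
      then obtain x where x: "x \<in> carrier W" "y = p x" using p(2) by auto
      then show "g y = h y" using fun_cong[OF gh(3), of x] by simp
    qed
  qed
  have im: "?p ` carrier (hom_space A C V) =
      {h \<in> carrier (hom_space A W V). ?f h = \<zero>\<^bsub>hom_space A M V\<^esub>}"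
  proof (intro subset_antisym subsetI)
    fix h assume "h \<in> ?p ` carrier (hom_space A C V)"
    then obtain g where g: "g \<in> Hom A C V" "h = ?p g" by auto
    interpret g: left_module_hom A C V g by (intro left_module_homI lm Hom_module_hom g)
    have "h \<in> Hom A W V" using lp.T_im[of g] g by simp
    then show "h \<in> {h \<in> carrier (hom_space A W V). ?f h = \<zero>\<^bsub>hom_space A M V\<^esub>}"
      using g by (auto simp: pf intro!: restrict_ext)
  next
    fix h assume "h \<in> {h \<in> carrier (hom_space A W V). ?f h = \<zero>\<^bsub>hom_space A M V\<^esub>}"
    then have h: "h \<in> Hom A W V" "?f h = (\<lambda>x\<in>carrier M. \<zero>\<^bsub>V\<^esub>)" by auto
    have "h x = \<zero>\<^bsub>V\<^esub>" if x: "x \<in> carrier W" "p x = \<zero>\<^bsub>C\<^esub>" for x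
    proof -
      have "x \<in> f ` carrier M" using exact x by auto
      then obtain m where "m \<in> carrier M" "x = f m" by auto
      then show ?thesis using fun_cong[OF h(2), of m] by simp
    qed
    then obtain g where g: "g \<in> module_hom A C V" "\<And>x. x \<in> carrier W \<Longrightarrow> g (p x) = h x"
      using hom_factor_surj[OF lm(3,4,1) p Hom_module_hom[OF h(1)]] by blast
    have gH: "(\<lambda>x\<in>carrier C. g x) \<in> Hom A C V" by (intro restrict_Hom lm g)
    have eq: "?p (\<lambda>x\<in>carrier C. g x) = h"
      by (rule Hom_eqI[OF _ h(1)]) (use lp.T_im[of "\<lambda>x\<in>carrier C. g x"] gH g in auto)
    show "h \<in> ?p ` carrier (hom_space A C V)"
      by (rule rev_image_eqI[of "\<lambda>x\<in>carrier C. g x"], simp add: gH, rule eq[symmetric])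
  qed
  show ?le unfolding hom_dim_def
    by (rule left_exact_dim_le[OF lp lf _ _ _ inj im]) (intro fin_dim_hom_space fd)+
  have "?eq \<longleftrightarrow> ?f ` carrier (hom_space A W V) = carrier (hom_space A M V)"
    unfolding hom_dim_def
    by (rule left_exact_dim_eq_iff[OF lp lf _ _ _ inj im]) (intro fin_dim_hom_space fd)+
  also have "\<dots> \<longleftrightarrow> ?ext"
  proof
    assume surj: "?f ` carrier (hom_space A W V) = carrier (hom_space A M V)"
    show ?ext
    proof
      fix h assume "h \<in> module_hom A M V"
      then have "(\<lambda>x\<in>carrier M. h x) \<in> Hom A M V" by (intro restrict_Hom lm)
      then obtain l where l: "l \<in> Hom A W V" "(\<lambda>x\<in>carrier M. h x) = ?f l" using surj by auto
      have "l (f x) = h x" if "x \<in> carrier M" for x using fun_cong[OF l(2), of x] that by simp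
      then show "\<exists>l\<in>module_hom A W V. \<forall>x\<in>carrier M. l (f x) = h x"
        using Hom_module_hom[OF l(1)] by blast
    qed
  next
    assume ext: ?ext
    show "?f ` carrier (hom_space A W V) = carrier (hom_space A M V)"
    proof (intro subset_antisym subsetI)
      fix h assume "h \<in> ?f ` carrier (hom_space A W V)"
      then show "h \<in> carrier (hom_space A M V)" using lf.T_im by auto
    next
      fix h assume "h \<in> carrier (hom_space A M V)"
      then have h: "h \<in> Hom A M V" by simp
      then obtain l where l: "l \<in> module_hom A W V" "\<forall>x\<in>carrier M. l (f x) = h x"
        using ext Hom_module_hom by blast
      have lH: "(\<lambda>x\<in>carrier W. l x) \<in> Hom A W V" by (intro restrict_Hom lm l)
      have eq: "?f (\<lambda>x\<in>carrier W. l x) = h"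
        by (rule Hom_eqI[OF _ h]) (use lf.T_im[of "\<lambda>x\<in>carrier W. l x"] lH l in auto)
      show "h \<in> ?f ` carrier (hom_space A W V)"
        by (rule rev_image_eqI[of "\<lambda>x\<in>carrier W. l x"], simp add: lH, rule eq[symmetric])
    qed
  qed
  finally show "?eq \<longleftrightarrow> ?ext" .
qed

end

lemma mod_isoE_bij:
  assumes "mod_iso R M N"
  obtains f where "f \<in> module_hom R M N" "inj_on f (carrier M)" "f ` carrier M = carrier N"
proof -
  obtain f g where fg: "f \<in> module_hom R M N" "g \<in> module_hom R N M"
    "\<And>x. x \<in> carrier M \<Longrightarrow> g (f x) = x" "\<And>y. y \<in> carrier N \<Longrightarrow> f (g y) = y"
    using mod_isoE[OF assms] by blast
  have "bij_betw f (carrier M) (carrier N)"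
    by (rule bij_betw_byWitness[where f' = g]) (use fg hom_closed[OF fg(1)] hom_closed[OF fg(2)] in auto)
  then show ?thesis using fg(1) that by (auto simp: bij_betw_def)
qed

context fd_algebra
begin

lemma hom_dim_zero_right:
  assumes U: "fd_module K A U" and Z: "fd_module K A Z" "carrier Z = {\<zero>\<^bsub>Z\<^esub>}"
  shows "hom_dim U Z = 0"
proof -
  note lZ = Z(1)[THEN fd_module_left_module]
  have "hom_dim U Z = hom_dim U Z + hom_dim U Z"
  proof (subst hom_dim_left_exact_eq_iff[OF U Z(1) Z(1) Z(1) hom_id _ hom_zero[OF lZ]])
    show "\<forall>h\<in>module_hom A U Z. \<exists>l\<in>module_hom A U Z. \<forall>x\<in>carrier U. \<zero>\<^bsub>Z\<^esub> = h x"
    proof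
      fix h assume h: "h \<in> module_hom A U Z"
      then show "\<exists>l\<in>module_hom A U Z. \<forall>x\<in>carrier U. \<zero>\<^bsub>Z\<^esub> = h x"
        using hom_closed[OF h] Z(2) by (intro bexI[OF _ h]) simp
    qed
  qed auto
  then show ?thesis by simp
qed

lemma hom_dim_zero_left:
  assumes V: "fd_module K A V" and Z: "fd_module K A Z" "carrier Z = {\<zero>\<^bsub>Z\<^esub>}"
  shows "hom_dim Z V = 0"
proof -
  note lZ = Z(1)[THEN fd_module_left_module]
  have "hom_dim Z V = hom_dim Z V + hom_dim Z V"
  proof (subst hom_dim_right_exact_eq_iff[OF V Z(1) Z(1) Z(1) hom_id hom_zero[OF lZ]])
    show "\<forall>h\<in>module_hom A Z V. \<exists>l\<in>module_hom A Z V. \<forall>x\<in>carrier Z. l x = h x" by blast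
  qed (use Z(2) in auto)
  then show ?thesis by simp
qed

lemma hom_dim_direct_sum_right:
  assumes U: "fd_module K A U" and M: "fd_module K A M" and N: "fd_module K A N"
  shows "hom_dim U (direct_sum M N) = hom_dim U M + hom_dim U N"
proof -
  note lm = M[THEN fd_module_left_module] N[THEN fd_module_left_module]
  interpret M: left_module A M by (rule lm)
  interpret N: left_module A N by (rule lm)
  show ?thesis
  proof (subst hom_dim_left_exact_eq_iff[OF U M fd_module_direct_sum[OF M N] N hom_inl[OF lm(2)] _ hom_snd])
    show "\<forall>h\<in>module_hom A U N. \<exists>l\<in>module_hom A U (direct_sum M N). \<forall>x\<in>carrier U. snd (l x) = h x"
    proof
      fix h assume "h \<in> module_hom A U N"
      then show "\<exists>l\<in>module_hom A U (direct_sum M N). \<forall>x\<in>carrier U. snd (l x) = h x"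
        by (intro bexI[of _ "\<lambda>x. (\<zero>\<^bsub>M\<^esub>, h x)"] hom_pair hom_zero lm) simp_all
    qed
  qed (auto intro: inj_onI)
qed

lemma hom_dim_direct_sum_left:
  assumes V: "fd_module K A V" and M: "fd_module K A M" and N: "fd_module K A N"
  shows "hom_dim (direct_sum M N) V = hom_dim M V + hom_dim N V"
proof -
  note lm = M[THEN fd_module_left_module] N[THEN fd_module_left_module]
  interpret M: left_module A M by (rule lm)
  interpret N: left_module A N by (rule lm)
  have "hom_dim (direct_sum M N) V = hom_dim N V + hom_dim M V"
  proof (subst hom_dim_right_exact_eq_iff[OF V M fd_module_direct_sum[OF M N] N hom_inl[OF lm(2)] hom_snd])
    show "\<forall>h\<in>module_hom A M V. \<exists>l\<in>module_hom A (direct_sum M N) V. \<forall>x\<in>carrier M. l (x, \<zero>\<^bsub>N\<^esub>) = h x"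
    proof
      fix h assume h: "h \<in> module_hom A M V"
      show "\<exists>l\<in>module_hom A (direct_sum M N) V. \<forall>x\<in>carrier M. l (x, \<zero>\<^bsub>N\<^esub>) = h x"
        by (intro bexI[OF _ hom_comp[OF h hom_fst]]) simp
    qed
    show "snd ` carrier (direct_sum M N) = carrier N" using M.zero_closed by force
  qed auto
  then show ?thesis by simp
qed

lemma hom_dim_iso_right:
  assumes U: "fd_module K A U" and M: "fd_module K A M" and N: "fd_module K A N" and iso: "mod_iso A M N"
  shows "hom_dim U M = hom_dim U N"
proof -
  obtain f where f: "f \<in> module_hom A M N" "inj_on f (carrier M)" "f ` carrier M = carrier N"
    by (rule mod_isoE_bij[OF iso])
  obtain Z where Z: "Z \<in> Amod K A" "carrier Z = {\<zero>\<^bsub>Z\<^esub>}" by (rule obtain_zero_module)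
  note fZ = Amod_fd_module[OF Z(1)]
  have "hom_dim U N = hom_dim U M + hom_dim U Z"
  proof (subst hom_dim_left_exact_eq_iff[OF U M N fZ f(1,2) hom_zero[OF fd_module_left_module[OF fZ]]])
    show "\<forall>h\<in>module_hom A U Z. \<exists>l\<in>module_hom A U N. \<forall>x\<in>carrier U. \<zero>\<^bsub>Z\<^esub> = h x"
    proof
      fix h assume h: "h \<in> module_hom A U Z"
      show "\<exists>l\<in>module_hom A U N. \<forall>x\<in>carrier U. \<zero>\<^bsub>Z\<^esub> = h x"
        using hom_closed[OF h] Z(2)
        by (intro bexI[OF _ hom_zero[OF fd_module_left_module[OF N]]]) simp
    qed
  qed (use f(3) in auto)
  then show ?thesis using hom_dim_zero_right[OF U fZ Z(2)] by simp
qed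

lemma hom_dim_iso_left:
  assumes V: "fd_module K A V" and M: "fd_module K A M" and N: "fd_module K A N" and iso: "mod_iso A M N"
  shows "hom_dim M V = hom_dim N V"
proof -
  obtain f where f: "f \<in> module_hom A M N" "inj_on f (carrier M)" "f ` carrier M = carrier N"
    by (rule mod_isoE_bij[OF iso])
  obtain Z where Z: "Z \<in> Amod K A" "carrier Z = {\<zero>\<^bsub>Z\<^esub>}" by (rule obtain_zero_module)
  note fZ = Amod_fd_module[OF Z(1)]
  note lm = V[THEN fd_module_left_module] M[THEN fd_module_left_module] N[THEN fd_module_left_module]
    fZ[THEN fd_module_left_module]
  interpret f: left_module_hom A M N f by (intro left_module_homI lm f)
  interpret Z: left_module A Z by (rule lm)
  have "hom_dim M V = hom_dim N V + hom_dim Z V"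
  proof (subst hom_dim_right_exact_eq_iff[OF V fZ M N hom_zero[OF lm(2)] f(1,3)])
    show "\<forall>h\<in>module_hom A Z V. \<exists>l\<in>module_hom A M V. \<forall>x\<in>carrier Z. l \<zero>\<^bsub>M\<^esub> = h x"
    proof
      fix h assume h: "h \<in> module_hom A Z V"
      interpret h: left_module_hom A Z V h by (intro left_module_homI lm h)
      show "\<exists>l\<in>module_hom A M V. \<forall>x\<in>carrier Z. l \<zero>\<^bsub>M\<^esub> = h x"
        using Z(2) by (intro bexI[OF _ hom_zero[OF lm(1)]]) auto
    qed
    show "(\<lambda>x. \<zero>\<^bsub>M\<^esub>) ` carrier Z = {x \<in> carrier M. f x = \<zero>\<^bsub>N\<^esub>}"
      using Z(2) f(2) unfolding f.inj_iff by auto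
  qed
  then show ?thesis using hom_dim_zero_left[OF V fZ Z(2)] by simp
qed

lemma hom_dim_self_eq_zero:
  assumes N: "fd_module K A N" and 0: "hom_dim N N = 0"
  shows "carrier N = {\<zero>\<^bsub>N\<^esub>}"
proof -
  obtain Z where Z: "Z \<in> Amod K A" "carrier Z = {\<zero>\<^bsub>Z\<^esub>}" by (rule obtain_zero_module)
  note fZ = Amod_fd_module[OF Z(1)]
  interpret N: left_module A N by (rule fd_module_left_module[OF N])
  have "hom_dim N Z = hom_dim N Z + hom_dim N N" using 0 by simp
  then have "\<forall>h\<in>module_hom A N N. \<exists>l\<in>module_hom A N Z. \<forall>x\<in>carrier N. \<zero>\<^bsub>N\<^esub> = h x"
    by (subst (asm) hom_dim_left_exact_eq_iff[OF N fZ fZ N hom_id _ hom_zero[OF N.left_module_axioms]])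
      (use Z in auto)
  from bspec[OF this hom_id] show ?thesis using N.zero_closed by fastforce
qed

end

section \<open>Fitting's lemma and indecomposable modules\<close>

text \<open>If \<open>T\<close> and \<open>T\<^sup>2\<close> have the same kernel, then they have the same image, by rank and nullity.\<close>

lemma linear_map_image_stable:
  assumes T: "linear_map K V V T" and fd: "vectorspace.fin_dim K V"
    and stable: "\<And>v. \<lbrakk>v \<in> carrier V; T (T v) = \<zero>\<^bsub>V\<^esub>\<rbrakk> \<Longrightarrow> T v = \<zero>\<^bsub>V\<^esub>"
    and v: "v \<in> carrier V"
  obtains w where "w \<in> carrier V" "T v = T (T w)"
proof -
  interpret T: linear_map K V V T by (rule T)
  have "(\<lambda>x. T (T x)) \<in> module_hom K V V" by (rule hom_comp[OF T.T_hom T.T_hom])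
  then have "linear_map K V V (\<lambda>x. T (T x))" by (intro linear_mapI T.V.vectorspace_axioms)
  then interpret TT: linear_map K V V "\<lambda>x. T (T x)" .
  have ker: "TT.ker = T.ker" unfolding TT.ker_def T.ker_def using stable by auto
  have dims: "vectorspace.dim K (V\<lparr>carrier := TT.im\<rparr>) = vectorspace.dim K (V\<lparr>carrier := T.im\<rparr>)"
    using T.rank_nullity_main(1)[OF fd] TT.rank_nullity_main(1)[OF fd] unfolding ker by simp
  interpret im: vectorspace K "V\<lparr>carrier := T.im\<rparr>"
    by (rule T.V.subspace_is_vs[OF T.imT_is_subspace])
  have fd_im: "im.fin_dim" by (rule T.V.subspace_fin_dim[OF fd T.imT_is_subspace])
  have "submodule K TT.im (V\<lparr>carrier := T.im\<rparr>)"
  proof -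
    interpret S: submodule K TT.im V by (rule TT.im_is_submodule)
    have "TT.im \<subseteq> T.im" unfolding TT.im_def T.im_def by auto
    then show ?thesis using S.m_closed S.zero_closed S.smult_closed
      by (intro submodule.intro im.module_axioms) auto
  qed
  then have "subspace K TT.im (V\<lparr>carrier := T.im\<rparr>)"
    by (intro subspace.intro im.vectorspace_axioms)
  from im.subspace_dim_eq[OF fd_im this] dims have "TT.im = T.im" by simp
  moreover have "T v \<in> T.im" using v by (simp add: T.im_def)
  ultimately obtain w where "w \<in> carrier V" "T v = T (T w)" unfolding TT.im_def by auto
  then show ?thesis by (rule that)
qed

lemma hom_funpow: "u \<in> module_hom R M M \<Longrightarrow> (u ^^ n) \<in> module_hom R M M"
proof (induction n)
  case 0
  then show ?case using hom_id[of R M] by (simp add: id_def)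
next
  case (Suc n)
  then show ?case using hom_comp[of u R M M "u ^^ n" M] by (simp add: comp_def)
qed

context fd_algebra
begin

lemma kernel_funpow_stable:
  assumes M: "fd_module K A M" and u: "u \<in> module_hom A M M"
  obtains n where "n > 0"
    "\<And>x. \<lbrakk>x \<in> carrier M; (u ^^ n) ((u ^^ n) x) = \<zero>\<^bsub>M\<^esub>\<rbrakk> \<Longrightarrow> (u ^^ n) x = \<zero>\<^bsub>M\<^esub>"
proof -
  note lM = fd_module_left_module[OF M]
  interpret V: vectorspace K "restrict_scalars A M" by (rule restrict_scalars_vs[OF lM])
  have fd: "V.fin_dim" using M by (simp add: fd_module_def)
  define k where "k n = {x \<in> carrier M. (u ^^ n) x = \<zero>\<^bsub>M\<^esub>}" for n
  have k: "subspace K (k n) (restrict_scalars A M)" for n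
  proof -
    interpret u: linear_map K "restrict_scalars A M" "restrict_scalars A M" "u ^^ n"
      by (intro restrict_scalars_linear_map lM hom_funpow u)
    show ?thesis using u.kerT_is_subspace by (simp add: u.ker_def k_def)
  qed
  define d where "d n = vectorspace.dim K (restrict_scalars A M\<lparr>carrier := k n\<rparr>)" for n
  have "d n < Suc V.dim" for n unfolding d_def using V.subspace_dim_le[OF fd k] by (simp add: less_Suc_eq_le)
  \<comment> \<open>Choose \<open>n\<close> such that the kernel of \<open>u\<^sup>n\<close> has maximal dimension.\<close>
  then obtain n where n: "n > 0" "\<And>m. m > 0 \<Longrightarrow> d m \<le> d n"
    using ex_has_greatest_nat[of "\<lambda>n. n > 0" 1 d "Suc V.dim"] by auto
  interpret k2: vectorspace K "restrict_scalars A M\<lparr>carrier := k (n + n)\<rparr>"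
    by (rule V.subspace_is_vs[OF k])
  interpret un: left_module_hom A M M "u ^^ n" by (intro left_module_homI lM hom_funpow u)
  have "k n \<subseteq> k (n + n)" by (auto simp: k_def funpow_add)
  moreover have "submodule K (k n) (restrict_scalars A M)" by (rule V.is_module[OF k])
  ultimately have "submodule K (k n) (restrict_scalars A M\<lparr>carrier := k (n + n)\<rparr>)"
    using k2.module_axioms unfolding submodule_def by auto
  then have sub: "subspace K (k n) (restrict_scalars A M\<lparr>carrier := k (n + n)\<rparr>)"
    by (intro subspace.intro k2.vectorspace_axioms)
  have fd2: "k2.fin_dim" by (rule V.subspace_fin_dim[OF fd k])
  have "d (n + n) \<le> d n" using n by simp
  moreover have "d n \<le> d (n + n)" using k2.subspace_dim_le[OF fd2 sub] by (simp add: d_def)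
  ultimately have "k n = k (n + n)"
    using k2.subspace_dim_eq[OF fd2 sub] by (simp add: d_def)
  then show ?thesis using n(1) that unfolding k_def by (auto simp: funpow_add)
qed

text \<open>Fitting's lemma: some power \<open>u\<^sup>n\<close> splits the module into its kernel and its image; \<open>e\<close> is the
  projection onto the kernel along the image.\<close>

lemma Fitting_projection:
  assumes M: "fd_module K A M" and u: "u \<in> module_hom A M M"
  obtains n e where "n > 0" "e \<in> module_hom A M M"
    "\<And>x. x \<in> carrier M \<Longrightarrow> (u ^^ n) (e x) = \<zero>\<^bsub>M\<^esub>"
    "\<And>x. \<lbrakk>x \<in> carrier M; (u ^^ n) x = \<zero>\<^bsub>M\<^esub>\<rbrakk> \<Longrightarrow> e x = x"
    "\<And>x. x \<in> carrier M \<Longrightarrow> \<exists>y\<in>carrier M. x = e x \<oplus>\<^bsub>M\<^esub> (u ^^ n) y"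
    "\<And>x. \<lbrakk>x \<in> carrier M; (u ^^ n) ((u ^^ n) x) = \<zero>\<^bsub>M\<^esub>\<rbrakk> \<Longrightarrow> (u ^^ n) x = \<zero>\<^bsub>M\<^esub>"
proof -
  note lM = fd_module_left_module[OF M]
  obtain n where n: "n > 0"
    "\<And>x. \<lbrakk>x \<in> carrier M; (u ^^ n) ((u ^^ n) x) = \<zero>\<^bsub>M\<^esub>\<rbrakk> \<Longrightarrow> (u ^^ n) x = \<zero>\<^bsub>M\<^esub>"
    using kernel_funpow_stable[OF M u] by blast
  define T where "T = u ^^ n"
  have T: "T \<in> module_hom A M M" unfolding T_def by (rule hom_funpow[OF u])
  interpret T: left_module_hom A M M T by (intro left_module_homI lM T)
  have stable: "T x = \<zero>\<^bsub>M\<^esub>" if "x \<in> carrier M" "T (T x) = \<zero>\<^bsub>M\<^esub>" for x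
    using n(2)[of x] that by (simp add: T_def)
  have ex: "\<exists>w. w \<in> carrier M \<and> T x = T (T w)" if x: "x \<in> carrier M" for x
  proof -
    have "linear_map K (restrict_scalars A M) (restrict_scalars A M) T"
      by (intro restrict_scalars_linear_map lM T)
    from linear_map_image_stable[OF this, of x]
    show ?thesis using M x stable by (auto simp: fd_module_def)
  qed
  define w where "w x = (SOME w. w \<in> carrier M \<and> T x = T (T w))" for x
  have wc: "w x \<in> carrier M" and wT: "T (T (w x)) = T x" if "x \<in> carrier M" for x
    using someI_ex[OF ex[OF that], folded w_def] by simp_all
  \<comment> \<open>The value \<open>e x\<close> does not depend on the choice of \<open>w x\<close>, which makes \<open>e\<close> a homomorphism.\<close>
  define e where "e x = x \<ominus>\<^bsub>M\<^esub> T (w x)" for x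
  have e_closed: "e x \<in> carrier M" if "x \<in> carrier M" for x using wc that by (simp add: e_def)
  have Te: "T (e x) = \<zero>\<^bsub>M\<^esub>" if "x \<in> carrier M" for x
    using wc[OF that] wT[OF that] that by (simp add: e_def T.M.diff_self)
  have unique: "e x = z"
    if x: "x \<in> carrier M" and z: "z \<in> carrier M" "T z = \<zero>\<^bsub>M\<^esub>" and y: "y \<in> carrier M" "x = z \<oplus>\<^bsub>M\<^esub> T y"
    for x y z
  proof -
    have "T x = T (T y)" using y z by simp
    then have "T (T (y \<ominus>\<^bsub>M\<^esub> w x)) = \<zero>\<^bsub>M\<^esub>" using wc[OF x] wT[OF x] x y(1) by (simp add: T.M.diff_self)
    then have "T (y \<ominus>\<^bsub>M\<^esub> w x) = \<zero>\<^bsub>M\<^esub>" by (rule stable[rotated]) (use wc[OF x] y(1) in simp)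
    then have "T y = T (w x)" using wc[OF x] y(1) by (simp add: T.M.diff_eq_zero_iff)
    moreover have "x \<ominus>\<^bsub>M\<^esub> T y = z" using y z by (simp add: T.M.add_diff_cancel)
    ultimately show ?thesis by (simp add: e_def)
  qed
  have dec: "x = e x \<oplus>\<^bsub>M\<^esub> T (w x)" if "x \<in> carrier M" for x
    using wc[OF that] that by (simp add: e_def T.M.diff_add_cancel)
  have "e \<in> module_hom A M M"
  proof (rule module_homI[OF e_closed])
    fix x y assume xy: "x \<in> carrier M" "y \<in> carrier M"
    have "x \<oplus>\<^bsub>M\<^esub> y = (e x \<oplus>\<^bsub>M\<^esub> e y) \<oplus>\<^bsub>M\<^esub> T (w x \<oplus>\<^bsub>M\<^esub> w y)"
      using xy wc e_closed
      by (subst dec[OF xy(1)], subst dec[OF xy(2)]) (simp add: T.M.a_ac)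
    then show "e (x \<oplus>\<^bsub>M\<^esub> y) = e x \<oplus>\<^bsub>M\<^esub> e y"
      using xy wc e_closed Te by (intro unique[of _ _ "w x \<oplus>\<^bsub>M\<^esub> w y"]) simp_all
  next
    fix a x assume ax: "a \<in> carrier A" "x \<in> carrier M"
    have "a \<odot>\<^bsub>M\<^esub> x = a \<odot>\<^bsub>M\<^esub> e x \<oplus>\<^bsub>M\<^esub> T (a \<odot>\<^bsub>M\<^esub> w x)"
      using ax wc e_closed by (subst dec[OF ax(2)]) (simp add: T.M.smult_r_distr)
    then show "e (a \<odot>\<^bsub>M\<^esub> x) = a \<odot>\<^bsub>M\<^esub> e x"
      using ax wc e_closed Te by (intro unique[of _ _ "a \<odot>\<^bsub>M\<^esub> w x"]) simp_all
  qed
  moreover have "e x = x" if "x \<in> carrier M" "T x = \<zero>\<^bsub>M\<^esub>" for x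
    using that by (intro unique[of _ _ "\<zero>\<^bsub>M\<^esub>"]) simp_all
  moreover have "\<exists>y\<in>carrier M. x = e x \<oplus>\<^bsub>M\<^esub> T y" if "x \<in> carrier M" for x
    using dec[OF that] wc[OF that] by blast
  ultimately show ?thesis using n Te that unfolding T_def by blast
qed

end

text \<open>A nonzero module without nontrivial idempotent endomorphisms.\<close>

definition indecomposable :: "('a, 'q) ring_scheme \<Rightarrow> ('a, 'm, 's) module_scheme \<Rightarrow> bool" where
  "indecomposable R M \<longleftrightarrow> carrier M \<noteq> {\<zero>\<^bsub>M\<^esub>} \<and>
     (\<forall>e\<in>module_hom R M M. (\<forall>x\<in>carrier M. e (e x) = e x) \<longrightarrow>
        (\<forall>x\<in>carrier M. e x = \<zero>\<^bsub>M\<^esub>) \<or> (\<forall>x\<in>carrier M. e x = x))"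

lemma funpow_fixed: "f x = x \<Longrightarrow> (f ^^ n) x = x"
  by (induction n) auto

context fd_algebra
begin

text \<open>By Fitting's lemma, an endomorphism of an indecomposable module is bijective or nilpotent.\<close>

lemma indecomposable_endomorphism:
  assumes M: "fd_module K A M" and ind: "indecomposable A M" and u: "u \<in> module_hom A M M"
  shows "bij_betw u (carrier M) (carrier M) \<or> (\<exists>n. \<forall>x\<in>carrier M. (u ^^ n) x = \<zero>\<^bsub>M\<^esub>)"
proof -
  obtain n e where n: "n > 0" and e: "e \<in> module_hom A M M"
    and Te: "\<And>x. x \<in> carrier M \<Longrightarrow> (u ^^ n) (e x) = \<zero>\<^bsub>M\<^esub>"
    and eT: "\<And>x. \<lbrakk>x \<in> carrier M; (u ^^ n) x = \<zero>\<^bsub>M\<^esub>\<rbrakk> \<Longrightarrow> e x = x"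
    and dec: "\<And>x. x \<in> carrier M \<Longrightarrow> \<exists>y\<in>carrier M. x = e x \<oplus>\<^bsub>M\<^esub> (u ^^ n) y"
    by (rule Fitting_projection[OF M u]) blast
  interpret u: left_module_hom A M M u by (intro left_module_homI fd_module_left_module[OF M] u)
  interpret e: left_module_hom A M M e by (intro left_module_homI fd_module_left_module[OF M] e)
  obtain m where m: "n = Suc m" using n by (cases n) auto
  note um = hom_closed[OF hom_funpow[OF u]]
  have "\<forall>x\<in>carrier M. e (e x) = e x" by (simp add: eT Te)
  then consider "\<forall>x\<in>carrier M. e x = \<zero>\<^bsub>M\<^esub>" | "\<forall>x\<in>carrier M. e x = x"
    using ind e unfolding indecomposable_def by blast
  then show ?thesis
  proof cases
    case 1
    have "inj_on u (carrier M)"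
      unfolding u.inj_iff
    proof (intro ballI impI)
      fix x assume x: "x \<in> carrier M" "u x = \<zero>\<^bsub>M\<^esub>"
      have "(u ^^ m) \<zero>\<^bsub>M\<^esub> = \<zero>\<^bsub>M\<^esub>" by (rule funpow_fixed) simp
      then have "(u ^^ n) x = \<zero>\<^bsub>M\<^esub>" using x by (simp add: m funpow_swap1)
      then show "x = \<zero>\<^bsub>M\<^esub>" using eT[of x] 1 x by simp
    qed
    moreover have "u ` carrier M = carrier M"
    proof (intro subset_antisym subsetI)
      fix x assume x: "x \<in> carrier M"
      then obtain y where y: "y \<in> carrier M" "x = e x \<oplus>\<^bsub>M\<^esub> (u ^^ n) y" using dec by blast
      then have "x = u ((u ^^ m) y)" using 1 x um by (simp add: m)
      then show "x \<in> u ` carrier M" using um y by blast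
    qed auto
    ultimately show ?thesis by (simp add: bij_betw_def)
  next
    case 2
    then show ?thesis using Te by (metis e.closed)
  qed
qed

text \<open>The endomorphism ring of an indecomposable module is local.\<close>

lemma indecomposable_local:
  assumes M: "fd_module K A M" and ind: "indecomposable A M"
    and u: "u \<in> module_hom A M M" and v: "v \<in> module_hom A M M" and w: "w \<in> module_hom A M M"
    and bij: "bij_betw w (carrier M) (carrier M)"
    and sum: "\<And>x. x \<in> carrier M \<Longrightarrow> w x = u x \<oplus>\<^bsub>M\<^esub> v x"
  shows "bij_betw u (carrier M) (carrier M) \<or> bij_betw v (carrier M) (carrier M)"
proof -
  note lM = fd_module_left_module[OF M]
  interpret M: left_module A M by (rule lM)
  obtain t where t: "t \<in> module_hom A M M" "\<And>x. x \<in> carrier M \<Longrightarrow> w (t x) = x"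
    using hom_factor_inj[OF lM lM lM w bij_betw_imp_inj_on[OF bij] hom_id]
      bij_betw_imp_surj_on[OF bij] by blast
  interpret t: left_module_hom A M M t by (intro left_module_homI lM t)
  have tw: "t (w x) = x" if "x \<in> carrier M" for x
    by (rule inj_onD[OF bij_betw_imp_inj_on[OF bij]]) (use that t hom_closed[OF w] in auto)
  let ?u = "\<lambda>x. t (u x)" and ?v = "\<lambda>x. t (v x)"
  have hu: "?u \<in> module_hom A M M" and hv: "?v \<in> module_hom A M M"
    by (intro hom_comp[OF t(1)] u v)+
  have eq: "?u x \<oplus>\<^bsub>M\<^esub> ?v x = x" if "x \<in> carrier M" for x
    using tw[OF that] sum[OF that] that hom_closed[OF u] hom_closed[OF v] by simp
  have lift: "bij_betw s (carrier M) (carrier M)"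
    if s: "s \<in> module_hom A M M" "bij_betw (\<lambda>x. t (s x)) (carrier M) (carrier M)" for s
  proof -
    have "bij_betw (w \<circ> (\<lambda>x. t (s x))) (carrier M) (carrier M)" by (rule bij_betw_trans[OF s(2) bij])
    then show ?thesis
      by (rule iffD1[OF bij_betw_cong, rotated]) (simp add: t(2) hom_closed[OF s(1)])
  qed
  show ?thesis
  proof (rule disjCI)
    assume "\<not> bij_betw v (carrier M) (carrier M)"
    then have "\<not> bij_betw ?v (carrier M) (carrier M)" using lift[OF v] by blast
    then obtain n where n: "\<forall>x\<in>carrier M. (?v ^^ n) x = \<zero>\<^bsub>M\<^esub>"
      using indecomposable_endomorphism[OF M ind hv] by blast
    have inj: "x = \<zero>\<^bsub>M\<^esub>" if x: "x \<in> carrier M" "?u x = \<zero>\<^bsub>M\<^esub>" for x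
    proof -
      have "?v x = x" using eq[OF x(1)] x hom_closed[OF hv x(1)] by simp
      then have "(?v ^^ n) x = x" by (rule funpow_fixed)
      then show ?thesis using n x by simp
    qed
    have "\<not> (\<exists>n. \<forall>x\<in>carrier M. (?u ^^ n) x = \<zero>\<^bsub>M\<^esub>)"
    proof
      assume "\<exists>n. \<forall>x\<in>carrier M. (?u ^^ n) x = \<zero>\<^bsub>M\<^esub>"
      then obtain n where n: "\<forall>x\<in>carrier M. (?u ^^ n) x = \<zero>\<^bsub>M\<^esub>" ..
      have "x = \<zero>\<^bsub>M\<^esub>" if "x \<in> carrier M" "(?u ^^ m) x = \<zero>\<^bsub>M\<^esub>" for m x
        using that
      proof (induction m arbitrary: x)
        case (Suc m)
        then have "?u ((?u ^^ m) x) = \<zero>\<^bsub>M\<^esub>" by simp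
        then have "(?u ^^ m) x = \<zero>\<^bsub>M\<^esub>"
          by (rule inj[OF hom_closed[OF hom_funpow[OF hu] Suc.prems(1)]])
        with Suc.prems(1) show ?case by (rule Suc.IH)
      qed simp
      then have "carrier M = {\<zero>\<^bsub>M\<^esub>}" using n M.zero_closed by blast
      then show False using ind by (simp add: indecomposable_def)
    qed
    then have "bij_betw ?u (carrier M) (carrier M)"
      using indecomposable_endomorphism[OF M ind hu] by blast
    then show "bij_betw u (carrier M) (carrier M)" by (rule lift[OF u])
  qed
qed

text \<open>Induction on \<open>[M, M]\<close>, which decreases strictly when passing to a proper direct summand.\<close>

lemma obtain_indecomposable_summand:
  assumes "M \<in> Amod K A" "carrier M \<noteq> {\<zero>\<^bsub>M\<^esub>}"
  obtains I B where "I \<in> Amod K A" "B \<in> Amod K A" "indecomposable A I" "mod_iso A (direct_sum I B) M"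
proof -
  have "\<exists>I B. I \<in> Amod K A \<and> B \<in> Amod K A \<and> indecomposable A I \<and> mod_iso A (direct_sum I B) M"
    using assms
  proof (induction "hom_dim M M" arbitrary: M rule: less_induct)
    case less
    note fM = Amod_fd_module[OF less.prems(1)]
    note lM = fd_module_left_module[OF fM]
    obtain Z where Z: "Z \<in> Amod K A" "carrier Z = {\<zero>\<^bsub>Z\<^esub>}" by (rule obtain_zero_module)
    show ?case
    proof (cases "indecomposable A M")
      case True
      moreover have "mod_iso A (direct_sum M Z) M"
        by (rule mod_iso_direct_sum_zero[OF fd_module_left_module[OF Amod_fd_module[OF Z(1)]] Z(2)])
      ultimately show ?thesis using Z less.prems by blast
    next
      case False
      then obtain e where e: "e \<in> module_hom A M M" "\<forall>x\<in>carrier M. e (e x) = e x"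
        and e0: "\<not> (\<forall>x\<in>carrier M. e x = \<zero>\<^bsub>M\<^esub>)" and e1: "\<not> (\<forall>x\<in>carrier M. e x = x)"
        using less.prems(2) unfolding indecomposable_def by blast
      interpret e: left_module_hom A M M e by (intro left_module_homI lM e)
      obtain L i where L: "L \<in> Amod K A" "i \<in> module_hom A L M" "inj_on i (carrier L)"
        "i ` carrier L = e ` carrier M"
        using obtain_submodule[OF fM left_submodule_image[OF lM lM e(1)]] by blast
      obtain L' k where L': "L' \<in> Amod K A" "k \<in> module_hom A L' M" "inj_on k (carrier L')"
        "k ` carrier L' = {x \<in> carrier M. e x = \<zero>\<^bsub>M\<^esub>}"
        using obtain_submodule[OF fM left_submodule_kernel[OF lM lM e(1)]] by blast
      note fL = Amod_fd_module[OF L(1)] and fL' = Amod_fd_module[OF L'(1)]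
      note lL = fd_module_left_module[OF fL] and lL' = fd_module_left_module[OF fL']
      interpret i: left_module_hom A L M i by (intro left_module_homI lM lL L)
      interpret k: left_module_hom A L' M k by (intro left_module_homI lM lL' L')
      obtain r where r: "r \<in> module_hom A M L" "\<And>x. x \<in> carrier M \<Longrightarrow> i (r x) = e x"
        using hom_factor_inj[OF lL lM lM L(2,3) e(1)] L(4) by blast
      interpret r: left_module_hom A M L r by (intro left_module_homI lM lL r)
      have ei: "e (i x) = i x" if "x \<in> carrier L" for x
      proof -
        have "i x \<in> e ` carrier M" using L(4) that by blast
        then show ?thesis using e(2) by auto
      qed
      have ri: "r (i x) = x" if "x \<in> carrier L" for x
        by (rule inj_onD[OF L(3)]) (use that in \<open>simp_all add: r(2) ei\<close>)
      have r0: "r x = \<zero>\<^bsub>L\<^esub> \<longleftrightarrow> e x = \<zero>\<^bsub>M\<^esub>" if "x \<in> carrier M" for x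
      proof
        assume "e x = \<zero>\<^bsub>M\<^esub>"
        then show "r x = \<zero>\<^bsub>L\<^esub>" using r(2)[OF that] L(3) that unfolding i.inj_iff by simp
      qed (use r(2)[OF that] in simp)
      have iso: "mod_iso A (direct_sum L L') M"
        by (rule mod_iso_split[OF lL lM lL' L(2) r(1) ri L'(2,3)]) (use L'(4) r0 in auto)
      have L0: "carrier L \<noteq> {\<zero>\<^bsub>L\<^esub>}"
      proof
        assume "carrier L = {\<zero>\<^bsub>L\<^esub>}"
        then have "e ` carrier M = {\<zero>\<^bsub>M\<^esub>}" using L(4) by simp
        then show False using e0 by blast
      qed
      have L'0: "carrier L' \<noteq> {\<zero>\<^bsub>L'\<^esub>}"
      proof
        assume "carrier L' = {\<zero>\<^bsub>L'\<^esub>}"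
        then have ker: "{x \<in> carrier M. e x = \<zero>\<^bsub>M\<^esub>} = {\<zero>\<^bsub>M\<^esub>}" using L'(4) by simp
        have "e x = x" if x: "x \<in> carrier M" for x
        proof -
          have "x \<ominus>\<^bsub>M\<^esub> e x \<in> {x \<in> carrier M. e x = \<zero>\<^bsub>M\<^esub>}" using x e(2) by (simp add: e.M.diff_self)
          then show ?thesis using x by (auto simp: ker e.M.diff_eq_zero_iff)
        qed
        then show False using e1 by blast
      qed
      have fLL': "fd_module K A (direct_sum L L')" by (rule fd_module_direct_sum[OF fL fL'])
      have "hom_dim M M = hom_dim (direct_sum L L') (direct_sum L L')"
        using hom_dim_iso_left[OF fM fLL' fM iso] hom_dim_iso_right[OF fLL' fLL' fM iso] by simp
      also have "\<dots> = hom_dim L L + hom_dim L L' + (hom_dim L' L + hom_dim L' L')"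
        by (simp add: hom_dim_direct_sum_left hom_dim_direct_sum_right fL fL' fLL')
      moreover have "hom_dim L' L' \<noteq> 0" using hom_dim_self_eq_zero[OF fL'] L'0 by blast
      ultimately have "hom_dim L L < hom_dim M M" by simp
      from less.hyps[OF this L(1) L0] obtain I B where IB: "I \<in> Amod K A" "B \<in> Amod K A"
        "indecomposable A I" "mod_iso A (direct_sum I B) L" by blast
      obtain D where D: "D \<in> Amod K A" "mod_iso A (direct_sum B L') D"
        using obtain_Amod_direct_sum[OF Amod_fd_module[OF IB(2)] fL'] .
      have "mod_iso A (direct_sum I D) (direct_sum I (direct_sum B L'))"
        by (intro mod_iso_direct_sum mod_iso_refl mod_iso_sym[OF D(2)])
      also have "mod_iso A \<dots> (direct_sum (direct_sum I B) L')"
        by (rule mod_iso_sym[OF mod_iso_direct_sum_assoc])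
      also have "mod_iso A \<dots> (direct_sum L L')"
        by (intro mod_iso_direct_sum mod_iso_refl IB)
      also note iso
      finally show ?thesis using IB D by blast
    qed
  qed
  then show ?thesis using that by blast
qed

end

section \<open>Modules are determined by dimensions of homomorphism spaces\<close>

context fd_algebra
begin

text \<open>The modules isomorphic to a finite direct sum of copies of \<open>N\<close>.\<close>

inductive power_of :: "('a, 'k list) module \<Rightarrow> ('a, 'k list) module \<Rightarrow> bool" for N where
  zero: "\<lbrakk>W \<in> Amod K A; carrier W = {\<zero>\<^bsub>W\<^esub>}\<rbrakk> \<Longrightarrow> power_of N W"
| step: "\<lbrakk>power_of N W; W' \<in> Amod K A; mod_iso A (direct_sum W N) W'\<rbrakk> \<Longrightarrow> power_of N W'"

lemma power_of_Amod: "power_of N W \<Longrightarrow> W \<in> Amod K A"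
  by (induction rule: power_of.induct)

lemma hom_dim_power_of:
  assumes "power_of N W" and N: "fd_module K A N" and M: "fd_module K A M"
    and eq: "hom_dim N N = hom_dim N M"
  shows "hom_dim W N = hom_dim W M"
  using assms(1)
proof (induction rule: power_of.induct)
  case (zero W)
  then show ?case using hom_dim_zero_left[OF N Amod_fd_module] hom_dim_zero_left[OF M Amod_fd_module] by simp
next
  case (step W W')
  note fW = Amod_fd_module[OF power_of_Amod[OF step.hyps(1)]]
  note fS = fd_module_direct_sum[OF fW N]
  note fW' = Amod_fd_module[OF step.hyps(2)]
  have "hom_dim W' N = hom_dim W N + hom_dim N N"
    using hom_dim_iso_left[OF N fS fW' step.hyps(3)] hom_dim_direct_sum_left[OF N fW N] by simp
  moreover have "hom_dim W' M = hom_dim W M + hom_dim N M"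
    using hom_dim_iso_left[OF M fS fW' step.hyps(3)] hom_dim_direct_sum_left[OF M fW N] by simp
  ultimately show ?case using step.IH eq by simp
qed

text \<open>An indecomposable summand of a power of \<open>N\<close> is a summand of \<open>N\<close>, because its
  endomorphism ring is local.\<close>

lemma indecomposable_summand_of_power:
  assumes "power_of N W" and N: "N \<in> Amod K A" and I: "fd_module K A I" "indecomposable A I"
    and a: "a \<in> module_hom A I W" and b: "b \<in> module_hom A W I"
    and bij: "bij_betw (\<lambda>x. b (a x)) (carrier I) (carrier I)"
  shows "\<exists>f\<in>module_hom A I N. \<exists>g\<in>module_hom A N I. bij_betw (\<lambda>x. g (f x)) (carrier I) (carrier I)"
  using assms(1) a b bij
proof (induction arbitrary: a b rule: power_of.induct)
  case (zero W)
  note lI = fd_module_left_module[OF I(1)]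
  interpret b: left_module_hom A W I b
    using zero by (intro left_module_homI lI fd_module_left_module[OF Amod_fd_module])
  have "b (a x) = \<zero>\<^bsub>I\<^esub>" if "x \<in> carrier I" for x
    using hom_closed[OF zero.prems(1) that] zero.hyps by simp
  then have "carrier I \<subseteq> {\<zero>\<^bsub>I\<^esub>}"
    using bij_betw_imp_surj_on[OF zero.prems(3)] by auto
  then have "carrier I = {\<zero>\<^bsub>I\<^esub>}" using b.N.zero_closed by blast
  then show ?case using I(2) by (simp add: indecomposable_def)
next
  case (step W W')
  note lI = fd_module_left_module[OF I(1)]
  note lW = fd_module_left_module[OF Amod_fd_module[OF power_of_Amod[OF step.hyps(1)]]]
  note lW' = fd_module_left_module[OF Amod_fd_module[OF step.hyps(2)]]
  note lN = fd_module_left_module[OF Amod_fd_module[OF N]]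
  note lS = left_module_direct_sum[OF lW lN]
  obtain \<phi> \<psi> where iso: "\<phi> \<in> module_hom A (direct_sum W N) W'" "\<psi> \<in> module_hom A W' (direct_sum W N)"
    "\<And>x. x \<in> carrier (direct_sum W N) \<Longrightarrow> \<psi> (\<phi> x) = x" "\<And>y. y \<in> carrier W' \<Longrightarrow> \<phi> (\<psi> y) = y"
    using mod_isoE[OF step.hyps(3)] by blast
  interpret phi: left_module_hom A "direct_sum W N" W' \<phi> by (intro left_module_homI lS lW' iso(1))
  interpret psi: left_module_hom A W' "direct_sum W N" \<psi> by (intro left_module_homI lS lW' iso(2))
  interpret a: left_module_hom A I W' a by (rule left_module_homI[OF lI lW' step.prems(1)])
  interpret b: left_module_hom A W' I b by (rule left_module_homI[OF lW' lI step.prems(2)])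
  interpret W: left_module A W by (rule lW)
  interpret N: left_module A N by (rule lN)
  define a1 where "a1 x = fst (\<psi> (a x))" for x
  define a2 where "a2 x = snd (\<psi> (a x))" for x
  define b1 where "b1 w = b (\<phi> (w, \<zero>\<^bsub>N\<^esub>))" for w
  define b2 where "b2 n = b (\<phi> (\<zero>\<^bsub>W\<^esub>, n))" for n
  have a1: "a1 \<in> module_hom A I W" unfolding a1_def
    by (rule hom_comp[OF hom_fst hom_comp[OF iso(2) step.prems(1)]])
  have a2: "a2 \<in> module_hom A I N" unfolding a2_def
    by (rule hom_comp[OF hom_snd hom_comp[OF iso(2) step.prems(1)]])
  have b1: "b1 \<in> module_hom A W I" unfolding b1_def
    by (rule hom_comp[OF step.prems(2) hom_comp[OF iso(1) hom_inl[OF lN]]])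
  have b2: "b2 \<in> module_hom A N I" unfolding b2_def
    by (rule hom_comp[OF step.prems(2) hom_comp[OF iso(1) hom_inr[OF lW]]])
  have sum: "b (a x) = b1 (a1 x) \<oplus>\<^bsub>I\<^esub> b2 (a2 x)" if x: "x \<in> carrier I" for x
  proof -
    have c: "a1 x \<in> carrier W" "a2 x \<in> carrier N" using hom_closed[OF a1 x] hom_closed[OF a2 x] .
    have "a x = \<phi> (\<psi> (a x))" using x by (simp add: iso(4))
    also have "\<psi> (a x) = (a1 x, a2 x)" by (simp add: a1_def a2_def)
    also have "\<dots> = (a1 x, \<zero>\<^bsub>N\<^esub>) \<oplus>\<^bsub>direct_sum W N\<^esub> (\<zero>\<^bsub>W\<^esub>, a2 x)" using c by simp
    also have "\<phi> \<dots> = \<phi> (a1 x, \<zero>\<^bsub>N\<^esub>) \<oplus>\<^bsub>W'\<^esub> \<phi> (\<zero>\<^bsub>W\<^esub>, a2 x)" using c by (intro phi.add) simp_all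
    finally have "b (a x) = b (\<phi> (a1 x, \<zero>\<^bsub>N\<^esub>) \<oplus>\<^bsub>W'\<^esub> \<phi> (\<zero>\<^bsub>W\<^esub>, a2 x))" by simp
    also have "\<dots> = b1 (a1 x) \<oplus>\<^bsub>I\<^esub> b2 (a2 x)" unfolding b1_def b2_def using c by (intro b.add) simp_all
    finally show ?thesis .
  qed
  have "bij_betw (\<lambda>x. b1 (a1 x)) (carrier I) (carrier I) \<or> bij_betw (\<lambda>x. b2 (a2 x)) (carrier I) (carrier I)"
    by (rule indecomposable_local[OF I hom_comp[OF b1 a1] hom_comp[OF b2 a2]
          hom_comp[OF step.prems(2,1)] step.prems(3) sum])
  then show ?case
  proof
    assume "bij_betw (\<lambda>x. b1 (a1 x)) (carrier I) (carrier I)"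
    then show ?thesis by (rule step.IH[OF a1 b1])
  next
    assume "bij_betw (\<lambda>x. b2 (a2 x)) (carrier I) (carrier I)"
    then show ?thesis using a2 b2 by blast
  qed
qed

lemma obtain_power_of_list:
  assumes M: "M \<in> Amod K A" and N: "N \<in> Amod K A" and hs: "set hs \<subseteq> module_hom A M N"
  shows "\<exists>W f. power_of N W \<and> f \<in> module_hom A M W \<and>
    (\<forall>h\<in>set hs. \<exists>l\<in>module_hom A W N. \<forall>x\<in>carrier M. l (f x) = h x)"
  using hs
proof (induction hs)
  case Nil
  obtain Z where Z: "Z \<in> Amod K A" "carrier Z = {\<zero>\<^bsub>Z\<^esub>}" by (rule obtain_zero_module)
  have "(\<lambda>x. \<zero>\<^bsub>Z\<^esub>) \<in> module_hom A M Z" by (rule hom_zero[OF fd_module_left_module[OF Amod_fd_module[OF Z(1)]]])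
  then show ?case using power_of.zero[OF Z] by auto
next
  case (Cons h hs)
  then obtain W f where W: "power_of N W" "f \<in> module_hom A M W"
    "\<forall>h\<in>set hs. \<exists>l\<in>module_hom A W N. \<forall>x\<in>carrier M. l (f x) = h x" by auto
  have h: "h \<in> module_hom A M N" using Cons.prems by simp
  obtain D where D: "D \<in> Amod K A" "mod_iso A (direct_sum W N) D"
    using obtain_Amod_direct_sum[OF Amod_fd_module[OF power_of_Amod[OF W(1)]] Amod_fd_module[OF N]] .
  obtain \<phi> \<psi> where iso: "\<phi> \<in> module_hom A (direct_sum W N) D" "\<psi> \<in> module_hom A D (direct_sum W N)"
    "\<And>x. x \<in> carrier (direct_sum W N) \<Longrightarrow> \<psi> (\<phi> x) = x" "\<And>y. y \<in> carrier D \<Longrightarrow> \<phi> (\<psi> y) = y"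
    using mod_isoE[OF D(2)] by blast
  let ?f = "\<lambda>x. \<phi> (f x, h x)"
  have f: "?f \<in> module_hom A M D" by (rule hom_comp[OF iso(1) hom_pair[OF W(2) h]])
  have psi: "\<psi> (?f x) = (f x, h x)" if "x \<in> carrier M" for x
    using that hom_closed[OF W(2)] hom_closed[OF h] by (intro iso(3)) simp
  have "\<exists>l\<in>module_hom A D N. \<forall>x\<in>carrier M. l (?f x) = h' x" if h': "h' \<in> set (h # hs)" for h'
  proof (cases "h' = h")
    case True
    then show ?thesis by (intro bexI[OF _ hom_comp[OF hom_snd iso(2)]]) (simp add: psi)
  next
    case False
    then obtain l where l: "l \<in> module_hom A W N" "\<forall>x\<in>carrier M. l (f x) = h' x" using W(3) h' by auto
    then show ?thesis by (intro bexI[OF _ hom_comp[OF l(1) hom_comp[OF hom_fst iso(2)]]]) (simp add: psi)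
  qed
  then show ?case using power_of.step[OF W(1) D] f by blast
qed

text \<open>A left approximation of \<open>M\<close> by a power of \<open>N\<close>: every homomorphism from \<open>M\<close> to \<open>N\<close> factors
  through \<open>f\<close>. It suffices to collect a finite spanning set of the homomorphisms.\<close>

lemma obtain_power_of_approximation:
  assumes M: "M \<in> Amod K A" and N: "N \<in> Amod K A"
  obtains W f where "power_of N W" "f \<in> module_hom A M W"
    "\<And>h. h \<in> module_hom A M N \<Longrightarrow> \<exists>l\<in>module_hom A W N. \<forall>x\<in>carrier M. l (f x) = h x"
proof -
  note fM = Amod_fd_module[OF M] and fN = Amod_fd_module[OF N]
  note lM = fd_module_left_module[OF fM] and lN = fd_module_left_module[OF fN]
  interpret H: vectorspace K "hom_space A M N" by (rule vectorspace_hom_space[OF lM lN])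
  obtain S where S: "finite S" "S \<subseteq> Hom A M N" "H.span S = Hom A M N"
    using fin_dim_hom_space[OF fM fN] by (auto simp: H.fin_dim_def)
  obtain hs where hs: "set hs = S" using S(1) finite_list by blast
  have "set hs \<subseteq> module_hom A M N" using hs S(2) by (auto simp: Hom_def)
  from obtain_power_of_list[OF M N this] obtain W f where W: "power_of N W" "f \<in> module_hom A M W"
    and ext: "\<And>h. h \<in> S \<Longrightarrow> \<exists>l\<in>module_hom A W N. \<forall>x\<in>carrier M. l (f x) = h x" using hs by auto
  note lW = fd_module_left_module[OF Amod_fd_module[OF power_of_Amod[OF W(1)]]]
  let ?f = "\<lambda>l. \<lambda>x\<in>carrier M. l (f x)"
  have lf: "linear_map K (hom_space A W N) (hom_space A M N) ?f"
    by (rule linear_map_precompose[OF lM lW lN W(2)])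
  interpret lf: linear_map K "hom_space A W N" "hom_space A M N" ?f by (rule lf)
  have "S \<subseteq> lf.im"
  proof
    fix h assume h: "h \<in> S"
    then obtain l where l: "l \<in> module_hom A W N" "\<forall>x\<in>carrier M. l (f x) = h x" using ext by blast
    have lH: "(\<lambda>x\<in>carrier W. l x) \<in> Hom A W N" by (rule restrict_Hom[OF lW l(1)])
    have eq: "?f (\<lambda>x\<in>carrier W. l x) = h"
      by (rule Hom_eqI[OF _ subsetD[OF S(2) h]])
        (use lf.T_im[of "\<lambda>x\<in>carrier W. l x"] lH l hom_closed[OF W(2)] in auto)
    show "h \<in> lf.im" unfolding lf.im_def
      by (rule rev_image_eqI[of "\<lambda>x\<in>carrier W. l x"], simp add: lH, rule eq[symmetric])
  qed
  from H.span_is_subset[OF this lf.im_is_submodule] S(3) have im: "Hom A M N \<subseteq> lf.im" by simp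
  have "\<exists>l\<in>module_hom A W N. \<forall>x\<in>carrier M. l (f x) = h x" if h: "h \<in> module_hom A M N" for h
  proof -
    have "(\<lambda>x\<in>carrier M. h x) \<in> lf.im" using restrict_Hom[OF lM h] im by blast
    then obtain l where l: "l \<in> Hom A W N" "(\<lambda>x\<in>carrier M. h x) = ?f l" by (auto simp: lf.im_def)
    have "l (f x) = h x" if "x \<in> carrier M" for x using fun_cong[OF l(2), of x] that by simp
    then show ?thesis using Hom_module_hom[OF l(1)] by blast
  qed
  then show ?thesis using W that by blast
qed

text \<open>Let \<open>C\<close> be the cokernel of the approximation \<open>f\<close> from \<open>M\<close> to \<open>W\<close>. All homomorphisms from \<open>M\<close> to
  \<open>N\<close> extend along \<open>f\<close>, so \<open>[W, N] = [C, N] + [M, N]\<close>. Since \<open>[W, M] = [W, N]\<close>, the hypothesis for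
  \<open>C\<close> and \<open>M\<close> turns the inequality \<open>[W, M] \<le> [C, M] + [M, M]\<close> into an equality. Hence the
  identity of \<open>M\<close> extends along \<open>f\<close>, too.\<close>

lemma summand_of_power:
  assumes M: "M \<in> Amod K A" and N: "N \<in> Amod K A"
    and le: "\<And>U. U \<in> Amod K A \<Longrightarrow> hom_dim U M \<le> hom_dim U N"
    and eq: "hom_dim N N = hom_dim N M"
  obtains W a b where "power_of N W" "a \<in> module_hom A M W" "b \<in> module_hom A W M"
    "\<forall>x\<in>carrier M. b (a x) = x"
proof -
  note fM = Amod_fd_module[OF M] and fN = Amod_fd_module[OF N]
  obtain W f where W: "power_of N W" "f \<in> module_hom A M W"
    and ext: "\<And>h. h \<in> module_hom A M N \<Longrightarrow> \<exists>l\<in>module_hom A W N. \<forall>x\<in>carrier M. l (f x) = h x"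
    by (rule obtain_power_of_approximation[OF M N]) blast
  note fW = Amod_fd_module[OF power_of_Amod[OF W(1)]]
  note lM = fd_module_left_module[OF fM] and lW = fd_module_left_module[OF fW]
  obtain C p where C: "C \<in> Amod K A" "p \<in> module_hom A W C" "p ` carrier W = carrier C"
    "\<And>x. x \<in> carrier W \<Longrightarrow> p x = \<zero>\<^bsub>C\<^esub> \<longleftrightarrow> x \<in> f ` carrier M"
    using obtain_quotient[OF fW left_submodule_image[OF lM lW W(2)]] by blast
  note fC = Amod_fd_module[OF C(1)]
  have exact: "f ` carrier M = {x \<in> carrier W. p x = \<zero>\<^bsub>C\<^esub>}"
    using C(4) hom_closed[OF W(2)] by auto
  have "hom_dim W N = hom_dim C N + hom_dim M N"
    unfolding hom_dim_right_exact_eq_iff[OF fN fM fW fC W(2) C(2,3) exact] using ext by blast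
  moreover have "hom_dim W M \<le> hom_dim C M + hom_dim M M"
    by (rule hom_dim_right_exact_le[OF fM fM fW fC W(2) C(2,3) exact])
  moreover have "hom_dim W N = hom_dim W M" by (rule hom_dim_power_of[OF W(1) fN fM eq])
  ultimately have "hom_dim W M = hom_dim C M + hom_dim M M" using le[OF C(1)] le[OF M] by simp
  then have "\<forall>h\<in>module_hom A M M. \<exists>l\<in>module_hom A W M. \<forall>x\<in>carrier M. l (f x) = h x"
    unfolding hom_dim_right_exact_eq_iff[OF fM fM fW fC W(2) C(2,3) exact] .
  from bspec[OF this hom_id] show ?thesis using W that by blast
qed

text \<open>The hypotheses pass to the complements of a common summand, which allows induction
  on \<open>[M, M]\<close>.\<close>

theorem mod_iso_if_hom_dim_le:
  assumes "M \<in> Amod K A" "N \<in> Amod K A"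
    and "\<And>U. U \<in> Amod K A \<Longrightarrow> hom_dim U M \<le> hom_dim U N" and "hom_dim N N = hom_dim N M"
  shows "mod_iso A M N"
  using assms
proof (induction "hom_dim M M" arbitrary: M N rule: less_induct)
  case less
  note M = less.prems(1) and N = less.prems(2) and le = less.prems(3) and eq = less.prems(4)
  note fM = Amod_fd_module[OF M] and fN = Amod_fd_module[OF N]
  note lM = fd_module_left_module[OF fM] and lN = fd_module_left_module[OF fN]
  interpret N: left_module A N by (rule lN)
  interpret M: left_module A M by (rule lM)
  show ?case
  proof (cases "carrier M = {\<zero>\<^bsub>M\<^esub>}")
    case True
    then have "hom_dim N N = 0" using eq hom_dim_zero_right[OF fN fM] by simp
    then have N0: "carrier N = {\<zero>\<^bsub>N\<^esub>}" by (rule hom_dim_self_eq_zero[OF fN])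
    show ?thesis
      by (rule mod_isoI[OF hom_zero[OF lN] hom_zero[OF lM]]) (use N0 True in auto)
  next
    case False
    obtain I B where I: "I \<in> Amod K A" "indecomposable A I" and B: "B \<in> Amod K A"
      and IB: "mod_iso A (direct_sum I B) M"
      by (rule obtain_indecomposable_summand[OF M False]) blast
    note fI = Amod_fd_module[OF I(1)] and fB = Amod_fd_module[OF B]
    note lI = fd_module_left_module[OF fI] and lB = fd_module_left_module[OF fB]
    interpret I: left_module A I by (rule lI)
    interpret B: left_module A B by (rule lB)
    obtain W a b where W: "power_of N W" "a \<in> module_hom A M W" "b \<in> module_hom A W M"
      "\<forall>x\<in>carrier M. b (a x) = x"
      by (rule summand_of_power[OF M N le eq]) blast
    obtain \<phi> \<psi> where iso: "\<phi> \<in> module_hom A (direct_sum I B) M" "\<psi> \<in> module_hom A M (direct_sum I B)"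
      "\<And>x. x \<in> carrier (direct_sum I B) \<Longrightarrow> \<psi> (\<phi> x) = x" "\<And>y. y \<in> carrier M \<Longrightarrow> \<phi> (\<psi> y) = y"
      using mod_isoE[OF IB] by blast
    have i: "(\<lambda>x. \<phi> (x, \<zero>\<^bsub>B\<^esub>)) \<in> module_hom A I M" by (rule hom_comp[OF iso(1) hom_inl[OF lB]])
    have r: "(\<lambda>x. fst (\<psi> x)) \<in> module_hom A M I" by (rule hom_comp[OF hom_fst iso(2)])
    have id: "fst (\<psi> (b (a (\<phi> (x, \<zero>\<^bsub>B\<^esub>))))) = x" if "x \<in> carrier I" for x
      using that hom_closed[OF i that] by (simp add: W(4) iso(3))
    have "bij_betw (\<lambda>x. fst (\<psi> (b (a (\<phi> (x, \<zero>\<^bsub>B\<^esub>)))))) (carrier I) (carrier I)"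
      by (subst bij_betw_cong[OF id]) (simp_all add: bij_betw_def)
    from indecomposable_summand_of_power[OF W(1) N fI I(2) hom_comp[OF W(2) i] hom_comp[OF r W(3)] this]
    obtain f g where fg: "f \<in> module_hom A I N" "g \<in> module_hom A N I"
      and bij: "bij_betw (\<lambda>x. g (f x)) (carrier I) (carrier I)" by blast
    obtain c where c: "c \<in> module_hom A I I" "\<And>x. x \<in> carrier I \<Longrightarrow> g (f (c x)) = x"
      using hom_factor_inj[OF lI lI lI hom_comp[OF fg(2,1)] bij_betw_imp_inj_on[OF bij] hom_id]
        bij_betw_imp_surj_on[OF bij] by blast
    \<comment> \<open>Now \<open>f c\<close> is a split monomorphism with retraction \<open>g\<close>.\<close>
    obtain C k where C: "C \<in> Amod K A" "k \<in> module_hom A C N" "inj_on k (carrier C)"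
      "k ` carrier C = {x \<in> carrier N. g x = \<zero>\<^bsub>I\<^esub>}"
      using obtain_submodule[OF fN left_submodule_kernel[OF lN lI fg(2)]] by blast
    note fC = Amod_fd_module[OF C(1)]
    note lC = fd_module_left_module[OF fC]
    have IC: "mod_iso A (direct_sum I C) N"
      by (rule mod_iso_split[OF lI lN lC hom_comp[OF fg(1) c(1)] fg(2) c(2) C(2,3,4)])
    note fIB = fd_module_direct_sum[OF fI fB] and fIC = fd_module_direct_sum[OF fI fC]
    have dM: "hom_dim U M = hom_dim U I + hom_dim U B" if "U \<in> Amod K A" for U
      using hom_dim_iso_right[OF Amod_fd_module[OF that] fIB fM IB]
        hom_dim_direct_sum_right[OF Amod_fd_module[OF that] fI fB] by simp
    have dN: "hom_dim U N = hom_dim U I + hom_dim U C" if "U \<in> Amod K A" for U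
      using hom_dim_iso_right[OF Amod_fd_module[OF that] fIC fN IC]
        hom_dim_direct_sum_right[OF Amod_fd_module[OF that] fI fC] by simp
    have le': "hom_dim U B \<le> hom_dim U C" if "U \<in> Amod K A" for U
      using le[OF that] dM[OF that] dN[OF that] by simp
    have eq': "hom_dim C C = hom_dim C B"
    proof -
      have "hom_dim N C = hom_dim N B" using eq dN[OF N] dM[OF N] by simp
      moreover have "hom_dim N C = hom_dim I C + hom_dim C C"
        using hom_dim_iso_left[OF fC fIC fN IC] hom_dim_direct_sum_left[OF fC fI fC] by simp
      moreover have "hom_dim N B = hom_dim I B + hom_dim C B"
        using hom_dim_iso_left[OF fB fIC fN IC] hom_dim_direct_sum_left[OF fB fI fC] by simp
      ultimately show ?thesis using le'[OF I(1)] le'[OF C(1)] by simp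
    qed
    have "hom_dim I I \<noteq> 0" using hom_dim_self_eq_zero[OF fI] I(2) by (auto simp: indecomposable_def)
    moreover have "hom_dim M M = (hom_dim I I + hom_dim B I) + (hom_dim I B + hom_dim B B)"
      using dM[OF M] hom_dim_iso_left[OF fI fIB fM IB] hom_dim_direct_sum_left[OF fI fI fB]
        hom_dim_iso_left[OF fB fIB fM IB] hom_dim_direct_sum_left[OF fB fI fB] by simp
    ultimately have "hom_dim B B < hom_dim M M" by simp
    from less.hyps[OF this B C(1) le' eq'] have BC: "mod_iso A B C" .
    have "mod_iso A M (direct_sum I B)" by (rule mod_iso_sym[OF IB])
    also have "mod_iso A \<dots> (direct_sum I C)" by (rule mod_iso_direct_sum[OF mod_iso_refl BC])
    also note IC
    finally show ?thesis .
  qed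
qed

end

section \<open>Degenerations as endomorphisms\<close>

text \<open>A degeneration of \<open>X\<close> to \<open>Y\<close> amounts to an endomorphism \<open>u\<close> of some module \<open>H\<close> with kernel
  isomorphic to \<open>Y\<close> (via \<open>j\<close>) and cokernel isomorphic to \<open>X\<close> (via \<open>q\<close>), such that the projection
  onto the cokernel has a section \<open>i\<close>.\<close>

definition deg_endo ::
  "('a, 'r) ring_scheme \<Rightarrow> ('a, 'm, 's) module_scheme \<Rightarrow> ('a, 'n, 't) module_scheme \<Rightarrow>
   ('a, 'h, 'v) module_scheme \<Rightarrow> ('h \<Rightarrow> 'h) \<Rightarrow> ('n \<Rightarrow> 'h) \<Rightarrow> ('m \<Rightarrow> 'h) \<Rightarrow> ('h \<Rightarrow> 'm) \<Rightarrow> bool" where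
  "deg_endo R X Y H u j i q \<longleftrightarrow> u \<in> module_hom R H H \<and>
     j \<in> module_hom R Y H \<and> inj_on j (carrier Y) \<and> j ` carrier Y = {h \<in> carrier H. u h = \<zero>\<^bsub>H\<^esub>} \<and>
     i \<in> module_hom R X H \<and> q \<in> module_hom R H X \<and> (\<forall>x\<in>carrier X. q (i x) = x) \<and>
     u ` carrier H = {h \<in> carrier H. q h = \<zero>\<^bsub>X\<^esub>}"

lemma deg_endoD:
  assumes "deg_endo R X Y H u j i q"
  shows "u \<in> module_hom R H H" "j \<in> module_hom R Y H" "inj_on j (carrier Y)"
    "j ` carrier Y = {h \<in> carrier H. u h = \<zero>\<^bsub>H\<^esub>}" "i \<in> module_hom R X H" "q \<in> module_hom R H X"
    "x \<in> carrier X \<Longrightarrow> q (i x) = x" "u ` carrier H = {h \<in> carrier H. q h = \<zero>\<^bsub>X\<^esub>}"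
  using assms unfolding deg_endo_def by simp_all

context fd_algebra
begin

text \<open>For \<open>0 \<rightarrow> Y \<rightarrow> X \<oplus> Z \<rightarrow> Z \<rightarrow> 0\<close> the endomorphism is the composite \<open>X \<oplus> Z \<rightarrow> Z \<rightarrow> X \<oplus> Z\<close>.
  Conversely, \<open>H\<close> is isomorphic to \<open>X \<oplus> Z\<close> where \<open>Z\<close> is the image of \<open>u\<close>.\<close>

lemma deg_endo_if_deg_le:
  fixes X :: "('a, 'm, 's) module_scheme" and Y :: "('a, 'n, 't) module_scheme"
  assumes X: "fd_module K A X" and Y: "fd_module K A Y" and deg: "deg_le K A X Y"
  obtains H :: "('a, 'm \<times> 'k list) module" and u j i q
  where "fd_module K A H" "deg_endo A X Y H u j i q"
proof -
  note lX = fd_module_left_module[OF X]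
  obtain Z f g where Z: "Z \<in> Amod K A" and se: "short_exact A Y f (direct_sum X Z) g Z"
    using deg unfolding deg_le_def by blast
  note fZ = Amod_fd_module[OF Z]
  note lZ = fd_module_left_module[OF fZ]
  interpret X: left_module A X by (rule lX)
  interpret Z: left_module A Z by (rule lZ)
  let ?u = "\<lambda>z. (\<zero>\<^bsub>X\<^esub>, g z)"
  have f: "f \<in> module_hom A Y (direct_sum X Z)" "inj_on f (carrier Y)"
    "f ` carrier Y = {x \<in> carrier (direct_sum X Z). g x = \<zero>\<^bsub>Z\<^esub>}"
    and g: "g \<in> module_hom A (direct_sum X Z) Z" "g ` carrier (direct_sum X Z) = carrier Z"
    using se unfolding short_exact_def by blast+
  have "?u ` carrier (direct_sum X Z) = Pair \<zero>\<^bsub>X\<^esub> ` (g ` carrier (direct_sum X Z))"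
    by (simp add: image_image)
  also have "\<dots> = {h \<in> carrier (direct_sum X Z). fst h = \<zero>\<^bsub>X\<^esub>}" unfolding g(2) by auto
  finally have im: "?u ` carrier (direct_sum X Z) = {h \<in> carrier (direct_sum X Z). fst h = \<zero>\<^bsub>X\<^esub>}" .
  have "deg_endo A X Y (direct_sum X Z) ?u f (\<lambda>x. (x, \<zero>\<^bsub>Z\<^esub>)) fst"
    unfolding deg_endo_def
    by (intro conjI hom_comp[OF hom_inr[OF lX] g(1)] hom_inl[OF lZ] hom_fst f(1,2) im)
      (simp_all add: f(3))
  then show ?thesis using fd_module_direct_sum[OF X fZ] that by blast
qed

lemma deg_le_if_deg_endo:
  assumes X: "fd_module K A X" and Y: "fd_module K A Y" and H: "fd_module K A H"
    and deg: "deg_endo A X Y H u j i q"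
  shows "deg_le K A X Y"
proof -
  note lX = fd_module_left_module[OF X] and lY = fd_module_left_module[OF Y]
    and lH = fd_module_left_module[OF H]
  note D = deg_endoD[OF deg]
  obtain Z k where Z: "Z \<in> Amod K A" "k \<in> module_hom A Z H" "inj_on k (carrier Z)"
    "k ` carrier Z = {h \<in> carrier H. q h = \<zero>\<^bsub>X\<^esub>}"
    using obtain_submodule[OF H left_submodule_kernel[OF lH lX D(6)]] by blast
  note lZ = fd_module_left_module[OF Amod_fd_module[OF Z(1)]]
  have "mod_iso A (direct_sum X Z) H" by (rule mod_iso_split[OF lX lH lZ D(5,6) D(7) Z(2,3,4)])
  then obtain \<phi> \<psi> where iso: "\<phi> \<in> module_hom A (direct_sum X Z) H" "\<psi> \<in> module_hom A H (direct_sum X Z)"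
    "\<And>x. x \<in> carrier (direct_sum X Z) \<Longrightarrow> \<psi> (\<phi> x) = x" "\<And>y. y \<in> carrier H \<Longrightarrow> \<phi> (\<psi> y) = y"
    using mod_isoE by blast
  have kZ: "k ` carrier Z = u ` carrier H" using Z(4) D(8) by simp
  obtain v where v: "v \<in> module_hom A H Z" "\<And>h. h \<in> carrier H \<Longrightarrow> k (v h) = u h"
    using hom_factor_inj[OF lZ lH lH Z(2,3) D(1)] kZ by blast
  interpret k: left_module_hom A Z H k by (rule left_module_homI[OF lZ lH Z(2)])
  interpret v: left_module_hom A H Z v by (rule left_module_homI[OF lH lZ v(1)])
  have v0: "v h = \<zero>\<^bsub>Z\<^esub> \<longleftrightarrow> u h = \<zero>\<^bsub>H\<^esub>" if "h \<in> carrier H" for h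
    using v(2)[OF that] Z(3) that unfolding k.inj_iff by (metis k.zero v.closed)
  note c\<phi> = hom_closed[OF iso(1)] and c\<psi> = hom_closed[OF iso(2)]
  note cj = hom_closed[OF D(2)]
  have "short_exact A Y (\<lambda>y. \<psi> (j y)) (direct_sum X Z) (\<lambda>z. v (\<phi> z)) Z"
    unfolding short_exact_def
  proof (intro conjI)
    show "inj_on (\<lambda>y. \<psi> (j y)) (carrier Y)"
      by (rule inj_onI) (metis cj iso(4) inj_onD[OF D(3)])
    show "(\<lambda>y. \<psi> (j y)) ` carrier Y = {x \<in> carrier (direct_sum X Z). v (\<phi> x) = \<zero>\<^bsub>Z\<^esub>}"
    proof (intro subset_antisym subsetI)
      fix x assume "x \<in> (\<lambda>y. \<psi> (j y)) ` carrier Y"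
      then obtain y where y: "y \<in> carrier Y" "x = \<psi> (j y)" by auto
      have "u (j y) = \<zero>\<^bsub>H\<^esub>" using D(4) y(1) by auto
      then show "x \<in> {x \<in> carrier (direct_sum X Z). v (\<phi> x) = \<zero>\<^bsub>Z\<^esub>}"
        using y cj[OF y(1)] c\<psi>[OF cj[OF y(1)]] by (simp only: mem_Collect_eq iso(4) v0 simp_thms)
    next
      fix x assume "x \<in> {x \<in> carrier (direct_sum X Z). v (\<phi> x) = \<zero>\<^bsub>Z\<^esub>}"
      then have x: "x \<in> carrier (direct_sum X Z)" "v (\<phi> x) = \<zero>\<^bsub>Z\<^esub>" by auto
      then have "u (\<phi> x) = \<zero>\<^bsub>H\<^esub>" using v0[OF c\<phi>[OF x(1)]] by simp
      then have "\<phi> x \<in> j ` carrier Y" unfolding D(4) using c\<phi>[OF x(1)] by simp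
      then obtain y where y: "y \<in> carrier Y" "\<phi> x = j y" by auto
      then have "x = \<psi> (j y)" using iso(3)[OF x(1)] by simp
      then show "x \<in> (\<lambda>y. \<psi> (j y)) ` carrier Y" using y(1) by blast
    qed
    show "(\<lambda>z. v (\<phi> z)) ` carrier (direct_sum X Z) = carrier Z"
    proof (intro subset_antisym subsetI)
      fix z assume z: "z \<in> carrier Z"
      then have "k z \<in> u ` carrier H" using kZ by blast
      then obtain h where h: "h \<in> carrier H" "k z = u h" by auto
      then have "z = v h" using z v(2)[OF h(1)] by (intro inj_onD[OF Z(3)]) simp_all
      then have "z = v (\<phi> (\<psi> h))" using iso(4)[OF h(1)] by simp
      then show "z \<in> (\<lambda>z. v (\<phi> z)) ` carrier (direct_sum X Z)" using c\<psi>[OF h(1)] by blast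
    qed (use c\<phi> in auto)
  qed (intro hom_comp[OF iso(2) D(2)] hom_comp[OF v(1) iso(1)])+
  then show ?thesis using Z(1) unfolding deg_le_def by blast
qed

lemma deg_le_iso:
  fixes X :: "('a, 'm, 's) module_scheme"
  assumes fd: "fd_module K A X" "fd_module K A Y" "fd_module K A X'" "fd_module K A Y'"
    and deg: "deg_le K A X Y" and "mod_iso A X X'" "mod_iso A Y Y'"
  shows "deg_le K A X' Y'"
proof -
  obtain H :: "('a, 'm \<times> 'k list) module" and u j i q
    where H: "fd_module K A H" and deg: "deg_endo A X Y H u j i q"
    by (rule deg_endo_if_deg_le[OF fd(1,2) deg])
  note D = deg_endoD[OF deg]
  obtain a a' where a: "a \<in> module_hom A X X'" "a' \<in> module_hom A X' X"
    "\<And>x. x \<in> carrier X \<Longrightarrow> a' (a x) = x" "\<And>y. y \<in> carrier X' \<Longrightarrow> a (a' y) = y"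
    using mod_isoE[OF assms(6)] by blast
  obtain b where b: "b \<in> module_hom A Y' Y" "inj_on b (carrier Y')" "b ` carrier Y' = carrier Y"
    by (rule mod_isoE_bij[OF mod_iso_sym[OF assms(7)]])
  note lX = fd_module_left_module[OF fd(1)] and lX' = fd_module_left_module[OF fd(3)]
  interpret a: left_module_hom A X X' a by (rule left_module_homI[OF lX lX' a(1)])
  interpret a': left_module_hom A X' X a' by (rule left_module_homI[OF lX' lX a(2)])
  have a0: "a x = \<zero>\<^bsub>X'\<^esub> \<longleftrightarrow> x = \<zero>\<^bsub>X\<^esub>" if "x \<in> carrier X" for x
    by (metis a(3) that a.zero a'.zero)
  have "deg_endo A X' Y' H u (\<lambda>y. j (b y)) (\<lambda>x. i (a' x)) (\<lambda>h. a (q h))"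
    unfolding deg_endo_def
  proof (intro conjI ballI)
    show "inj_on (\<lambda>y. j (b y)) (carrier Y')"
      using comp_inj_on[OF b(2), of j] D(3) b(3) by (simp add: comp_def)
    show "(\<lambda>y. j (b y)) ` carrier Y' = {h \<in> carrier H. u h = \<zero>\<^bsub>H\<^esub>}"
      using D(4) b(3) by (simp flip: image_image)
    show "a (q (i (a' x))) = x" if "x \<in> carrier X'" for x
      using that D(7) a(4) by simp
    show "u ` carrier H = {h \<in> carrier H. a (q h) = \<zero>\<^bsub>X'\<^esub>}"
      unfolding D(8) using a0 hom_closed[OF D(6)] by blast
  qed (intro D(1) hom_comp[OF D(2) b(1)] hom_comp[OF D(5) a(2)] hom_comp[OF a(1) D(6)])+
  then show ?thesis by (rule deg_le_if_deg_endo[OF fd(3,4) H])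
qed

lemma deg_le_refl:
  assumes X: "fd_module K A X"
  shows "deg_le K A X X"
proof -
  obtain Z where Z: "Z \<in> Amod K A" "carrier Z = {\<zero>\<^bsub>Z\<^esub>}" by (rule obtain_zero_module)
  note lX = fd_module_left_module[OF X] and lZ = fd_module_left_module[OF Amod_fd_module[OF Z(1)]]
  interpret X: left_module A X by (rule lX)
  interpret Z: left_module A Z by (rule lZ)
  have "short_exact A X (\<lambda>x. (x, \<zero>\<^bsub>Z\<^esub>)) (direct_sum X Z) snd Z"
    unfolding short_exact_def
  proof (intro conjI hom_inl hom_snd lZ)
    show "snd ` carrier (direct_sum X Z) = carrier Z" using X.zero_closed by force
    show "(\<lambda>x. (x, \<zero>\<^bsub>Z\<^esub>)) ` carrier X = {x \<in> carrier (direct_sum X Z). snd x = \<zero>\<^bsub>Z\<^esub>}"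
      by auto
  qed (simp add: inj_on_def)
  then show ?thesis using Z(1) unfolding deg_le_def by blast
qed

lemma deg_le_direct_sum:
  assumes V: "left_module A V" and deg: "deg_le K A X Y"
  shows "deg_le K A (direct_sum X V) (direct_sum Y V)"
proof -
  obtain Z f g where Z: "Z \<in> Amod K A" and se: "short_exact A Y f (direct_sum X Z) g Z"
    using deg unfolding deg_le_def by blast
  have f: "f \<in> module_hom A Y (direct_sum X Z)" "inj_on f (carrier Y)"
    "f ` carrier Y = {x \<in> carrier (direct_sum X Z). g x = \<zero>\<^bsub>Z\<^esub>}"
    and g: "g \<in> module_hom A (direct_sum X Z) Z" "g ` carrier (direct_sum X Z) = carrier Z"
    using se unfolding short_exact_def by blast+
  interpret V: left_module A V by (rule V)
  let ?f = "\<lambda>w. ((fst (f (fst w)), snd w), snd (f (fst w)))"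
  let ?g = "\<lambda>w. g (fst (fst w), snd w)"
  have "short_exact A (direct_sum Y V) ?f (direct_sum (direct_sum X V) Z) ?g Z"
    unfolding short_exact_def
  proof (intro conjI)
    have fY: "f \<circ> fst \<in> module_hom A (direct_sum Y V) (direct_sum X Z)"
      using hom_comp[OF f(1) hom_fst] by (simp add: comp_def)
    show "?f \<in> module_hom A (direct_sum Y V) (direct_sum (direct_sum X V) Z)"
      using hom_pair[OF hom_pair[OF hom_comp[OF hom_fst fY] hom_snd] hom_comp[OF hom_snd fY]] by simp
    show "?g \<in> module_hom A (direct_sum (direct_sum X V) Z) Z"
      by (rule hom_comp[OF g(1) hom_pair[OF hom_comp[OF hom_fst hom_fst] hom_snd]])
    show "inj_on ?f (carrier (direct_sum Y V))"
      using f(2) by (auto simp: inj_on_def prod_eq_iff)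
    show "?f ` carrier (direct_sum Y V) = {x \<in> carrier (direct_sum (direct_sum X V) Z). ?g x = \<zero>\<^bsub>Z\<^esub>}"
    proof (intro subset_antisym subsetI)
      fix w assume "w \<in> ?f ` carrier (direct_sum Y V)"
      then obtain y v where y: "y \<in> carrier Y" "v \<in> carrier V" "w = ?f (y, v)" by auto
      have "f y \<in> {x \<in> carrier (direct_sum X Z). g x = \<zero>\<^bsub>Z\<^esub>}" using f(3) y(1) by blast
      then show "w \<in> {x \<in> carrier (direct_sum (direct_sum X V) Z). ?g x = \<zero>\<^bsub>Z\<^esub>}"
        using y by auto
    next
      fix w assume "w \<in> {x \<in> carrier (direct_sum (direct_sum X V) Z). ?g x = \<zero>\<^bsub>Z\<^esub>}"
      then have w: "w \<in> carrier (direct_sum (direct_sum X V) Z)" "?g w = \<zero>\<^bsub>Z\<^esub>" by auto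
      then have "(fst (fst w), snd w) \<in> f ` carrier Y" unfolding f(3) by auto
      then obtain y where y: "y \<in> carrier Y" "(fst (fst w), snd w) = f y" by auto
      then have "w = ?f (y, snd (fst w))" by (metis fst_conv snd_conv prod.collapse)
      then show "w \<in> ?f ` carrier (direct_sum Y V)"
        using y(1) w(1) by (intro image_eqI[of _ _ "(y, snd (fst w))"]) auto
    qed
    show "?g ` carrier (direct_sum (direct_sum X V) Z) = carrier Z"
    proof (intro subset_antisym subsetI)
      fix z assume "z \<in> carrier Z"
      then obtain x where "x \<in> carrier (direct_sum X Z)" "z = g x" using g(2) by blast
      then show "z \<in> ?g ` carrier (direct_sum (direct_sum X V) Z)"
        by (intro image_eqI[of _ _ "((fst x, \<zero>\<^bsub>V\<^esub>), snd x)"]) auto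
    qed (use hom_closed[OF g(1)] in auto)
  qed
  then show ?thesis using Z unfolding deg_le_def by blast
qed

lemma projective_fd_module: "projective K A P \<Longrightarrow> fd_module K A P"
  by (simp add: projective_def)

text \<open>The lifting property extends from objects of \<open>A\<close>-mod to finite-dimensional modules with
  carriers in arbitrary types.\<close>

lemma projective_lift:
  assumes P: "projective K A P" and M: "fd_module K A M" and N: "fd_module K A N"
    and g: "g \<in> module_hom A M N" "g ` carrier M = carrier N" and h: "h \<in> module_hom A P N"
  obtains l where "l \<in> module_hom A P M" "\<forall>x\<in>carrier P. g (l x) = h x"
proof -
  obtain M' where M': "M' \<in> Amod K A" "mod_iso A M M'" using obtain_Amod_iso[OF M] .
  obtain N' where N': "N' \<in> Amod K A" "mod_iso A N N'" using obtain_Amod_iso[OF N] .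
  obtain a where a: "a \<in> module_hom A M' M" "inj_on a (carrier M')" "a ` carrier M' = carrier M"
    by (rule mod_isoE_bij[OF mod_iso_sym[OF M'(2)]])
  obtain b where b: "b \<in> module_hom A N N'" "inj_on b (carrier N)" "b ` carrier N = carrier N'"
    by (rule mod_isoE_bij[OF N'(2)])
  have "(\<lambda>x. b (g (a x))) ` carrier M' = b ` g ` a ` carrier M'" by (simp only: image_image)
  then have surj: "(\<lambda>x. b (g (a x))) ` carrier M' = carrier N'" by (simp only: a(3) g(2) b(3))
  have "\<exists>l\<in>module_hom A P M'. \<forall>x\<in>carrier P. b (g (a (l x))) = b (h x)"
    using P[unfolded projective_def, THEN conjunct2, rule_format, OF M'(1) N'(1)
        hom_comp[OF b(1) hom_comp[OF g(1) a(1)]] hom_comp[OF b(1) h] surj] .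
  then obtain l where l: "l \<in> module_hom A P M'" "\<forall>x\<in>carrier P. b (g (a (l x))) = b (h x)" by blast
  have "g (a (l x)) = h x" if "x \<in> carrier P" for x
    by (rule inj_onD[OF b(2)])
      (use l that hom_closed[OF h] hom_closed[OF g(1)] hom_closed[OF a(1)] hom_closed[OF l(1)] in auto)
  then show ?thesis using that hom_comp[OF a(1) l(1)] by blast
qed

lemma deg_le_hom_dim:
  assumes U: "fd_module K A U" and X: "fd_module K A X" and Y: "fd_module K A Y"
    and deg: "deg_le K A X Y"
  shows deg_le_hom_dim_le: "hom_dim U X \<le> hom_dim U Y"
    and deg_le_hom_dim_eq: "projective K A U \<Longrightarrow> hom_dim U X = hom_dim U Y"
proof -
  obtain Z f g where Z: "Z \<in> Amod K A" and se: "short_exact A Y f (direct_sum X Z) g Z"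
    using deg unfolding deg_le_def by blast
  have f: "f \<in> module_hom A Y (direct_sum X Z)" "inj_on f (carrier Y)"
    "f ` carrier Y = {x \<in> carrier (direct_sum X Z). g x = \<zero>\<^bsub>Z\<^esub>}"
    and g: "g \<in> module_hom A (direct_sum X Z) Z" "g ` carrier (direct_sum X Z) = carrier Z"
    using se unfolding short_exact_def by blast+
  note fZ = Amod_fd_module[OF Z]
  note fXZ = fd_module_direct_sum[OF X fZ]
  have sum: "hom_dim U (direct_sum X Z) = hom_dim U X + hom_dim U Z"
    by (rule hom_dim_direct_sum_right[OF U X fZ])
  show "hom_dim U X \<le> hom_dim U Y"
    using hom_dim_left_exact_le[OF U Y fXZ fZ f(1,2) g(1) f(3)] sum by simp
  assume P: "projective K A U"
  have "hom_dim U (direct_sum X Z) = hom_dim U Y + hom_dim U Z"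
    unfolding hom_dim_left_exact_eq_iff[OF U Y fXZ fZ f(1,2) g(1) f(3)]
    using projective_lift[OF P fXZ fZ g] by blast
  then show "hom_dim U X = hom_dim U Y" using sum by simp
qed

section \<open>Transitivity of degeneration\<close>

text \<open>By Fitting's lemma the endomorphism \<open>u\<close> may be taken nilpotent.\<close>

lemma deg_endo_nilpotent:
  assumes X: "fd_module K A X" and Y: "fd_module K A Y" and H: "fd_module K A H"
    and deg: "deg_endo A X Y H u j i q"
  obtains H' u' j' i' q' n where "H' \<in> Amod K A" "deg_endo A X Y H' u' j' i' q'"
    "n > 0" "\<forall>x\<in>carrier H'. (u' ^^ n) x = \<zero>\<^bsub>H'\<^esub>"
proof -
  note D = deg_endoD[OF deg]
  note lX = fd_module_left_module[OF X] and lY = fd_module_left_module[OF Y]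
    and lH = fd_module_left_module[OF H]
  obtain n e where n: "n > 0" and e: "e \<in> module_hom A H H"
    and Te: "\<And>x. x \<in> carrier H \<Longrightarrow> (u ^^ n) (e x) = \<zero>\<^bsub>H\<^esub>"
    and dec: "\<And>x. x \<in> carrier H \<Longrightarrow> \<exists>y\<in>carrier H. x = e x \<oplus>\<^bsub>H\<^esub> (u ^^ n) y"
    and stable: "\<And>x. \<lbrakk>x \<in> carrier H; (u ^^ n) ((u ^^ n) x) = \<zero>\<^bsub>H\<^esub>\<rbrakk> \<Longrightarrow> (u ^^ n) x = \<zero>\<^bsub>H\<^esub>"
    by (rule Fitting_projection[OF H D(1)]) blast
  obtain m where m: "n = Suc m" using n by (cases n) auto
  have un: "(u ^^ n) \<in> module_hom A H H" by (rule hom_funpow[OF D(1)])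
  interpret u: left_module_hom A H H u by (rule left_module_homI[OF lH lH D(1)])
  interpret un: left_module_hom A H H "u ^^ n" by (rule left_module_homI[OF lH lH un])
  interpret um: left_module_hom A H H "u ^^ m" by (rule left_module_homI[OF lH lH hom_funpow[OF D(1)]])
  interpret q: left_module_hom A H X q by (rule left_module_homI[OF lH lX D(6)])
  have un_Suc: "(u ^^ n) h = u ((u ^^ m) h)" for h by (simp add: m)
  have un_u: "(u ^^ n) (u h) = u ((u ^^ n) h)" for h by (simp add: funpow_swap1)
  obtain H' k where H': "H' \<in> Amod K A" "k \<in> module_hom A H' H" "inj_on k (carrier H')"
    "k ` carrier H' = {h \<in> carrier H. (u ^^ n) h = \<zero>\<^bsub>H\<^esub>}"
    using obtain_submodule[OF H left_submodule_kernel[OF lH lH un]] by blast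
  note lH' = fd_module_left_module[OF Amod_fd_module[OF H'(1)]]
  interpret k: left_module_hom A H' H k by (rule left_module_homI[OF lH' lH H'(2)])
  have kn: "(u ^^ n) (k x) = \<zero>\<^bsub>H\<^esub>" if "x \<in> carrier H'" for x using H'(4) that by blast
  have k0: "x = \<zero>\<^bsub>H'\<^esub>" if "x \<in> carrier H'" "k x = \<zero>\<^bsub>H\<^esub>" for x
    using H'(3) that unfolding k.inj_iff by blast
  have "u (k x) \<in> k ` carrier H'" if x: "x \<in> carrier H'" for x
    unfolding H'(4) using x by (simp add: un_u kn)
  then obtain u' where u': "u' \<in> module_hom A H' H'" "\<And>x. x \<in> carrier H' \<Longrightarrow> k (u' x) = u (k x)"
    using hom_factor_inj[OF lH' lH lH' H'(2,3) hom_comp[OF D(1) H'(2)]] by blast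
  have ju: "u (j y) = \<zero>\<^bsub>H\<^esub>" if "y \<in> carrier Y" for y using D(4) that by blast
  have "j y \<in> k ` carrier H'" if y: "y \<in> carrier Y" for y
  proof -
    have "(u ^^ n) (j y) = (u ^^ m) (u (j y))" by (simp add: m funpow_swap1)
    then show ?thesis unfolding H'(4) using y hom_closed[OF D(2) y] by (simp add: ju)
  qed
  then obtain j' where j': "j' \<in> module_hom A Y H'" "\<And>y. y \<in> carrier Y \<Longrightarrow> k (j' y) = j y"
    using hom_factor_inj[OF lH' lH lY H'(2,3) D(2)] by blast
  have "e (i x) \<in> k ` carrier H'" if x: "x \<in> carrier X" for x
    unfolding H'(4) using hom_closed[OF D(5) x] hom_closed[OF e] Te by simp
  then obtain i' where i': "i' \<in> module_hom A X H'" "\<And>x. x \<in> carrier X \<Longrightarrow> k (i' x) = e (i x)"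
    using hom_factor_inj[OF lH' lH lX H'(2,3) hom_comp[OF e D(5)]] by blast
  have qu: "q (u h) = \<zero>\<^bsub>X\<^esub>" if "h \<in> carrier H" for h using D(8) that by blast
  have qe: "q (e h) = q h" if h: "h \<in> carrier H" for h
  proof -
    obtain y where y: "y \<in> carrier H" "h = e h \<oplus>\<^bsub>H\<^esub> (u ^^ n) y" using dec[OF h] by blast
    have "q h = q (e h \<oplus>\<^bsub>H\<^esub> (u ^^ n) y)" using y(2) by simp
    also have "\<dots> = q (e h)" using y(1) h hom_closed[OF e h] by (simp add: un_Suc qu del: funpow.simps)
    finally show ?thesis by simp
  qed
  have "deg_endo A X Y H' u' j' i' (\<lambda>x. q (k x))"
    unfolding deg_endo_def
  proof (intro conjI ballI)
    show "inj_on j' (carrier Y)" by (rule inj_onI) (metis j'(2) inj_onD[OF D(3)])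
    show "j' ` carrier Y = {h \<in> carrier H'. u' h = \<zero>\<^bsub>H'\<^esub>}"
    proof (intro subset_antisym subsetI)
      fix x assume "x \<in> j' ` carrier Y"
      then obtain y where y: "y \<in> carrier Y" "x = j' y" by auto
      have c: "x \<in> carrier H'" using hom_closed[OF j'(1)] y by simp
      have "k (u' x) = \<zero>\<^bsub>H\<^esub>" using u'(2)[OF c] y j'(2) ju by simp
      then show "x \<in> {h \<in> carrier H'. u' h = \<zero>\<^bsub>H'\<^esub>}" using c k0 hom_closed[OF u'(1) c] by simp
    next
      fix x assume "x \<in> {h \<in> carrier H'. u' h = \<zero>\<^bsub>H'\<^esub>}"
      then have x: "x \<in> carrier H'" "u' x = \<zero>\<^bsub>H'\<^esub>" by auto
      then have "u (k x) = \<zero>\<^bsub>H\<^esub>" using u'(2)[OF x(1)] by simp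
      then have "k x \<in> j ` carrier Y" unfolding D(4) using x(1) by simp
      then obtain y where y: "y \<in> carrier Y" "k x = j y" by auto
      then have "x = j' y"
        using x(1) hom_closed[OF j'(1)] j'(2) by (intro inj_onD[OF H'(3)]) simp_all
      then show "x \<in> j' ` carrier Y" using y(1) by blast
    qed
    show "q (k (i' x)) = x" if "x \<in> carrier X" for x
      using that i'(2) qe hom_closed[OF D(5)] D(7) by simp
    show "u' ` carrier H' = {h \<in> carrier H'. q (k h) = \<zero>\<^bsub>X\<^esub>}"
    proof (intro subset_antisym subsetI)
      fix x assume "x \<in> u' ` carrier H'"
      then show "x \<in> {h \<in> carrier H'. q (k h) = \<zero>\<^bsub>X\<^esub>}"
        using hom_closed[OF u'(1)] u'(2) qu by auto
    next
      fix x assume "x \<in> {h \<in> carrier H'. q (k h) = \<zero>\<^bsub>X\<^esub>}"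
      then have x: "x \<in> carrier H'" "q (k x) = \<zero>\<^bsub>X\<^esub>" by auto
      then have "k x \<in> u ` carrier H" unfolding D(8) by simp
      then obtain h where h: "h \<in> carrier H" "k x = u h" by auto
      have "u ((u ^^ n) h) = \<zero>\<^bsub>H\<^esub>" using kn[OF x(1)] h(2) un_u by simp
      then have "(u ^^ m) (u ((u ^^ n) h)) = \<zero>\<^bsub>H\<^esub>" by simp
      then have "(u ^^ n) ((u ^^ n) h) = \<zero>\<^bsub>H\<^esub>" by (simp add: m funpow_swap1)
      then have "h \<in> k ` carrier H'" unfolding H'(4) using h(1) stable by simp
      then obtain z where z: "z \<in> carrier H'" "h = k z" by auto
      then have "x = u' z"
        using x(1) h(2) u'(2) hom_closed[OF u'(1)] by (intro inj_onD[OF H'(3)]) simp_all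
      then show "x \<in> u' ` carrier H'" using z(1) by blast
    qed
  qed (intro u'(1) j'(1) i'(1) hom_comp[OF D(6) H'(2)])+
  moreover have "\<forall>x\<in>carrier H'. (u' ^^ n) x = \<zero>\<^bsub>H'\<^esub>"
  proof
    fix x assume x: "x \<in> carrier H'"
    have c: "(u' ^^ r) x \<in> carrier H'" for r by (rule hom_closed[OF hom_funpow[OF u'(1)] x])
    have "k ((u' ^^ r) x) = (u ^^ r) (k x)" for r
      by (induction r) (simp_all add: u'(2) c)
    then show "(u' ^^ n) x = \<zero>\<^bsub>H'\<^esub>" using k0[OF c] kn[OF x] by simp
  qed
  ultimately show ?thesis using H'(1) n that by blast
qed

end

text \<open>The module \<open>M\<^sup>N\<close>, realised as the sequences in \<open>M\<close> that vanish from index \<open>N\<close> on.\<close>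

definition power_module :: "('a, 'm, 's) module_scheme \<Rightarrow> nat \<Rightarrow> ('a, nat \<Rightarrow> 'm) module" where
  "power_module M N = \<lparr>carrier = {g. (\<forall>i. g i \<in> carrier M) \<and> (\<forall>i\<ge>N. g i = \<zero>\<^bsub>M\<^esub>)},
     mult = undefined, one = undefined, zero = (\<lambda>i. \<zero>\<^bsub>M\<^esub>), add = (\<lambda>g h i. g i \<oplus>\<^bsub>M\<^esub> h i),
     smult = (\<lambda>a g i. a \<odot>\<^bsub>M\<^esub> g i)\<rparr>"

lemma power_module_simps [simp]:
  "g \<in> carrier (power_module M N) \<longleftrightarrow> (\<forall>i. g i \<in> carrier M) \<and> (\<forall>i\<ge>N. g i = \<zero>\<^bsub>M\<^esub>)"
  "\<zero>\<^bsub>power_module M N\<^esub> = (\<lambda>i. \<zero>\<^bsub>M\<^esub>)"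
  "g \<oplus>\<^bsub>power_module M N\<^esub> h = (\<lambda>i. g i \<oplus>\<^bsub>M\<^esub> h i)"
  "a \<odot>\<^bsub>power_module M N\<^esub> g = (\<lambda>i. a \<odot>\<^bsub>M\<^esub> g i)"
  by (simp_all add: power_module_def)

lemma left_module_power_module:
  assumes "left_module R M"
  shows "left_module R (power_module M N)"
proof -
  interpret M: left_module R M by fact
  have "abelian_group (power_module M N)"
  proof (rule abelian_groupI)
    fix g assume "g \<in> carrier (power_module M N)"
    then show "\<exists>h\<in>carrier (power_module M N). h \<oplus>\<^bsub>power_module M N\<^esub> g = \<zero>\<^bsub>power_module M N\<^esub>"
      by (intro bexI[of _ "\<lambda>i. \<ominus>\<^bsub>M\<^esub> g i"]) (auto simp: M.l_neg)
  qed (auto simp: M.a_ac)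
  then show ?thesis
    by (intro left_module.intro M.ring)
      (auto simp: M.smult_l_distr M.smult_r_distr M.smult_assoc M.smult_one)
qed

lemma hom_power_module_nth: "(\<lambda>g. g i) \<in> module_hom R (power_module M N) M"
  by (rule module_homI) auto

lemma power_module_homI:
  assumes "\<And>i. (\<lambda>x. f x i) \<in> module_hom R L M"
    and "\<And>i x. \<lbrakk>x \<in> carrier L; i \<ge> N\<rbrakk> \<Longrightarrow> f x i = \<zero>\<^bsub>M\<^esub>"
  shows "f \<in> module_hom R L (power_module M N)"
  by (rule module_homI)
    (use assms(2) hom_closed[OF assms(1)] module_hom_add[OF assms(1)] module_hom_smult[OF assms(1)] in auto)

lemma (in fd_algebra) fd_module_power_module:
  assumes M: "fd_module K A M"
  shows "fd_module K A (power_module M N)"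
proof (induction N)
  case 0
  obtain Z where Z: "Z \<in> Amod K A" "carrier Z = {\<zero>\<^bsub>Z\<^esub>}" by (rule obtain_zero_module)
  note fZ = Amod_fd_module[OF Z(1)]
  have "inj_on (\<lambda>g. \<zero>\<^bsub>Z\<^esub>) (carrier (power_module M 0))" by (rule inj_onI) auto
  then show ?case
    using fd_module_inj[OF left_module_power_module[OF fd_module_left_module[OF M]] fZ
        hom_zero[OF fd_module_left_module[OF fZ]]] by blast
next
  case (Suc N)
  note lM = fd_module_left_module[OF M]
  interpret M: left_module A M by (rule lM)
  let ?f = "\<lambda>g. (g N, \<lambda>i. if i = N then \<zero>\<^bsub>M\<^esub> else g i)"
  have "?f \<in> module_hom A (power_module M (Suc N)) (direct_sum M (power_module M N))"
    by (rule module_homI) (auto simp: fun_eq_iff Suc_le_eq)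
  moreover have "inj_on ?f (carrier (power_module M (Suc N)))"
    by (rule inj_onI) (auto simp: fun_eq_iff split: if_splits; metis)
  ultimately show ?case
    by (rule fd_module_inj[OF left_module_power_module[OF lM] fd_module_direct_sum[OF M Suc.IH]])
qed

text \<open>The sum \<open>\<Sum>i<n. u\<^sup>i (\<kappa> (y i))\<close>.\<close>

primrec twisted_sum ::
  "('a, 'h, 'v) module_scheme \<Rightarrow> ('h \<Rightarrow> 'h) \<Rightarrow> ('n \<Rightarrow> 'h) \<Rightarrow> nat \<Rightarrow> (nat \<Rightarrow> 'n) \<Rightarrow> 'h" where
  "twisted_sum H u \<kappa> 0 y = \<zero>\<^bsub>H\<^esub>"
| "twisted_sum H u \<kappa> (Suc n) y = twisted_sum H u \<kappa> n y \<oplus>\<^bsub>H\<^esub> (u ^^ n) (\<kappa> (y n))"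

lemma hom_twisted_sum:
  assumes Y: "left_module R Y" and H: "left_module R H"
    and u: "u \<in> module_hom R H H" and \<kappa>: "\<kappa> \<in> module_hom R Y H"
  shows "twisted_sum H u \<kappa> n \<in> module_hom R (power_module Y N) H"
proof (induction n)
  case 0
  then show ?case using hom_zero[OF H] by (rule hom_cong[OF left_module_power_module[OF Y]]) simp
next
  case (Suc n)
  have "(\<lambda>y. twisted_sum H u \<kappa> n y \<oplus>\<^bsub>H\<^esub> (u ^^ n) (\<kappa> (y n))) \<in> module_hom R (power_module Y N) H"
    by (intro hom_add[OF left_module_power_module[OF Y] H Suc.IH]
        hom_comp[OF hom_funpow[OF u] hom_comp[OF \<kappa> hom_power_module_nth]])
  then show ?case by (rule hom_cong[OF left_module_power_module[OF Y]]) simp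
qed

text \<open>The sequence \<open>x, g 0, \<dots>, g (N - 2)\<close>, continued by the constant \<open>z\<close>.\<close>

definition shift_seq :: "nat \<Rightarrow> 'm \<Rightarrow> 'm \<Rightarrow> (nat \<Rightarrow> 'm) \<Rightarrow> nat \<Rightarrow> 'm" where
  "shift_seq N z x g i = (if i = 0 then x else if i < N then g (i - 1) else z)"

context fd_algebra
begin

text \<open>
  With \<open>N = M + 1\<close>, the module \<open>E\<close> below is the pushout of \<open>G\<^sup>N\<close> and \<open>H\<close> over \<open>Y\<^sup>N\<close>, that is, the quotient
  of \<open>D = G\<^sup>N \<oplus> H\<close> by the image of \<open>\<rho>\<close>. An element of \<open>D\<close> should be read as \<open>\<Sum>i<N. T\<^sup>i (g i) + h\<close> for
  an operator \<open>T\<close> that extends \<open>u\<close> and satisfies \<open>T\<^sup>N = t\<close> on \<open>G\<close>. Accordingly, \<open>T\<close> acts on \<open>D\<close> by \<open>s\<close>,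
  which induces the endomorphism \<open>v\<close> of \<open>E\<close>. The map \<open>c\<close> induced by \<open>b\<close> is the projection onto
  the cokernel \<open>X\<close>.
\<close>

lemma deg_le_trans_nilpotent:
  assumes X: "fd_module K A X" and Y: "fd_module K A Y" and W: "fd_module K A W"
    and G: "fd_module K A G" and degG: "deg_endo A X Y G t j \<iota> p"
    and H: "fd_module K A H" and degH: "deg_endo A Y W H u m \<kappa> q"
    and nilp: "\<And>h. h \<in> carrier H \<Longrightarrow> (u ^^ Suc M) h = \<zero>\<^bsub>H\<^esub>"
  shows "deg_le K A X W"
proof -
  note DG = deg_endoD[OF degG] and DH = deg_endoD[OF degH]
  note lX = fd_module_left_module[OF X] and lY = fd_module_left_module[OF Y]
    and lW = fd_module_left_module[OF W] and lG = fd_module_left_module[OF G]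
    and lH = fd_module_left_module[OF H]
  interpret t: left_module_hom A G G t by (rule left_module_homI[OF lG lG DG(1)])
  interpret j: left_module_hom A Y G j by (rule left_module_homI[OF lY lG DG(2)])
  interpret io: left_module_hom A X G \<iota> by (rule left_module_homI[OF lX lG DG(5)])
  interpret p: left_module_hom A G X p by (rule left_module_homI[OF lG lX DG(6)])
  interpret u: left_module_hom A H H u by (rule left_module_homI[OF lH lH DH(1)])
  interpret m: left_module_hom A W H m by (rule left_module_homI[OF lW lH DH(2)])
  interpret ka: left_module_hom A Y H \<kappa> by (rule left_module_homI[OF lY lH DH(5)])
  interpret q: left_module_hom A H Y q by (rule left_module_homI[OF lH lY DH(6)])
  have tj: "t (j y) = \<zero>\<^bsub>G\<^esub>" if "y \<in> carrier Y" for y using DG(4) that by blast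
  have pt: "p (t g) = \<zero>\<^bsub>X\<^esub>" if "g \<in> carrier G" for g using DG(8) that by blast
  have um: "u (m w) = \<zero>\<^bsub>H\<^esub>" if "w \<in> carrier W" for w using DH(4) that by blast
  have qu: "q (u h) = \<zero>\<^bsub>Y\<^esub>" if "h \<in> carrier H" for h using DH(8) that by blast
  have j0: "y = \<zero>\<^bsub>Y\<^esub>" if "y \<in> carrier Y" "j y = \<zero>\<^bsub>G\<^esub>" for y
    using DG(3) that unfolding j.inj_iff by blast
  have m0: "w = \<zero>\<^bsub>W\<^esub>" if "w \<in> carrier W" "m w = \<zero>\<^bsub>H\<^esub>" for w
    using DH(3) that unfolding m.inj_iff by blast
  have un: "(u ^^ n) h \<in> carrier H" if "h \<in> carrier H" for n h
    by (rule hom_closed[OF hom_funpow[OF DH(1)] that])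
  define N where "N = Suc M"
  define D where "D = direct_sum (power_module G N) H"
  have fP: "fd_module K A (power_module G N)" by (rule fd_module_power_module[OF G])
  note lP = fd_module_left_module[OF fP]
  have fD: "fd_module K A D" unfolding D_def by (rule fd_module_direct_sum[OF fP H])
  note lD = fd_module_left_module[OF fD]
  interpret P: left_module A "power_module G N" by (rule lP)
  interpret D: left_module A D by (rule lD)
  let ?PY = "power_module Y N"
  have lPY: "left_module A ?PY" by (rule left_module_power_module[OF lY])
  let ?\<sigma> = "twisted_sum H u \<kappa>"
  have hs: "?\<sigma> n \<in> module_hom A ?PY H" for n by (rule hom_twisted_sum[OF lY lH DH(1,5)])
  have \<sigma>_closed: "?\<sigma> n y \<in> carrier H" if "y \<in> carrier ?PY" for n y by (rule hom_closed[OF hs that])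
  have \<sigma>0: "?\<sigma> n (\<lambda>i. \<zero>\<^bsub>Y\<^esub>) = \<zero>\<^bsub>H\<^esub>" for n
    using left_module_hom.zero[OF left_module_homI[OF lPY lH hs]] by simp
  have q_\<sigma>: "q (?\<sigma> (Suc n) y) = y 0" if "y \<in> carrier ?PY" for n y
    using that
  proof (induction n)
    case 0
    then show ?case by (simp add: DH(7))
  next
    case (Suc n)
    have "q ((u ^^ Suc n) (\<kappa> (y (Suc n)))) = \<zero>\<^bsub>Y\<^esub>" using Suc.prems by (simp add: qu un)
    moreover have "?\<sigma> (Suc n) y \<in> carrier H" by (rule \<sigma>_closed[OF Suc.prems])
    moreover have "(u ^^ Suc n) (\<kappa> (y (Suc n))) \<in> carrier H" using Suc.prems by (intro un) simp
    ultimately show ?case using Suc by (simp only: twisted_sum.simps(2)[of _ _ _ "Suc n"] q.add) simp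
  qed
  define sY where "sY = shift_seq N \<zero>\<^bsub>Y\<^esub> \<zero>\<^bsub>Y\<^esub>"
  have sY: "sY y \<in> carrier ?PY" if "y \<in> carrier ?PY" for y
    using that by (auto simp: sY_def shift_seq_def N_def)
  have u_\<sigma>: "?\<sigma> N (sY y) = u (?\<sigma> N y)" if y: "y \<in> carrier ?PY" for y
  proof -
    have yc: "y i \<in> carrier Y" for i using y by simp
    have c: "?\<sigma> n y \<in> carrier H" for n by (rule \<sigma>_closed[OF y])
    have "?\<sigma> (Suc n) (sY y) = u (?\<sigma> n y)" if "n \<le> M" for n
      using that
    proof (induction n)
      case 0
      then show ?case by (simp add: sY_def shift_seq_def)
    next
      case (Suc n)
      have "?\<sigma> (Suc (Suc n)) (sY y) = ?\<sigma> (Suc n) (sY y) \<oplus>\<^bsub>H\<^esub> (u ^^ Suc n) (\<kappa> (sY y (Suc n)))"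
        by (rule twisted_sum.simps)
      also have "\<dots> = u (?\<sigma> n y) \<oplus>\<^bsub>H\<^esub> u ((u ^^ n) (\<kappa> (y n)))"
      proof -
        have "?\<sigma> (Suc n) (sY y) = u (?\<sigma> n y)" using Suc by (intro Suc.IH) simp
        moreover have "sY y (Suc n) = y n" using Suc.prems by (simp add: sY_def shift_seq_def N_def)
        ultimately show ?thesis by (simp del: twisted_sum.simps)
      qed
      also have "\<dots> = u (?\<sigma> (Suc n) y)" by (simp add: c un yc)
      finally show ?case .
    qed
    from this[of M] have "?\<sigma> N (sY y) = u (?\<sigma> M y)" by (simp add: N_def)
    moreover have "u ((u ^^ M) (\<kappa> (y M))) = \<zero>\<^bsub>H\<^esub>" using nilp[of "\<kappa> (y M)"] yc by simp
    then have "u (?\<sigma> N y) = u (?\<sigma> M y)" by (simp add: N_def c un yc)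
    ultimately show ?thesis by simp
  qed
  \<comment> \<open>The relations: the pushout identifies \<open>j y\<close> in position \<open>i\<close> with \<open>u\<^sup>i (\<kappa> y)\<close>.\<close>
  define \<rho> where "\<rho> y = ((\<lambda>i. j (y i)), \<zero>\<^bsub>H\<^esub> \<ominus>\<^bsub>H\<^esub> ?\<sigma> N y)" for y
  have h\<rho>: "\<rho> \<in> module_hom A ?PY D"
    unfolding \<rho>_def D_def
    by (intro hom_pair power_module_homI hom_comp[OF DG(2) hom_power_module_nth]
        hom_diff[OF lPY lH hom_zero[OF lH] hs]) simp
  have \<rho>_closed: "\<rho> y \<in> carrier D" if "y \<in> carrier ?PY" for y by (rule hom_closed[OF h\<rho> that])
  obtain E \<pi> where E: "E \<in> Amod K A" "\<pi> \<in> module_hom A D E" "\<pi> ` carrier D = carrier E"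
    and ker\<pi>: "\<And>x. x \<in> carrier D \<Longrightarrow> \<pi> x = \<zero>\<^bsub>E\<^esub> \<longleftrightarrow> x \<in> \<rho> ` carrier ?PY"
    using obtain_quotient[OF fD left_submodule_image[OF lPY lD h\<rho>]] by blast
  note fE = Amod_fd_module[OF E(1)]
  note lE = fd_module_left_module[OF fE]
  interpret pi: left_module_hom A D E \<pi> by (rule left_module_homI[OF lD lE E(2)])
  have \<pi>\<rho>: "\<pi> (\<rho> y) = \<zero>\<^bsub>E\<^esub>" if "y \<in> carrier ?PY" for y
    using ker\<pi>[OF \<rho>_closed[OF that]] that by blast
  have \<pi>_add_\<rho>: "\<pi> (x \<oplus>\<^bsub>D\<^esub> \<rho> y) = \<pi> x" if "x \<in> carrier D" "y \<in> carrier ?PY" for x y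
    using that \<rho>_closed[of y] by (simp add: \<pi>\<rho>)
  define s where "s x = (shift_seq N \<zero>\<^bsub>G\<^esub> (t (fst x M)) (fst x), u (snd x))" for x
  have hsD: "s \<in> module_hom A D D"
    unfolding s_def D_def
  proof (intro hom_pair power_module_homI hom_comp[OF DH(1) hom_snd])
    have nth: "(\<lambda>x. fst x i) \<in> module_hom A (direct_sum (power_module G N) H) G" for i
      by (rule hom_comp[OF hom_power_module_nth hom_fst])
    show "(\<lambda>x. shift_seq N \<zero>\<^bsub>G\<^esub> (t (fst x M)) (fst x) i)
        \<in> module_hom A (direct_sum (power_module G N) H) G" for i
    proof -
      consider "i = 0" | "0 < i" "i < N" | "i \<ge> N" "i \<noteq> 0" by linarith
      then show ?thesis
        by cases (simp_all add: shift_seq_def nth hom_comp[OF DG(1) nth] hom_zero[OF lG])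
    qed
  qed (simp add: shift_seq_def N_def)
  interpret s: left_module_hom A D D s by (rule left_module_homI[OF lD lD hsD])
  have s\<rho>: "s (\<rho> y) = \<rho> (sY y)" if y: "y \<in> carrier ?PY" for y
  proof -
    have "u (\<zero>\<^bsub>H\<^esub> \<ominus>\<^bsub>H\<^esub> ?\<sigma> N y) = \<zero>\<^bsub>H\<^esub> \<ominus>\<^bsub>H\<^esub> ?\<sigma> N (sY y)"
      using \<sigma>_closed[OF y] by (simp add: u_\<sigma>[OF y])
    moreover have "shift_seq N \<zero>\<^bsub>G\<^esub> (t (j (y M))) (\<lambda>i. j (y i)) = (\<lambda>i. j (sY y i))"
      using y by (auto simp: fun_eq_iff shift_seq_def sY_def tj)
    ultimately show ?thesis by (simp add: s_def \<rho>_def)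
  qed
  obtain v where v: "v \<in> module_hom A E E" "\<And>x. x \<in> carrier D \<Longrightarrow> v (\<pi> x) = \<pi> (s x)"
  proof (rule hom_factor_surj[OF lD lE lE E(2,3) hom_comp[OF E(2) hsD]])
    fix x assume x: "x \<in> carrier D" "\<pi> x = \<zero>\<^bsub>E\<^esub>"
    then obtain y where "y \<in> carrier ?PY" "x = \<rho> y" using ker\<pi>[OF x(1)] by blast
    then show "\<pi> (s x) = \<zero>\<^bsub>E\<^esub>" by (simp only: s\<rho> \<pi>\<rho> sY)
  qed blast
  define b where "b x = p (fst x (0::nat)) \<oplus>\<^bsub>X\<^esub> p (j (q (snd x)))" for x
  have hb: "b \<in> module_hom A D X"
    unfolding b_def D_def
    by (intro hom_add[OF lD[unfolded D_def] lX] hom_comp[OF DG(6)] hom_comp[OF hom_power_module_nth hom_fst]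
        hom_comp[OF DG(2)] hom_comp[OF DH(6) hom_snd])
  have b\<rho>: "b (\<rho> y) = \<zero>\<^bsub>X\<^esub>" if y: "y \<in> carrier ?PY" for y
  proof -
    have yc: "y 0 \<in> carrier Y" using y by simp
    have "q (\<zero>\<^bsub>H\<^esub> \<ominus>\<^bsub>H\<^esub> ?\<sigma> N y) = \<zero>\<^bsub>Y\<^esub> \<ominus>\<^bsub>Y\<^esub> y 0"
      using \<sigma>_closed[OF y, of N] q_\<sigma>[OF y, of M] unfolding N_def by (simp del: twisted_sum.simps)
    then show ?thesis using yc by (simp add: b_def \<rho>_def a_minus_def io.M.r_neg)
  qed
  obtain c where c: "c \<in> module_hom A E X" "\<And>x. x \<in> carrier D \<Longrightarrow> c (\<pi> x) = b x"
  proof (rule hom_factor_surj[OF lD lE lX E(2,3) hb])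
    fix x assume x: "x \<in> carrier D" "\<pi> x = \<zero>\<^bsub>E\<^esub>"
    then obtain y where "y \<in> carrier ?PY" "x = \<rho> y" using ker\<pi>[OF x(1)] by blast
    then show "b x = \<zero>\<^bsub>X\<^esub>" by (simp only: b\<rho>)
  qed blast
  have in_D: "(g, h) \<in> carrier D \<longleftrightarrow> g \<in> carrier (power_module G N) \<and> h \<in> carrier H" for g h
    by (simp add: D_def)
  have ex_D: "\<exists>g h. e = \<pi> (g, h) \<and> (g, h) \<in> carrier D" if "e \<in> carrier E" for e
    using that E(3) by (metis imageE surj_pair)
  let ?z = "\<lambda>i::nat. \<zero>\<^bsub>G\<^esub>"
  let ?m = "\<lambda>w. (?z, m w)" and ?i = "\<lambda>x. (\<lambda>i::nat. if i = 0 then \<iota> x else \<zero>\<^bsub>G\<^esub>, \<zero>\<^bsub>H\<^esub>)"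
  have hm: "?m \<in> module_hom A W D" unfolding D_def using hom_pair[OF hom_zero[OF lP] DH(2)] by simp
  have hi: "?i \<in> module_hom A X D"
    unfolding D_def
  proof (intro hom_pair hom_zero[OF lH] power_module_homI)
    show "(\<lambda>x. if i = 0 then \<iota> x else \<zero>\<^bsub>G\<^esub>) \<in> module_hom A X G" for i :: nat
      by (cases "i = 0") (simp_all add: DG(5) hom_zero[OF lG])
  qed (simp add: N_def)
  have "deg_endo A X W E v (\<lambda>w. \<pi> (?m w)) (\<lambda>x. \<pi> (?i x)) c"
    unfolding deg_endo_def
  proof (intro conjI ballI)
    interpret pm: left_module_hom A W E "\<lambda>w. \<pi> (?m w)"
      by (rule left_module_homI[OF lW lE hom_comp[OF E(2) hm]])
    show "inj_on (\<lambda>w. \<pi> (?m w)) (carrier W)"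
      unfolding pm.inj_iff
    proof (intro ballI impI)
      fix w assume w: "w \<in> carrier W" "\<pi> (?m w) = \<zero>\<^bsub>E\<^esub>"
      then obtain y where y: "y \<in> carrier ?PY" "?m w = \<rho> y" using ker\<pi>[OF hom_closed[OF hm w(1)]] by blast
      have "j (y i) = \<zero>\<^bsub>G\<^esub>" for i using y(2) by (simp add: \<rho>_def fun_eq_iff)
      then have "y = (\<lambda>i. \<zero>\<^bsub>Y\<^esub>)" using j0 y(1) by (simp add: fun_eq_iff)
      then have "m w = \<zero>\<^bsub>H\<^esub>" using y(2) \<sigma>0[of N] by (simp add: \<rho>_def a_minus_def)
      then show "w = \<zero>\<^bsub>W\<^esub>" by (rule m0[OF w(1)])
    qed
    show "(\<lambda>w. \<pi> (?m w)) ` carrier W = {e \<in> carrier E. v e = \<zero>\<^bsub>E\<^esub>}"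
    proof (intro subset_antisym subsetI)
      fix e assume "e \<in> (\<lambda>w. \<pi> (?m w)) ` carrier W"
      then obtain w where w: "w \<in> carrier W" "e = \<pi> (?m w)" by blast
      have "s (?m w) = (?z, \<zero>\<^bsub>H\<^esub>)" using w(1) by (auto simp: s_def shift_seq_def um fun_eq_iff)
      also have "\<dots> = \<zero>\<^bsub>D\<^esub>" by (simp add: D_def)
      finally have "v e = \<zero>\<^bsub>E\<^esub>" using w v(2)[OF hom_closed[OF hm w(1)]] by simp
      then show "e \<in> {e \<in> carrier E. v e = \<zero>\<^bsub>E\<^esub>}" using w hom_closed[OF hm w(1)] by simp
    next
      fix e assume "e \<in> {e \<in> carrier E. v e = \<zero>\<^bsub>E\<^esub>}"
      then obtain g h where gh: "(g, h) \<in> carrier D" "e = \<pi> (g, h)" and ve: "v e = \<zero>\<^bsub>E\<^esub>" using ex_D by blast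
      have gc: "g i \<in> carrier G" and g0: "i \<ge> N \<Longrightarrow> g i = \<zero>\<^bsub>G\<^esub>" and hc: "h \<in> carrier H" for i
        using gh(1) by (auto simp: D_def)
      have "\<pi> (s (g, h)) = \<zero>\<^bsub>E\<^esub>" using ve gh v(2) by simp
      then obtain y where y: "y \<in> carrier ?PY" and sy: "s (g, h) = \<rho> y"
        using ker\<pi>[OF s.closed[OF gh(1)]] by blast
      have yc: "y i \<in> carrier Y" and yN: "i \<ge> N \<Longrightarrow> y i = \<zero>\<^bsub>Y\<^esub>" for i using y by auto
      have comp: "shift_seq N \<zero>\<^bsub>G\<^esub> (t (g M)) g i = j (y i)" for i
        using sy by (simp add: s_def \<rho>_def fun_eq_iff)
      have uh: "u h = \<zero>\<^bsub>H\<^esub> \<ominus>\<^bsub>H\<^esub> ?\<sigma> N y" using sy by (simp add: s_def \<rho>_def)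
      have "q (\<zero>\<^bsub>H\<^esub> \<ominus>\<^bsub>H\<^esub> ?\<sigma> N y) = \<zero>\<^bsub>Y\<^esub> \<ominus>\<^bsub>Y\<^esub> y 0"
        using \<sigma>_closed[OF y, of N] q_\<sigma>[OF y, of M] unfolding N_def by (simp del: twisted_sum.simps)
      then have "\<zero>\<^bsub>Y\<^esub> \<ominus>\<^bsub>Y\<^esub> y 0 = \<zero>\<^bsub>Y\<^esub>" using qu[OF hc] uh by simp
      then have y0: "y 0 = \<zero>\<^bsub>Y\<^esub>" using yc by (simp add: j.M.diff_eq_zero_iff)
      then have "t (g M) = \<zero>\<^bsub>G\<^esub>" using comp[of 0] by (simp add: shift_seq_def)
      then have "g M \<in> j ` carrier Y" unfolding DG(4) using gc by simp
      then obtain y' where y': "y' \<in> carrier Y" "g M = j y'" by blast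
      define y2 where "y2 i = (if i < M then y (Suc i) else if i = M then y' else \<zero>\<^bsub>Y\<^esub>)" for i
      have y2: "y2 \<in> carrier ?PY" using yc y'(1) by (simp add: y2_def N_def)
      have gy2: "g i = j (y2 i)" for i
      proof -
        consider "i < M" | "i = M" | "i > M" by linarith
        then show ?thesis
        proof cases
          case 1
          then show ?thesis using comp[of "Suc i"] by (simp add: y2_def shift_seq_def N_def)
        next
          case 3
          then show ?thesis using g0[of i] by (simp add: y2_def N_def)
        qed (simp add: y2_def y')
      qed
      have "sY y2 i = y i" for i
        using y0 yN[of i] by (auto simp: sY_def shift_seq_def y2_def N_def)
      then have "sY y2 = y" by (simp add: fun_eq_iff)
      then have u2: "u (?\<sigma> N y2) = ?\<sigma> N y" using u_\<sigma>[OF y2] by simp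
      let ?k = "h \<oplus>\<^bsub>H\<^esub> ?\<sigma> N y2"
      have kc: "?k \<in> carrier H" using hc \<sigma>_closed[OF y2] by simp
      have "u ?k = \<zero>\<^bsub>H\<^esub>"
        using hc \<sigma>_closed[OF y2] \<sigma>_closed[OF y] uh u2 by (simp add: a_minus_def u.M.l_neg)
      then have "?k \<in> m ` carrier W" unfolding DH(4) using kc by simp
      then obtain w where w: "w \<in> carrier W" "?k = m w" by blast
      have "m w \<oplus>\<^bsub>H\<^esub> (\<zero>\<^bsub>H\<^esub> \<ominus>\<^bsub>H\<^esub> ?\<sigma> N y2) = h"
        unfolding w(2)[symmetric] using hc \<sigma>_closed[OF y2, of N] by (simp add: a_minus_def u.M.a_assoc u.M.r_neg)
      then have "(g, h) = ?m w \<oplus>\<^bsub>D\<^esub> \<rho> y2"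
        using y2 by (simp add: D_def \<rho>_def fun_eq_iff gy2)
      then have "e = \<pi> (?m w)" using gh(2) \<pi>_add_\<rho>[OF hom_closed[OF hm w(1)] y2] by simp
      then show "e \<in> (\<lambda>w. \<pi> (?m w)) ` carrier W" using w(1) by blast
    qed
    show "c (\<pi> (?i x)) = x" if x: "x \<in> carrier X" for x
      using x by (simp add: c(2)[OF hom_closed[OF hi x]] b_def DG(7))
    show "v ` carrier E = {e \<in> carrier E. c e = \<zero>\<^bsub>X\<^esub>}"
    proof (intro subset_antisym subsetI)
      fix e assume "e \<in> v ` carrier E"
      then obtain e' where e': "e' \<in> carrier E" "e = v e'" by blast
      then obtain g h where gh: "(g, h) \<in> carrier D" "e' = \<pi> (g, h)" using ex_D by blast
      have gc: "g i \<in> carrier G" and hc: "h \<in> carrier H" for i using gh(1) by (auto simp: D_def)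
      have e: "e = \<pi> (s (g, h))" using e'(2) gh v(2) by simp
      have "b (s (g, h)) = \<zero>\<^bsub>X\<^esub>" using gc hc by (simp add: b_def s_def shift_seq_def pt qu)
      then have "c e = \<zero>\<^bsub>X\<^esub>" unfolding e c(2)[OF s.closed[OF gh(1)]] .
      then show "e \<in> {e \<in> carrier E. c e = \<zero>\<^bsub>X\<^esub>}" using e pi.closed[OF s.closed[OF gh(1)]] by simp
    next
      fix e assume "e \<in> {e \<in> carrier E. c e = \<zero>\<^bsub>X\<^esub>}"
      then obtain g h where gh: "(g, h) \<in> carrier D" "e = \<pi> (g, h)" and ce: "c e = \<zero>\<^bsub>X\<^esub>" using ex_D by blast
      have gc: "g i \<in> carrier G" and g0: "i \<ge> N \<Longrightarrow> g i = \<zero>\<^bsub>G\<^esub>" and hc: "h \<in> carrier H" for i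
        using gh(1) by (auto simp: D_def)
      define y0 where "y0 = q h"
      have y0: "y0 \<in> carrier Y" using hc by (simp add: y0_def)
      have "q (h \<ominus>\<^bsub>H\<^esub> \<kappa> y0) = \<zero>\<^bsub>Y\<^esub>" using hc y0 by (simp add: DH(7) y0_def j.M.diff_self)
      then have "h \<ominus>\<^bsub>H\<^esub> \<kappa> y0 \<in> u ` carrier H" unfolding DH(8) using hc y0 by simp
      then obtain h' where h': "h' \<in> carrier H" "h \<ominus>\<^bsub>H\<^esub> \<kappa> y0 = u h'" by blast
      have "b (g, h) = \<zero>\<^bsub>X\<^esub>" using ce gh c(2) by simp
      then have "p (g 0 \<oplus>\<^bsub>G\<^esub> j y0) = \<zero>\<^bsub>X\<^esub>" using gc y0 by (simp add: b_def y0_def)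
      then have "g 0 \<oplus>\<^bsub>G\<^esub> j y0 \<in> t ` carrier G" unfolding DG(8) using gc y0 by simp
      then obtain g' where g': "g' \<in> carrier G" "g 0 \<oplus>\<^bsub>G\<^esub> j y0 = t g'" by blast
      define y where "y i = (if i = 0 then y0 else \<zero>\<^bsub>Y\<^esub>)" for i :: nat
      have y: "y \<in> carrier ?PY" using y0 by (simp add: y_def N_def)
      have "?\<sigma> (Suc n) y = \<kappa> y0" for n
      proof (induction n)
        case (Suc n)
        have "(u ^^ Suc n) \<zero>\<^bsub>H\<^esub> = \<zero>\<^bsub>H\<^esub>" by (rule funpow_fixed) simp
        then show ?case using Suc y0 by (simp add: y_def del: funpow.simps)
      qed (simp add: y_def y0)
      then have \<sigma>y: "?\<sigma> N y = \<kappa> y0" by (simp add: N_def)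
      define g2 where "g2 i = (if i < M then g (Suc i) else if i = M then g' else \<zero>\<^bsub>G\<^esub>)" for i
      have g2: "(g2, h') \<in> carrier D" using gc g'(1) h'(1) by (simp add: in_D g2_def N_def)
      have "shift_seq N \<zero>\<^bsub>G\<^esub> (t (g2 M)) g2 i = g i \<oplus>\<^bsub>G\<^esub> j (y i)" for i
        using g'(2) g0[of i] gc[of i] by (auto simp: shift_seq_def g2_def y_def N_def)
      moreover have "h \<oplus>\<^bsub>H\<^esub> (\<zero>\<^bsub>H\<^esub> \<ominus>\<^bsub>H\<^esub> ?\<sigma> N y) = u h'"
        using h' hc y0 by (simp add: \<sigma>y a_minus_def)
      ultimately have "s (g2, h') = (g, h) \<oplus>\<^bsub>D\<^esub> \<rho> y"
        by (simp add: s_def \<rho>_def D_def fun_eq_iff)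
      then have "e = v (\<pi> (g2, h'))" using v(2)[OF g2] \<pi>_add_\<rho>[OF gh(1) y] gh(2) by simp
      then show "e \<in> v ` carrier E" using pi.closed[OF g2] by blast
    qed
  qed (intro v(1) c(1) hom_comp[OF E(2) hm] hom_comp[OF E(2) hi])+
  then show ?thesis by (rule deg_le_if_deg_endo[OF X W fE])
qed

theorem deg_le_trans:
  fixes X :: "('a, 'm, 's) module_scheme" and Y :: "('a, 'n, 't) module_scheme"
  assumes X: "fd_module K A X" and Y: "fd_module K A Y" and W: "fd_module K A W"
    and XY: "deg_le K A X Y" and YW: "deg_le K A Y W"
  shows "deg_le K A X W"
proof -
  obtain G :: "('a, 'm \<times> 'k list) module" and t j \<iota> p
    where G: "fd_module K A G" "deg_endo A X Y G t j \<iota> p"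
    by (rule deg_endo_if_deg_le[OF X Y XY])
  obtain H' :: "('a, 'n \<times> 'k list) module" and u' m' \<kappa>' q'
    where H': "fd_module K A H'" "deg_endo A Y W H' u' m' \<kappa>' q'"
    by (rule deg_endo_if_deg_le[OF Y W YW])
  obtain H u m \<kappa> q n where H: "H \<in> Amod K A" "deg_endo A Y W H u m \<kappa> q"
    "n > 0" "\<forall>x\<in>carrier H. (u ^^ n) x = \<zero>\<^bsub>H\<^esub>"
    by (rule deg_endo_nilpotent[OF Y W H'])
  then obtain M where M: "n = Suc M" by (cases n) auto
  show ?thesis
    by (rule deg_le_trans_nilpotent[OF X Y W G Amod_fd_module[OF H(1)] H(2), where M = M])
      (use H(4) in \<open>simp only: M\<close>)
qed

end

section \<open>Projective modules and stable equivalence\<close>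

lemma mod_iso_direct_sum_swap:
  "mod_iso R (direct_sum (direct_sum L M) N) (direct_sum (direct_sum L N) M)"
proof -
  note mod_iso_direct_sum_assoc
  also have "mod_iso R (direct_sum L (direct_sum M N)) (direct_sum L (direct_sum N M))"
    by (intro mod_iso_direct_sum mod_iso_refl mod_iso_direct_sum_commute)
  also have "mod_iso R \<dots> (direct_sum (direct_sum L N) M)"
    by (rule mod_iso_sym[OF mod_iso_direct_sum_assoc])
  finally show ?thesis .
qed

context fd_algebra
begin

lemma projective_retract:
  assumes P: "fd_module K A P" and R: "projective K A R"
    and i: "i \<in> module_hom A P R" and r: "r \<in> module_hom A R P"
    and ri: "\<And>x. x \<in> carrier P \<Longrightarrow> r (i x) = x"
  shows "projective K A P"
  unfolding projective_def
proof (intro conjI ballI impI P)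
  fix M N g h
  assume M: "M \<in> Amod K A" and N: "N \<in> Amod K A" and g: "g \<in> module_hom A M N"
    and h: "h \<in> module_hom A P N" and surj: "g ` carrier M = carrier N"
  obtain l where l: "l \<in> module_hom A R M" "\<forall>x\<in>carrier R. g (l x) = h (r x)"
    by (rule projective_lift[OF R Amod_fd_module[OF M] Amod_fd_module[OF N] g surj hom_comp[OF h r]])
  show "\<exists>l\<in>module_hom A P M. \<forall>x\<in>carrier P. g (l x) = h x"
    by (rule bexI[OF _ hom_comp[OF l(1) i]]) (simp add: l(2) hom_closed[OF i] ri)
qed

lemma projective_iso:
  assumes "fd_module K A P" "projective K A R" "mod_iso A P R"
  shows "projective K A P"
proof -
  obtain f g where fg: "f \<in> module_hom A P R" "g \<in> module_hom A R P"
    "\<And>x. x \<in> carrier P \<Longrightarrow> g (f x) = x" "\<And>y. y \<in> carrier R \<Longrightarrow> f (g y) = y"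
    using mod_isoE[OF assms(3)] by blast
  show ?thesis by (rule projective_retract[OF assms(1,2) fg(1,2,3)])
qed

lemma projective_direct_sum:
  assumes P: "projective K A P" and Q: "projective K A Q"
  shows "projective K A (direct_sum P Q)"
  unfolding projective_def
proof (intro conjI ballI impI)
  note fP = projective_fd_module[OF P] and fQ = projective_fd_module[OF Q]
  note lP = fd_module_left_module[OF fP] and lQ = fd_module_left_module[OF fQ]
  interpret P: left_module A P by (rule lP)
  interpret Q: left_module A Q by (rule lQ)
  show "fd_module K A (direct_sum P Q)" by (rule fd_module_direct_sum[OF fP fQ])
  fix M N g h
  assume M: "M \<in> Amod K A" and N: "N \<in> Amod K A" and g: "g \<in> module_hom A M N"
    and h: "h \<in> module_hom A (direct_sum P Q) N" and surj: "g ` carrier M = carrier N"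
  note fM = Amod_fd_module[OF M] and fN = Amod_fd_module[OF N]
  interpret g: left_module_hom A M N g
    by (rule left_module_homI[OF fd_module_left_module[OF fM] fd_module_left_module[OF fN] g])
  interpret h: left_module_hom A "direct_sum P Q" N h
    by (rule left_module_homI[OF left_module_direct_sum[OF lP lQ] fd_module_left_module[OF fN] h])
  obtain l where l: "l \<in> module_hom A P M" "\<forall>x\<in>carrier P. g (l x) = h (x, \<zero>\<^bsub>Q\<^esub>)"
    by (rule projective_lift[OF P fM fN g surj hom_comp[OF h hom_inl[OF lQ]]])
  obtain k where k: "k \<in> module_hom A Q M" "\<forall>x\<in>carrier Q. g (k x) = h (\<zero>\<^bsub>P\<^esub>, x)"
    by (rule projective_lift[OF Q fM fN g surj hom_comp[OF h hom_inr[OF lP]]])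
  have "g (l (fst z) \<oplus>\<^bsub>M\<^esub> k (snd z)) = h z" if z: "z \<in> carrier (direct_sum P Q)" for z
  proof -
    have "h z = h ((fst z, \<zero>\<^bsub>Q\<^esub>) \<oplus>\<^bsub>direct_sum P Q\<^esub> (\<zero>\<^bsub>P\<^esub>, snd z))" using z by auto
    also have "\<dots> = h (fst z, \<zero>\<^bsub>Q\<^esub>) \<oplus>\<^bsub>N\<^esub> h (\<zero>\<^bsub>P\<^esub>, snd z)" using z by (intro h.add) auto
    finally show ?thesis using z l k hom_closed[OF l(1)] hom_closed[OF k(1)] by auto
  qed
  then show "\<exists>l\<in>module_hom A (direct_sum P Q) M. \<forall>x\<in>carrier (direct_sum P Q). g (l x) = h x"
    by (intro bexI[OF _ hom_copair[OF lP lQ fd_module_left_module[OF fM] l(1) k(1)]] ballI)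
qed

lemma obtain_projective_zero:
  obtains Z where "Z \<in> Amod K A" "carrier Z = {\<zero>\<^bsub>Z\<^esub>}" "projective K A Z"
proof -
  obtain Z where Z: "Z \<in> Amod K A" "carrier Z = {\<zero>\<^bsub>Z\<^esub>}" by (rule obtain_zero_module)
  have "projective K A Z"
    unfolding projective_def
  proof (intro conjI ballI impI Amod_fd_module Z(1))
    fix M N g h
    assume M: "M \<in> Amod K A" and N: "N \<in> Amod K A" and g: "g \<in> module_hom A M N"
      and h: "h \<in> module_hom A Z N"
    note lM = fd_module_left_module[OF Amod_fd_module[OF M]]
    interpret g: left_module_hom A M N g
      by (rule left_module_homI[OF lM fd_module_left_module[OF Amod_fd_module[OF N]] g])
    interpret h: left_module_hom A Z N h
      by (rule left_module_homI[OF fd_module_left_module[OF Amod_fd_module[OF Z(1)]]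
            fd_module_left_module[OF Amod_fd_module[OF N]] h])
    show "\<exists>l\<in>module_hom A Z M. \<forall>x\<in>carrier Z. g (l x) = h x"
      by (rule bexI[OF _ hom_zero[OF lM]]) (simp add: Z(2))
  qed
  then show ?thesis using Z that by blast
qed

text \<open>Isomorphism up to projective direct summands; it will turn out to be isomorphism in the
  stable category.\<close>

definition proj_equiv :: "('a, 'm, 's) module_scheme \<Rightarrow> ('a, 'n, 't) module_scheme \<Rightarrow> bool" where
  "proj_equiv X Y \<longleftrightarrow> (\<exists>P\<in>Amod K A. \<exists>Q\<in>Amod K A. projective K A P \<and> projective K A Q \<and>
     mod_iso A (direct_sum X P) (direct_sum Y Q))"

lemma obtain_Amod_projective:
  assumes "projective K A P"
  obtains P' where "P' \<in> Amod K A" "projective K A P'" "mod_iso A P P'"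
proof -
  obtain P' where P': "P' \<in> Amod K A" "mod_iso A P P'"
    using obtain_Amod_iso[OF projective_fd_module[OF assms]] .
  then show ?thesis
    using that projective_iso[OF Amod_fd_module[OF P'(1)] assms mod_iso_sym[OF P'(2)]] by blast
qed

lemma proj_equivI:
  assumes P: "projective K A P" and Q: "projective K A Q"
    and iso: "mod_iso A (direct_sum X P) (direct_sum Y Q)"
  shows "proj_equiv X Y"
proof -
  obtain P' where P': "P' \<in> Amod K A" "projective K A P'" "mod_iso A P P'"
    by (rule obtain_Amod_projective[OF P])
  obtain Q' where Q': "Q' \<in> Amod K A" "projective K A Q'" "mod_iso A Q Q'"
    by (rule obtain_Amod_projective[OF Q])
  have "mod_iso A (direct_sum X P') (direct_sum X P)"
    by (rule mod_iso_direct_sum[OF mod_iso_refl mod_iso_sym[OF P'(3)]])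
  also note iso
  also have "mod_iso A (direct_sum Y Q) (direct_sum Y Q')"
    by (rule mod_iso_direct_sum[OF mod_iso_refl Q'(3)])
  finally show ?thesis using P' Q' unfolding proj_equiv_def by blast
qed

lemma proj_equivE:
  assumes "proj_equiv X Y"
  obtains P Q where "P \<in> Amod K A" "Q \<in> Amod K A" "projective K A P" "projective K A Q"
    "mod_iso A (direct_sum X P) (direct_sum Y Q)"
  using assms unfolding proj_equiv_def by blast

lemma proj_equiv_refl: "proj_equiv X X"
proof -
  obtain Z where "Z \<in> Amod K A" "projective K A Z" using obtain_projective_zero by blast
  then show ?thesis unfolding proj_equiv_def using mod_iso_refl by blast
qed

lemma proj_equiv_sym: "proj_equiv X Y \<Longrightarrow> proj_equiv Y X"
  unfolding proj_equiv_def using mod_iso_sym by blast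

lemma proj_equiv_trans:
  assumes XY: "proj_equiv X Y" and YW: "proj_equiv Y W"
  shows "proj_equiv X W"
proof -
  obtain P Q where "P \<in> Amod K A" "Q \<in> Amod K A" and P: "projective K A P" and Q: "projective K A Q"
    and iso: "mod_iso A (direct_sum X P) (direct_sum Y Q)"
    by (rule proj_equivE[OF XY])
  obtain P' Q' where "P' \<in> Amod K A" "Q' \<in> Amod K A" and P': "projective K A P'" and Q': "projective K A Q'"
    and iso': "mod_iso A (direct_sum Y P') (direct_sum W Q')"
    by (rule proj_equivE[OF YW])
  have "mod_iso A (direct_sum X (direct_sum P P')) (direct_sum (direct_sum X P) P')"
    by (rule mod_iso_sym[OF mod_iso_direct_sum_assoc])
  also have "mod_iso A \<dots> (direct_sum (direct_sum Y Q) P')"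
    by (rule mod_iso_direct_sum[OF iso mod_iso_refl])
  also note mod_iso_direct_sum_swap
  also have "mod_iso A (direct_sum (direct_sum Y P') Q) (direct_sum (direct_sum W Q') Q)"
    by (rule mod_iso_direct_sum[OF iso' mod_iso_refl])
  also note mod_iso_direct_sum_assoc
  finally show ?thesis by (rule proj_equivI[OF projective_direct_sum[OF P P'] projective_direct_sum[OF Q' Q]])
qed

section \<open>Stable degeneration\<close>

lemma st_leI:
  assumes X: "fd_module K A X" and Y: "fd_module K A Y"
    and P: "projective K A P" and Q: "projective K A Q"
    and deg: "deg_le K A (direct_sum X P) (direct_sum Y Q)"
  shows "st_le K A X Y"
proof -
  obtain P' where P': "P' \<in> Amod K A" "projective K A P'" "mod_iso A P P'"
    by (rule obtain_Amod_projective[OF P])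
  obtain Q' where Q': "Q' \<in> Amod K A" "projective K A Q'" "mod_iso A Q Q'"
    by (rule obtain_Amod_projective[OF Q])
  have "deg_le K A (direct_sum X P') (direct_sum Y Q')"
    by (rule deg_le_iso[OF _ _ _ _ deg mod_iso_direct_sum[OF mod_iso_refl P'(3)]
          mod_iso_direct_sum[OF mod_iso_refl Q'(3)]])
      (rule fd_module_direct_sum[OF X projective_fd_module[OF P]]
        fd_module_direct_sum[OF Y projective_fd_module[OF Q]]
        fd_module_direct_sum[OF X projective_fd_module[OF P'(2)]]
        fd_module_direct_sum[OF Y projective_fd_module[OF Q'(2)]])+
  then show ?thesis unfolding st_le_def using P' Q' by blast
qed

lemma st_leE:
  assumes "st_le K A X Y"
  obtains P Q where "P \<in> Amod K A" "Q \<in> Amod K A" "projective K A P" "projective K A Q"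
    "deg_le K A (direct_sum X P) (direct_sum Y Q)"
  using assms unfolding st_le_def by blast

lemma st_le_refl:
  assumes X: "fd_module K A X"
  shows "st_le K A X X"
proof -
  obtain Z where Z: "Z \<in> Amod K A" "projective K A Z" using obtain_projective_zero by blast
  have "deg_le K A (direct_sum X Z) (direct_sum X Z)"
    by (rule deg_le_refl[OF fd_module_direct_sum[OF X Amod_fd_module[OF Z(1)]]])
  then show ?thesis unfolding st_le_def using Z by blast
qed

lemma st_le_trans:
  assumes X: "fd_module K A X" and Y: "fd_module K A Y" and W: "fd_module K A W"
    and XY: "st_le K A X Y" and YW: "st_le K A Y W"
  shows "st_le K A X W"
proof -
  obtain P Q where "P \<in> Amod K A" "Q \<in> Amod K A" and P: "projective K A P" and Q: "projective K A Q"
    and deg: "deg_le K A (direct_sum X P) (direct_sum Y Q)"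
    by (rule st_leE[OF XY])
  obtain P' Q' where "P' \<in> Amod K A" "Q' \<in> Amod K A" and P': "projective K A P'" and Q': "projective K A Q'"
    and deg': "deg_le K A (direct_sum Y P') (direct_sum W Q')"
    by (rule st_leE[OF YW])
  note fd = fd_module_direct_sum and pf = projective_fd_module
  note fP = pf[OF P] and fQ = pf[OF Q] and fP' = pf[OF P'] and fQ' = pf[OF Q']
  have 1: "deg_le K A (direct_sum (direct_sum X P) P') (direct_sum (direct_sum Y Q) P')"
    by (rule deg_le_direct_sum[OF fd_module_left_module[OF fP'] deg])
  have 2: "deg_le K A (direct_sum (direct_sum Y P') Q) (direct_sum (direct_sum W Q') Q)"
    by (rule deg_le_direct_sum[OF fd_module_left_module[OF fQ] deg'])
  have "deg_le K A (direct_sum X (direct_sum P P')) (direct_sum (direct_sum Y P') Q)"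
    by (rule deg_le_iso[OF fd[OF fd[OF X fP] fP'] fd[OF fd[OF Y fQ] fP'] fd[OF X fd[OF fP fP']]
          fd[OF fd[OF Y fP'] fQ] 1 mod_iso_direct_sum_assoc mod_iso_direct_sum_swap])
  moreover have "deg_le K A (direct_sum (direct_sum Y P') Q) (direct_sum W (direct_sum Q' Q))"
    by (rule deg_le_iso[OF fd[OF fd[OF Y fP'] fQ] fd[OF fd[OF W fQ'] fQ] fd[OF fd[OF Y fP'] fQ]
          fd[OF W fd[OF fQ' fQ]] 2 mod_iso_refl mod_iso_direct_sum_assoc])
  ultimately have "deg_le K A (direct_sum X (direct_sum P P')) (direct_sum W (direct_sum Q' Q))"
    by (rule deg_le_trans[OF fd[OF X fd[OF fP fP']] fd[OF fd[OF Y fP'] fQ] fd[OF W fd[OF fQ' fQ]]])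
  then show ?thesis
    by (rule st_leI[OF X W projective_direct_sum[OF P P'] projective_direct_sum[OF Q' Q]])
qed

lemma st_le_proj_equiv:
  assumes X: "fd_module K A X" and Y: "fd_module K A Y" and XY: "proj_equiv X Y"
  shows "st_le K A X Y"
proof -
  obtain P Q where "P \<in> Amod K A" "Q \<in> Amod K A" and P: "projective K A P" and Q: "projective K A Q"
    and iso: "mod_iso A (direct_sum X P) (direct_sum Y Q)"
    by (rule proj_equivE[OF XY])
  note fXP = fd_module_direct_sum[OF X projective_fd_module[OF P]]
    and fYQ = fd_module_direct_sum[OF Y projective_fd_module[OF Q]]
  have "deg_le K A (direct_sum X P) (direct_sum Y Q)"
    by (rule deg_le_iso[OF fXP fXP fXP fYQ deg_le_refl[OF fXP] mod_iso_refl iso])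
  then show ?thesis by (rule st_leI[OF X Y P Q])
qed

theorem st_le_antisym:
  assumes X: "X \<in> Amod K A" and Y: "Y \<in> Amod K A" and XY: "st_le K A X Y" and YX: "st_le K A Y X"
  shows "proj_equiv X Y"
proof -
  obtain P Q where "P \<in> Amod K A" "Q \<in> Amod K A" and P: "projective K A P" and Q: "projective K A Q"
    and deg: "deg_le K A (direct_sum X P) (direct_sum Y Q)"
    by (rule st_leE[OF XY])
  obtain P' Q' where "P' \<in> Amod K A" "Q' \<in> Amod K A" and P': "projective K A P'" and Q': "projective K A Q'"
    and deg': "deg_le K A (direct_sum Y P') (direct_sum X Q')"
    by (rule st_leE[OF YX])
  note fd = fd_module_direct_sum and pf = projective_fd_module
  note fX = Amod_fd_module[OF X] and fY = Amod_fd_module[OF Y]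
  note fP = pf[OF P] and fQ = pf[OF Q] and fP' = pf[OF P'] and fQ' = pf[OF Q']
  have le: "hom_dim U X + hom_dim U P \<le> hom_dim U Y + hom_dim U Q"
    "hom_dim U Y + hom_dim U P' \<le> hom_dim U X + hom_dim U Q'" if U: "U \<in> Amod K A" for U
    using deg_le_hom_dim_le[OF Amod_fd_module[OF U] fd[OF fX fP] fd[OF fY fQ] deg]
      deg_le_hom_dim_le[OF Amod_fd_module[OF U] fd[OF fY fP'] fd[OF fX fQ'] deg']
    by (simp_all add: hom_dim_direct_sum_right[OF Amod_fd_module[OF U]] fX fY fP fQ fP' fQ')
  have eq: "hom_dim U X + hom_dim U P = hom_dim U Y + hom_dim U Q"
    "hom_dim U Y + hom_dim U P' = hom_dim U X + hom_dim U Q'" if U: "U \<in> Amod K A" "projective K A U" for U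
    using deg_le_hom_dim_eq[OF Amod_fd_module[OF U(1)] fd[OF fX fP] fd[OF fY fQ] deg U(2)]
      deg_le_hom_dim_eq[OF Amod_fd_module[OF U(1)] fd[OF fY fP'] fd[OF fX fQ'] deg' U(2)]
    by (simp_all add: hom_dim_direct_sum_right[OF Amod_fd_module[OF U(1)]] fX fY fP fQ fP' fQ')
  obtain P1 where P1: "P1 \<in> Amod K A" "mod_iso A (direct_sum P P') P1"
    using obtain_Amod_direct_sum[OF fP fP'] .
  obtain Q1 where Q1: "Q1 \<in> Amod K A" "projective K A Q1" "mod_iso A (direct_sum Q Q') Q1"
    using obtain_Amod_projective[OF projective_direct_sum[OF Q Q']] .
  have dP1: "hom_dim U P1 = hom_dim U P + hom_dim U P'" if U: "U \<in> Amod K A" for U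
    using hom_dim_iso_right[OF Amod_fd_module[OF U] fd[OF fP fP'] Amod_fd_module[OF P1(1)] P1(2)]
    by (simp add: hom_dim_direct_sum_right[OF Amod_fd_module[OF U] fP fP'])
  have dQ1: "hom_dim U Q1 = hom_dim U Q + hom_dim U Q'" if U: "U \<in> Amod K A" for U
    using hom_dim_iso_right[OF Amod_fd_module[OF U] fd[OF fQ fQ'] Amod_fd_module[OF Q1(1)] Q1(3)]
    by (simp add: hom_dim_direct_sum_right[OF Amod_fd_module[OF U] fQ fQ'])
  \<comment> \<open>The projective summands agree, because the inequality is an equality for \<open>U = Q1\<close>.\<close>
  have "mod_iso A P1 Q1"
  proof (rule mod_iso_if_hom_dim_le[OF P1(1) Q1(1)])
    show "hom_dim U P1 \<le> hom_dim U Q1" if "U \<in> Amod K A" for U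
      using le[OF that] dP1[OF that] dQ1[OF that] by simp
    show "hom_dim Q1 Q1 = hom_dim Q1 P1"
      using eq[OF Q1(1,2)] dP1[OF Q1(1)] dQ1[OF Q1(1)] by simp
  qed
  then have PQ: "hom_dim U P + hom_dim U P' = hom_dim U Q + hom_dim U Q'" if U: "U \<in> Amod K A" for U
    using hom_dim_iso_right[OF Amod_fd_module[OF U] Amod_fd_module[OF P1(1)] Amod_fd_module[OF Q1(1)]]
      dP1[OF U] dQ1[OF U] by simp
  note fM = fd[OF fX fd[OF fP fP']] and fN = fd[OF fY fd[OF fQ fP']]
  obtain M where M: "M \<in> Amod K A" "mod_iso A (direct_sum X (direct_sum P P')) M"
    using obtain_Amod_iso[OF fM] .
  obtain N where N: "N \<in> Amod K A" "mod_iso A (direct_sum Y (direct_sum Q P')) N"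
    using obtain_Amod_iso[OF fN] .
  have dM: "hom_dim U M = hom_dim U X + (hom_dim U P + hom_dim U P')" if U: "U \<in> Amod K A" for U
    using hom_dim_iso_right[OF Amod_fd_module[OF U] fM Amod_fd_module[OF M(1)] M(2)]
    by (simp add: hom_dim_direct_sum_right[OF Amod_fd_module[OF U]] fX fd[OF fP fP'] fP fP')
  have dN: "hom_dim U N = hom_dim U Y + (hom_dim U Q + hom_dim U P')" if U: "U \<in> Amod K A" for U
    using hom_dim_iso_right[OF Amod_fd_module[OF U] fN Amod_fd_module[OF N(1)] N(2)]
    by (simp add: hom_dim_direct_sum_right[OF Amod_fd_module[OF U]] fY fd[OF fQ fP'] fQ fP')
  have "mod_iso A M N"
  proof (rule mod_iso_if_hom_dim_le[OF M(1) N(1)])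
    show "hom_dim U M \<le> hom_dim U N" if "U \<in> Amod K A" for U
      using le(1)[OF that] dM[OF that] dN[OF that] by simp
    show "hom_dim N N = hom_dim N M"
      using le[OF N(1)] PQ[OF N(1)] dM[OF N(1)] dN[OF N(1)] by simp
  qed
  then have "mod_iso A (direct_sum X (direct_sum P P')) (direct_sum Y (direct_sum Q P'))"
    by (rule mod_iso_trans[OF mod_iso_trans[OF M(2)] mod_iso_sym[OF N(2)]])
  then show ?thesis
    by (rule proj_equivI[OF projective_direct_sum[OF P P'] projective_direct_sum[OF Q P']])
qed

end

section \<open>Isomorphism in the stable category\<close>

lemma (in left_module) diff_diff_cancel:
  assumes "x \<in> carrier M" "y \<in> carrier M" "z \<in> carrier M"
  shows "(x \<ominus>\<^bsub>M\<^esub> z) \<ominus>\<^bsub>M\<^esub> (y \<ominus>\<^bsub>M\<^esub> z) = x \<ominus>\<^bsub>M\<^esub> y"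
proof -
  have "(x \<ominus>\<^bsub>M\<^esub> z) \<ominus>\<^bsub>M\<^esub> (y \<ominus>\<^bsub>M\<^esub> z) = x \<oplus>\<^bsub>M\<^esub> (\<ominus>\<^bsub>M\<^esub> z \<oplus>\<^bsub>M\<^esub> (z \<oplus>\<^bsub>M\<^esub> \<ominus>\<^bsub>M\<^esub> y))"
    using assms by (simp add: a_minus_def minus_add a_ac)
  also have "\<dots> = x \<ominus>\<^bsub>M\<^esub> y" using assms by (simp add: a_minus_def r_neg1)
  finally show ?thesis .
qed

context fd_algebra
begin

text \<open>The function \<open>f\<close> agrees on \<open>X\<close> with a homomorphism that factors through a projective module.
  Unlike for \<^const>\<open>proj_maps\<close>, the values of \<open>f\<close> outside \<open>X\<close> are irrelevant.\<close>

definition factors_projective ::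
  "('a, 'm, 's) module_scheme \<Rightarrow> ('a, 'n, 't) module_scheme \<Rightarrow> ('m \<Rightarrow> 'n) \<Rightarrow> bool" where
  "factors_projective X Y f \<longleftrightarrow> (\<exists>P\<in>Amod K A. projective K A P \<and>
     (\<exists>a\<in>module_hom A X P. \<exists>b\<in>module_hom A P Y. \<forall>x\<in>carrier X. f x = b (a x)))"

lemma factors_projectiveI:
  assumes P: "projective K A P" and a: "a \<in> module_hom A X P" and b: "b \<in> module_hom A P Y"
    and f: "\<And>x. x \<in> carrier X \<Longrightarrow> f x = b (a x)"
  shows "factors_projective X Y f"
proof -
  obtain P' where P': "P' \<in> Amod K A" "projective K A P'" "mod_iso A P P'"
    by (rule obtain_Amod_projective[OF P])
  obtain \<phi> \<psi> where iso: "\<phi> \<in> module_hom A P P'" "\<psi> \<in> module_hom A P' P"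
    "\<And>x. x \<in> carrier P \<Longrightarrow> \<psi> (\<phi> x) = x" "\<And>y. y \<in> carrier P' \<Longrightarrow> \<phi> (\<psi> y) = y"
    using mod_isoE[OF P'(3)] by blast
  have "\<forall>x\<in>carrier X. f x = b (\<psi> (\<phi> (a x)))" by (simp add: f iso(3) hom_closed[OF a])
  then show ?thesis
    unfolding factors_projective_def
    using P'(2)
    by (intro bexI[OF _ P'(1)] conjI bexI[OF _ hom_comp[OF iso(1) a]] bexI[OF _ hom_comp[OF b iso(2)]])
qed

lemma factors_projectiveE:
  assumes "factors_projective X Y f"
  obtains P a b where "P \<in> Amod K A" "projective K A P" "a \<in> module_hom A X P"
    "b \<in> module_hom A P Y" "\<forall>x\<in>carrier X. f x = b (a x)"
  using assms unfolding factors_projective_def by blast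

lemma factors_projective_cong:
  "\<lbrakk>factors_projective X Y f; \<And>x. x \<in> carrier X \<Longrightarrow> g x = f x\<rbrakk> \<Longrightarrow> factors_projective X Y g"
  unfolding factors_projective_def by simp

lemma factors_projective_zero:
  assumes Y: "left_module A Y"
  shows "factors_projective X Y (\<lambda>x. \<zero>\<^bsub>Y\<^esub>)"
proof -
  obtain Z where Z: "Z \<in> Amod K A" "projective K A Z" using obtain_projective_zero by blast
  show ?thesis
    by (rule factors_projectiveI[OF Z(2) hom_zero[OF fd_module_left_module[OF Amod_fd_module[OF Z(1)]]]
          hom_zero[OF Y]]) simp
qed

lemma factors_projective_diff:
  assumes Y: "left_module A Y"
    and f: "factors_projective X Y f" and g: "factors_projective X Y g"
  shows "factors_projective X Y (\<lambda>x. f x \<ominus>\<^bsub>Y\<^esub> g x)"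
proof -
  obtain P a b where P: "P \<in> Amod K A" "projective K A P" "a \<in> module_hom A X P"
    "b \<in> module_hom A P Y" "\<forall>x\<in>carrier X. f x = b (a x)"
    by (rule factors_projectiveE[OF f])
  obtain Q c d where Q: "Q \<in> Amod K A" "projective K A Q" "c \<in> module_hom A X Q"
    "d \<in> module_hom A Q Y" "\<forall>x\<in>carrier X. g x = d (c x)"
    by (rule factors_projectiveE[OF g])
  note lS = fd_module_left_module[OF projective_fd_module[OF projective_direct_sum[OF P(2) Q(2)]]]
  show ?thesis
    by (rule factors_projectiveI[OF projective_direct_sum[OF P(2) Q(2)] hom_pair[OF P(3) Q(3)]
          hom_diff[OF lS Y hom_comp[OF P(4) hom_fst] hom_comp[OF Q(4) hom_snd]]])
      (simp add: P(5) Q(5))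
qed

lemma factors_projective_minus_commute:
  assumes Y: "left_module A Y" and f: "f \<in> module_hom A X Y" and g: "g \<in> module_hom A X Y"
    and fg: "factors_projective X Y (\<lambda>x. f x \<ominus>\<^bsub>Y\<^esub> g x)"
  shows "factors_projective X Y (\<lambda>x. g x \<ominus>\<^bsub>Y\<^esub> f x)"
proof -
  interpret Y: left_module A Y by (rule Y)
  show ?thesis
    by (rule factors_projective_cong[OF factors_projective_diff[OF Y factors_projective_zero[OF Y] fg]])
      (simp add: a_minus_def Y.minus_add Y.a_comm hom_closed[OF f] hom_closed[OF g])
qed

lemma factors_projective_diff_trans:
  assumes Y: "left_module A Y" and f: "f \<in> module_hom A X Y" and g: "g \<in> module_hom A X Y"
    and h: "h \<in> module_hom A X Y"
    and fg: "factors_projective X Y (\<lambda>x. f x \<ominus>\<^bsub>Y\<^esub> g x)"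
    and gh: "factors_projective X Y (\<lambda>x. g x \<ominus>\<^bsub>Y\<^esub> h x)"
  shows "factors_projective X Y (\<lambda>x. f x \<ominus>\<^bsub>Y\<^esub> h x)"
proof -
  interpret Y: left_module A Y by (rule Y)
  note hg = factors_projective_minus_commute[OF Y g h gh]
  show ?thesis
    by (rule factors_projective_cong[OF factors_projective_diff[OF Y fg hg]])
      (simp add: Y.diff_diff_cancel hom_closed[OF f] hom_closed[OF g] hom_closed[OF h])
qed

lemma factors_projective_postcompose:
  assumes f: "factors_projective X Y f" and g: "g \<in> module_hom A Y W"
  shows "factors_projective X W (\<lambda>x. g (f x))"
proof -
  obtain P a b where P: "P \<in> Amod K A" "projective K A P" "a \<in> module_hom A X P"
    "b \<in> module_hom A P Y" "\<forall>x\<in>carrier X. f x = b (a x)"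
    by (rule factors_projectiveE[OF f])
  show ?thesis by (rule factors_projectiveI[OF P(2,3) hom_comp[OF g P(4)]]) (simp add: P(5))
qed

lemma factors_projective_precompose:
  assumes f: "factors_projective X Y f" and g: "g \<in> module_hom A W X"
  shows "factors_projective W Y (\<lambda>x. f (g x))"
proof -
  obtain P a b where P: "P \<in> Amod K A" "projective K A P" "a \<in> module_hom A X P"
    "b \<in> module_hom A P Y" "\<forall>x\<in>carrier X. f x = b (a x)"
    by (rule factors_projectiveE[OF f])
  show ?thesis
    by (rule factors_projectiveI[OF P(2) hom_comp[OF P(3) g] P(4)]) (simp add: P(5) hom_closed[OF g])
qed

lemma stable_eq_iff:
  assumes X: "left_module A X" and Y: "left_module A Y"
  shows "(f, g) \<in> stable_eq K A X Y \<longleftrightarrow> f \<in> Hom A X Y \<and> g \<in> Hom A X Y \<and>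
    factors_projective X Y (\<lambda>x. f x \<ominus>\<^bsub>Y\<^esub> g x)"
proof
  assume fg: "(f, g) \<in> stable_eq K A X Y"
  then have f: "f \<in> Hom A X Y" and g: "g \<in> Hom A X Y"
    and p: "(\<lambda>x\<in>carrier X. f x \<ominus>\<^bsub>Y\<^esub> g x) \<in> proj_maps K A X Y"
    by (auto simp: stable_eq_def)
  from p obtain P a b where P: "P \<in> Amod K A" "projective K A P" "a \<in> Hom A X P" "b \<in> Hom A P Y"
    "(\<lambda>x\<in>carrier X. f x \<ominus>\<^bsub>Y\<^esub> g x) = compose (carrier X) b a"
    unfolding proj_maps_def by blast
  have "f x \<ominus>\<^bsub>Y\<^esub> g x = b (a x)" if "x \<in> carrier X" for x
    using fun_cong[OF P(5), of x] that by (simp add: compose_def)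
  then have "factors_projective X Y (\<lambda>x. f x \<ominus>\<^bsub>Y\<^esub> g x)"
    by (rule factors_projectiveI[OF P(2) Hom_module_hom[OF P(3)] Hom_module_hom[OF P(4)]])
  then show "f \<in> Hom A X Y \<and> g \<in> Hom A X Y \<and> factors_projective X Y (\<lambda>x. f x \<ominus>\<^bsub>Y\<^esub> g x)"
    using f g by blast
next
  assume "f \<in> Hom A X Y \<and> g \<in> Hom A X Y \<and> factors_projective X Y (\<lambda>x. f x \<ominus>\<^bsub>Y\<^esub> g x)"
  then have f: "f \<in> Hom A X Y" and g: "g \<in> Hom A X Y"
    and p: "factors_projective X Y (\<lambda>x. f x \<ominus>\<^bsub>Y\<^esub> g x)" by auto
  obtain P a b where P: "P \<in> Amod K A" "projective K A P" "a \<in> module_hom A X P"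
    "b \<in> module_hom A P Y" "\<forall>x\<in>carrier X. f x \<ominus>\<^bsub>Y\<^esub> g x = b (a x)"
    by (rule factors_projectiveE[OF p])
  note lP = fd_module_left_module[OF Amod_fd_module[OF P(1)]]
  have a: "(\<lambda>x\<in>carrier X. a x) \<in> Hom A X P" by (rule restrict_Hom[OF X P(3)])
  have b: "(\<lambda>x\<in>carrier P. b x) \<in> Hom A P Y" by (rule restrict_Hom[OF lP P(4)])
  have d: "(\<lambda>x\<in>carrier X. f x \<ominus>\<^bsub>Y\<^esub> g x) \<in> Hom A X Y"
    by (rule restrict_Hom[OF X hom_diff[OF X Y Hom_module_hom[OF f] Hom_module_hom[OF g]]])
  have "(\<lambda>x\<in>carrier X. f x \<ominus>\<^bsub>Y\<^esub> g x) =
      compose (carrier X) (\<lambda>x\<in>carrier P. b x) (\<lambda>x\<in>carrier X. a x)"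
    unfolding compose_def by (rule restrict_ext) (simp add: P(5) hom_closed[OF P(3)])
  then have "(\<lambda>x\<in>carrier X. f x \<ominus>\<^bsub>Y\<^esub> g x) \<in> proj_maps K A X Y"
    unfolding proj_maps_def using d a b P(1,2) by blast
  then show "(f, g) \<in> stable_eq K A X Y" using f g by (simp add: stable_eq_def)
qed

lemma equiv_stable_eq:
  assumes X: "left_module A X" and Y: "left_module A Y"
  shows "equiv (Hom A X Y) (stable_eq K A X Y)"
proof (rule equivI)
  interpret Y: left_module A Y by (rule Y)
  note iff = stable_eq_iff[OF X Y]
  show "stable_eq K A X Y \<subseteq> Hom A X Y \<times> Hom A X Y" by (auto simp: stable_eq_def)
  show "refl_on (Hom A X Y) (stable_eq K A X Y)"
  proof (rule refl_onI)
    fix f assume f: "f \<in> Hom A X Y"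
    have "factors_projective X Y (\<lambda>x. f x \<ominus>\<^bsub>Y\<^esub> f x)"
      by (rule factors_projective_cong[OF factors_projective_zero[OF Y]])
        (simp add: Hom_closed[OF f] Y.diff_self)
    then show "(f, f) \<in> stable_eq K A X Y" using f iff by blast
  qed
  show "sym (stable_eq K A X Y)"
  proof (rule symI)
    fix f g assume "(f, g) \<in> stable_eq K A X Y"
    then show "(g, f) \<in> stable_eq K A X Y"
      using factors_projective_minus_commute[OF Y Hom_module_hom Hom_module_hom, of f X g] unfolding iff by blast
  qed
  show "trans (stable_eq K A X Y)"
  proof (rule transI)
    fix f g h assume "(f, g) \<in> stable_eq K A X Y" "(g, h) \<in> stable_eq K A X Y"
    then show "(f, h) \<in> stable_eq K A X Y"
      using factors_projective_diff_trans[OF Y Hom_module_hom Hom_module_hom Hom_module_hom, of f X g h]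
      unfolding iff by blast
  qed
qed

text \<open>All composites of representatives lie in the class of the identity, because composition
  preserves the stable equivalence of homomorphisms.\<close>

lemma stable_comp_eq_id:
  assumes X: "left_module A X" and Y: "left_module A Y"
    and f: "f \<in> Hom A X Y" and g: "g \<in> Hom A Y X"
    and gf: "factors_projective X X (\<lambda>x. x \<ominus>\<^bsub>X\<^esub> g (f x))"
  shows "stable_comp K A X X (stable_eq K A Y X `` {g}) (stable_eq K A X Y `` {f}) = stable_id K A X"
proof -
  interpret X: left_module A X by (rule X)
  interpret Y: left_module A Y by (rule Y)
  note eqX = equiv_stable_eq[OF X X]
  have "stable_eq K A X X `` {compose (carrier X) g' f'} = stable_id K A X"
    if g': "(g, g') \<in> stable_eq K A Y X" and f': "(f, f') \<in> stable_eq K A X Y" for g' f'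
    unfolding stable_id_def
  proof (rule equiv_class_eq[OF eqX, OF equivE[OF eqX, THEN symD]])
    show "sym (stable_eq K A X X)" using eqX by (rule equivE)
    have hf': "f' \<in> Hom A X Y" and hg': "g' \<in> Hom A Y X"
      and ff': "factors_projective X Y (\<lambda>x. f x \<ominus>\<^bsub>Y\<^esub> f' x)"
      and gg': "factors_projective Y X (\<lambda>x. g x \<ominus>\<^bsub>X\<^esub> g' x)"
      using f' g' stable_eq_iff[OF X Y] stable_eq_iff[OF Y X] by auto
    note mf = Hom_module_hom[OF f] and mg = Hom_module_hom[OF g]
      and mf' = Hom_module_hom[OF hf'] and mg' = Hom_module_hom[OF hg']
    interpret g': left_module_hom A Y X g' by (rule left_module_homI[OF Y X mg'])
    have 1: "factors_projective X X (\<lambda>x. g (f x) \<ominus>\<^bsub>X\<^esub> g' (f x))"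
      by (rule factors_projective_precompose[OF gg' mf])
    have 2: "factors_projective X X (\<lambda>x. g' (f x) \<ominus>\<^bsub>X\<^esub> g' (f' x))"
      by (rule factors_projective_cong[OF factors_projective_postcompose[OF ff' mg']])
        (simp add: hom_closed[OF mf] hom_closed[OF mf'])
    have 3: "factors_projective X X (\<lambda>x. x \<ominus>\<^bsub>X\<^esub> g' (f x))"
      by (rule factors_projective_diff_trans[OF X hom_id hom_comp[OF mg mf] hom_comp[OF mg' mf] gf 1])
    have 4: "factors_projective X X (\<lambda>x. x \<ominus>\<^bsub>X\<^esub> g' (f' x))"
      by (rule factors_projective_diff_trans[OF X hom_id hom_comp[OF mg' mf] hom_comp[OF mg' mf'] 3 2])
    have "factors_projective X X (\<lambda>x. (\<lambda>x\<in>carrier X. x) x \<ominus>\<^bsub>X\<^esub> compose (carrier X) g' f' x)"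
      by (rule factors_projective_cong[OF 4]) (simp add: compose_def)
    moreover have "(\<lambda>x\<in>carrier X. x) \<in> Hom A X X" by (rule restrict_Hom[OF X hom_id])
    moreover have "compose (carrier X) g' f' \<in> Hom A X X"
      unfolding compose_def by (rule restrict_Hom[OF X hom_comp[OF mg' mf']])
    ultimately show "((\<lambda>x\<in>carrier X. x), compose (carrier X) g' f') \<in> stable_eq K A X X"
      unfolding stable_eq_iff[OF X X] by blast
  qed
  moreover have "g \<in> stable_eq K A Y X `` {g}" "f \<in> stable_eq K A X Y `` {f}"
    using equiv_class_self[OF equiv_stable_eq[OF Y X] g] equiv_class_self[OF equiv_stable_eq[OF X Y] f] .
  ultimately show ?thesis unfolding stable_comp_def by blast
qed

lemma factors_projective_of_stable_comp:
  assumes X: "left_module A X" and Y: "left_module A Y"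
    and f: "f \<in> Hom A X Y" and g: "g \<in> Hom A Y X"
    and id: "stable_comp K A X X (stable_eq K A Y X `` {g}) (stable_eq K A X Y `` {f}) = stable_id K A X"
  shows "factors_projective X X (\<lambda>x. x \<ominus>\<^bsub>X\<^esub> g (f x))"
proof -
  have c: "compose (carrier X) g f \<in> Hom A X X"
    unfolding compose_def by (rule restrict_Hom[OF X hom_comp[OF Hom_module_hom[OF g] Hom_module_hom[OF f]]])
  have "g \<in> stable_eq K A Y X `` {g}" "f \<in> stable_eq K A X Y `` {f}"
    "compose (carrier X) g f \<in> stable_eq K A X X `` {compose (carrier X) g f}"
    using equiv_class_self[OF equiv_stable_eq[OF Y X] g] equiv_class_self[OF equiv_stable_eq[OF X Y] f]
      equiv_class_self[OF equiv_stable_eq[OF X X] c] .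
  then have "compose (carrier X) g f \<in> stable_id K A X" unfolding id[symmetric] stable_comp_def by blast
  then have "factors_projective X X (\<lambda>x. (\<lambda>x\<in>carrier X. x) x \<ominus>\<^bsub>X\<^esub> compose (carrier X) g f x)"
    unfolding stable_id_def by (simp add: stable_eq_iff[OF X X])
  then show ?thesis by (rule factors_projective_cong) (simp add: compose_def)
qed

lemma stable_iso_iff_factors:
  assumes X: "left_module A X" and Y: "left_module A Y"
  shows "stable_iso K A X Y \<longleftrightarrow> (\<exists>f\<in>module_hom A X Y. \<exists>g\<in>module_hom A Y X.
    factors_projective X X (\<lambda>x. x \<ominus>\<^bsub>X\<^esub> g (f x)) \<and> factors_projective Y Y (\<lambda>y. y \<ominus>\<^bsub>Y\<^esub> f (g y)))"
    (is "_ \<longleftrightarrow> ?R")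
proof
  assume "stable_iso K A X Y"
  then obtain \<phi> \<psi> where \<phi>: "\<phi> \<in> stable_Hom K A X Y" and \<psi>: "\<psi> \<in> stable_Hom K A Y X"
    and id: "stable_comp K A X X \<psi> \<phi> = stable_id K A X" "stable_comp K A Y Y \<phi> \<psi> = stable_id K A Y"
    unfolding stable_iso_def by blast
  obtain f where f: "\<phi> = stable_eq K A X Y `` {f}" "f \<in> Hom A X Y"
    using \<phi> unfolding stable_Hom_def by (rule quotientE)
  obtain g where g: "\<psi> = stable_eq K A Y X `` {g}" "g \<in> Hom A Y X"
    using \<psi> unfolding stable_Hom_def by (rule quotientE)
  show ?R
    using factors_projective_of_stable_comp[OF X Y f(2) g(2)] factors_projective_of_stable_comp[OF Y X g(2) f(2)]
      id f g by (intro bexI[OF _ Hom_module_hom[OF f(2)]] bexI[OF _ Hom_module_hom[OF g(2)]]) simp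
next
  interpret X: left_module A X by (rule X)
  interpret Y: left_module A Y by (rule Y)
  assume ?R
  then obtain f g where f: "f \<in> module_hom A X Y" and g: "g \<in> module_hom A Y X"
    and gf: "factors_projective X X (\<lambda>x. x \<ominus>\<^bsub>X\<^esub> g (f x))"
    and fg: "factors_projective Y Y (\<lambda>y. y \<ominus>\<^bsub>Y\<^esub> f (g y))" by blast
  let ?f = "\<lambda>x\<in>carrier X. f x" and ?g = "\<lambda>y\<in>carrier Y. g y"
  have rf: "?f \<in> Hom A X Y" by (rule restrict_Hom[OF X f])
  have rg: "?g \<in> Hom A Y X" by (rule restrict_Hom[OF Y g])
  have "factors_projective X X (\<lambda>x. x \<ominus>\<^bsub>X\<^esub> ?g (?f x))"
    by (rule factors_projective_cong[OF gf]) (simp add: hom_closed[OF f])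
  note 1 = stable_comp_eq_id[OF X Y rf rg this]
  have "factors_projective Y Y (\<lambda>y. y \<ominus>\<^bsub>Y\<^esub> ?f (?g y))"
    by (rule factors_projective_cong[OF fg]) (simp add: hom_closed[OF g])
  note 2 = stable_comp_eq_id[OF Y X rg rf this]
  have "stable_eq K A X Y `` {?f} \<in> stable_Hom K A X Y" "stable_eq K A Y X `` {?g} \<in> stable_Hom K A Y X"
    unfolding stable_Hom_def by (rule quotientI[OF rf], rule quotientI[OF rg])
  then show "stable_iso K A X Y" unfolding stable_iso_def using 1 2 by blast
qed

lemma factors_projective_of_direct_sum_iso:
  assumes X: "left_module A X" and P: "left_module A P" and Y: "left_module A Y" and Q: "projective K A Q"
    and \<phi>: "\<phi> \<in> module_hom A (direct_sum X P) (direct_sum Y Q)"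
    and \<psi>: "\<psi> \<in> module_hom A (direct_sum Y Q) (direct_sum X P)"
    and inv: "\<And>z. z \<in> carrier (direct_sum X P) \<Longrightarrow> \<psi> (\<phi> z) = z"
  shows "factors_projective X X (\<lambda>x. x \<ominus>\<^bsub>X\<^esub> fst (\<psi> (fst (\<phi> (x, \<zero>\<^bsub>P\<^esub>)), \<zero>\<^bsub>Q\<^esub>)))"
proof (rule factors_projectiveI[OF Q])
  note lQ = fd_module_left_module[OF projective_fd_module[OF Q]]
  interpret phi: left_module_hom A "direct_sum X P" "direct_sum Y Q" \<phi>
    by (rule left_module_homI[OF left_module_direct_sum[OF X P] left_module_direct_sum[OF Y lQ] \<phi>])
  interpret psi: left_module_hom A "direct_sum Y Q" "direct_sum X P" \<psi>
    by (rule left_module_homI[OF left_module_direct_sum[OF Y lQ] left_module_direct_sum[OF X P] \<psi>])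
  interpret X: left_module A X by (rule X)
  interpret P: left_module A P by (rule P)
  interpret Y: left_module A Y by (rule Y)
  interpret Q: left_module A Q by (rule lQ)
  show "(\<lambda>x. snd (\<phi> (x, \<zero>\<^bsub>P\<^esub>))) \<in> module_hom A X Q"
    by (rule hom_comp[OF hom_snd hom_comp[OF \<phi> hom_inl[OF P]]])
  show "(\<lambda>w. fst (\<psi> (\<zero>\<^bsub>Y\<^esub>, w))) \<in> module_hom A Q X"
    by (rule hom_comp[OF hom_fst hom_comp[OF \<psi> hom_inr[OF Y]]])
  fix x assume x: "x \<in> carrier X"
  define y w where "y = fst (\<phi> (x, \<zero>\<^bsub>P\<^esub>))" and "w = snd (\<phi> (x, \<zero>\<^bsub>P\<^esub>))"
  have "\<phi> (x, \<zero>\<^bsub>P\<^esub>) \<in> carrier (direct_sum Y Q)" using x by (intro phi.closed) simp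
  then have yw: "y \<in> carrier Y" "w \<in> carrier Q" by (auto simp: y_def w_def)
  have c1: "\<psi> (y, \<zero>\<^bsub>Q\<^esub>) \<in> carrier (direct_sum X P)" and c2: "\<psi> (\<zero>\<^bsub>Y\<^esub>, w) \<in> carrier (direct_sum X P)"
    using yw by (intro psi.closed; simp)+
  have "\<psi> (y, \<zero>\<^bsub>Q\<^esub>) \<oplus>\<^bsub>direct_sum X P\<^esub> \<psi> (\<zero>\<^bsub>Y\<^esub>, w) = \<psi> ((y, \<zero>\<^bsub>Q\<^esub>) \<oplus>\<^bsub>direct_sum Y Q\<^esub> (\<zero>\<^bsub>Y\<^esub>, w))"
    using yw by (intro psi.add[symmetric]) simp_all
  also have "(y, \<zero>\<^bsub>Q\<^esub>) \<oplus>\<^bsub>direct_sum Y Q\<^esub> (\<zero>\<^bsub>Y\<^esub>, w) = \<phi> (x, \<zero>\<^bsub>P\<^esub>)"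
    using yw by (simp add: y_def w_def)
  also have "\<psi> \<dots> = (x, \<zero>\<^bsub>P\<^esub>)" using x by (intro inv) simp
  finally have "fst (\<psi> (y, \<zero>\<^bsub>Q\<^esub>)) \<oplus>\<^bsub>X\<^esub> fst (\<psi> (\<zero>\<^bsub>Y\<^esub>, w)) = x" by simp
  moreover have "fst (\<psi> (y, \<zero>\<^bsub>Q\<^esub>)) \<in> carrier X" "fst (\<psi> (\<zero>\<^bsub>Y\<^esub>, w)) \<in> carrier X" using c1 c2 by auto
  ultimately have "x \<ominus>\<^bsub>X\<^esub> fst (\<psi> (y, \<zero>\<^bsub>Q\<^esub>)) = fst (\<psi> (\<zero>\<^bsub>Y\<^esub>, w))"
    by (metis X.a_comm X.add_diff_cancel)
  then show "x \<ominus>\<^bsub>X\<^esub> fst (\<psi> (fst (\<phi> (x, \<zero>\<^bsub>P\<^esub>)), \<zero>\<^bsub>Q\<^esub>)) = fst (\<psi> (\<zero>\<^bsub>Y\<^esub>, snd (\<phi> (x, \<zero>\<^bsub>P\<^esub>))))"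
    unfolding y_def w_def .
qed

lemma stable_iso_if_proj_equiv:
  assumes X: "left_module A X" and Y: "left_module A Y" and XY: "proj_equiv X Y"
  shows "stable_iso K A X Y"
proof -
  obtain P Q where P: "P \<in> Amod K A" "projective K A P" and Q: "Q \<in> Amod K A" "projective K A Q"
    and iso: "mod_iso A (direct_sum X P) (direct_sum Y Q)"
    by (rule proj_equivE[OF XY]) blast
  note lP = fd_module_left_module[OF Amod_fd_module[OF P(1)]]
  note lQ = fd_module_left_module[OF Amod_fd_module[OF Q(1)]]
  obtain \<phi> \<psi> where iso: "\<phi> \<in> module_hom A (direct_sum X P) (direct_sum Y Q)"
    "\<psi> \<in> module_hom A (direct_sum Y Q) (direct_sum X P)"
    "\<And>x. x \<in> carrier (direct_sum X P) \<Longrightarrow> \<psi> (\<phi> x) = x" "\<And>y. y \<in> carrier (direct_sum Y Q) \<Longrightarrow> \<phi> (\<psi> y) = y"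
    using mod_isoE[OF iso] by blast
  have f: "(\<lambda>x. fst (\<phi> (x, \<zero>\<^bsub>P\<^esub>))) \<in> module_hom A X Y"
    by (rule hom_comp[OF hom_fst hom_comp[OF iso(1) hom_inl[OF lP]]])
  have g: "(\<lambda>y. fst (\<psi> (y, \<zero>\<^bsub>Q\<^esub>))) \<in> module_hom A Y X"
    by (rule hom_comp[OF hom_fst hom_comp[OF iso(2) hom_inl[OF lQ]]])
  show ?thesis
    unfolding stable_iso_iff_factors[OF X Y]
    using factors_projective_of_direct_sum_iso[OF X lP Y Q(2) iso(1,2,3)]
      factors_projective_of_direct_sum_iso[OF Y lQ X P(2) iso(2,1,4)]
    by (intro bexI[OF _ f] bexI[OF _ g] conjI)
qed

text \<open>If \<open>id - g f\<close> factors through \<open>P\<close>, then \<open>X\<close> is a direct summand of \<open>Y \<oplus> P\<close>; it remains to see that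
  its complement is projective.\<close>

lemma proj_equiv_if_stable_iso:
  assumes X: "fd_module K A X" and Y: "fd_module K A Y" and st: "stable_iso K A X Y"
  shows "proj_equiv X Y"
proof -
  note lX = fd_module_left_module[OF X] and lY = fd_module_left_module[OF Y]
  obtain f g where f: "f \<in> module_hom A X Y" and g: "g \<in> module_hom A Y X"
    and gf: "factors_projective X X (\<lambda>x. x \<ominus>\<^bsub>X\<^esub> g (f x))"
    and fg: "factors_projective Y Y (\<lambda>y. y \<ominus>\<^bsub>Y\<^esub> f (g y))"
    using st unfolding stable_iso_iff_factors[OF lX lY] by blast
  obtain P a b where P: "P \<in> Amod K A" "projective K A P" "a \<in> module_hom A X P"
    "b \<in> module_hom A P X" "\<forall>x\<in>carrier X. x \<ominus>\<^bsub>X\<^esub> g (f x) = b (a x)"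
    by (rule factors_projectiveE[OF gf])
  obtain R c d where R: "R \<in> Amod K A" "projective K A R" "c \<in> module_hom A Y R"
    "d \<in> module_hom A R Y" "\<forall>y\<in>carrier Y. y \<ominus>\<^bsub>Y\<^esub> f (g y) = d (c y)"
    by (rule factors_projectiveE[OF fg])
  note fP = Amod_fd_module[OF P(1)] and fR = Amod_fd_module[OF R(1)]
  note lP = fd_module_left_module[OF fP] and lR = fd_module_left_module[OF fR]
  note fS = fd_module_direct_sum[OF Y fP]
  note lS = fd_module_left_module[OF fS]
  interpret f: left_module_hom A X Y f by (rule left_module_homI[OF lX lY f])
  interpret g: left_module_hom A Y X g by (rule left_module_homI[OF lY lX g])
  interpret b: left_module_hom A P X b by (rule left_module_homI[OF lP lX P(4)])
  interpret d: left_module_hom A R Y d by (rule left_module_homI[OF lR lY R(4)])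
  interpret S: left_module A "direct_sum Y P" by (rule lS)
  \<comment> \<open>\<open>X\<close> is a direct summand of \<open>Y \<oplus> P\<close>.\<close>
  define i where "i x = (f x, a x)" for x
  define r where "r z = g (fst z) \<oplus>\<^bsub>X\<^esub> b (snd z)" for z
  have hi: "i \<in> module_hom A X (direct_sum Y P)" unfolding i_def by (rule hom_pair[OF f P(3)])
  have hr: "r \<in> module_hom A (direct_sum Y P) X" unfolding r_def by (rule hom_copair[OF lY lP lX g P(4)])
  interpret i: left_module_hom A X "direct_sum Y P" i by (rule left_module_homI[OF lX lS hi])
  interpret r: left_module_hom A "direct_sum Y P" X r by (rule left_module_homI[OF lS lX hr])
  have ri: "r (i x) = x" if x: "x \<in> carrier X" for x
  proof -
    have "r (i x) = g (f x) \<oplus>\<^bsub>X\<^esub> (x \<ominus>\<^bsub>X\<^esub> g (f x))" using P(5) x by (simp add: r_def i_def)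
    also have "\<dots> = x"
      using f.M.diff_add_cancel[of x "g (f x)"] x by (simp add: f.M.a_comm)
    finally show ?thesis .
  qed
  obtain L k where L: "L \<in> Amod K A" "k \<in> module_hom A L (direct_sum Y P)" "inj_on k (carrier L)"
    "k ` carrier L = {z \<in> carrier (direct_sum Y P). r z = \<zero>\<^bsub>X\<^esub>}"
    using obtain_submodule[OF fS left_submodule_kernel[OF lS lX hr]] by blast
  note fL = Amod_fd_module[OF L(1)]
  note lL = fd_module_left_module[OF fL]
  have iso: "mod_iso A (direct_sum X L) (direct_sum Y P)"
    by (rule mod_iso_split[OF lX lS lL hi hr ri L(2,3,4)])
  \<comment> \<open>The complement \<open>L\<close> is projective, since its identity factors through \<open>R \<oplus> P\<close>.\<close>
  let ?e = "\<lambda>z. z \<ominus>\<^bsub>direct_sum Y P\<^esub> i (r z)"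
  have he: "?e \<in> module_hom A (direct_sum Y P) (direct_sum Y P)"
    by (rule hom_diff[OF lS lS hom_id hom_comp[OF hi hr]])
  have "?e z \<in> k ` carrier L" if z: "z \<in> carrier (direct_sum Y P)" for z
  proof -
    have "r (?e z) = r z \<ominus>\<^bsub>X\<^esub> r (i (r z))" using z by (intro r.diff i.closed r.closed)
    also have "\<dots> = \<zero>\<^bsub>X\<^esub>" using z by (simp only: ri r.closed f.M.diff_self)
    finally show ?thesis unfolding L(4) using hom_closed[OF he z] by blast
  qed
  then obtain \<rho> where \<rho>: "\<rho> \<in> module_hom A (direct_sum Y P) L"
    "\<And>z. z \<in> carrier (direct_sum Y P) \<Longrightarrow> k (\<rho> z) = ?e z"
    using hom_factor_inj[OF lL lS lS L(2,3) he] by blast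
  let ?\<alpha> = "\<lambda>l. (c (fst (k l)), snd (k l))"
  let ?\<beta> = "\<lambda>w. (d (fst w) \<ominus>\<^bsub>Y\<^esub> f (b (snd w)), snd w)"
  have h\<alpha>: "?\<alpha> \<in> module_hom A L (direct_sum R P)"
    by (rule hom_pair[OF hom_comp[OF R(3) hom_comp[OF hom_fst L(2)]] hom_comp[OF hom_snd L(2)]])
  have h\<beta>: "?\<beta> \<in> module_hom A (direct_sum R P) (direct_sum Y P)"
    by (intro hom_pair[OF hom_diff[OF left_module_direct_sum[OF lR lP] lY hom_comp[OF R(4) hom_fst]
            hom_comp[OF f hom_comp[OF P(4) hom_snd]]] hom_snd])
  have "\<rho> (?\<beta> (?\<alpha> l)) = l" if l: "l \<in> carrier L" for l
  proof -
    define y z where "y = fst (k l)" and "z = snd (k l)"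
    have kl: "k l = (y, z)" by (simp add: y_def z_def)
    have "k l \<in> {z \<in> carrier (direct_sum Y P). r z = \<zero>\<^bsub>X\<^esub>}" using L(4) l by blast
    then have yz: "y \<in> carrier Y" "z \<in> carrier P" and r0: "r (y, z) = \<zero>\<^bsub>X\<^esub>" by (auto simp: kl)
    have "f (g y \<oplus>\<^bsub>X\<^esub> b z) = \<zero>\<^bsub>Y\<^esub>" using r0 by (simp add: r_def)
    then have fgb: "f (g y) \<oplus>\<^bsub>Y\<^esub> f (b z) = \<zero>\<^bsub>Y\<^esub>" using yz by simp
    have "d (c y) \<ominus>\<^bsub>Y\<^esub> f (b z) = y \<ominus>\<^bsub>Y\<^esub> (f (g y) \<oplus>\<^bsub>Y\<^esub> f (b z))"
      using R(5)[rule_format, OF yz(1), symmetric] yz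
      by (simp add: a_minus_def f.N.minus_add f.N.a_assoc)
    also have "\<dots> = y" using yz by (simp add: fgb f.N.diff_zero)
    finally have \<beta>\<alpha>: "?\<beta> (?\<alpha> l) = k l" by (simp add: kl)
    have c: "k l \<in> carrier (direct_sum Y P)" by (rule hom_closed[OF L(2) l])
    have "k (\<rho> (k l)) = k l \<ominus>\<^bsub>direct_sum Y P\<^esub> i (r (k l))" by (rule \<rho>(2)[OF c])
    also have "i (r (k l)) = \<zero>\<^bsub>direct_sum Y P\<^esub>" unfolding kl r0 by (rule i.zero)
    also have "k l \<ominus>\<^bsub>direct_sum Y P\<^esub> \<zero>\<^bsub>direct_sum Y P\<^esub> = k l" by (rule S.diff_zero[OF c])
    finally have "\<rho> (k l) = l"
      by (rule inj_onD[OF L(3) _ hom_closed[OF \<rho>(1) c] l])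
    then show ?thesis unfolding \<beta>\<alpha> .
  qed
  then have "projective K A L"
    by (rule projective_retract[OF fL projective_direct_sum[OF R(2) P(2)] h\<alpha> hom_comp[OF \<rho>(1) h\<beta>]])
  then show ?thesis by (rule proj_equivI[OF _ P(2) iso])
qed

lemma stable_iso_rel_eq:
  "stable_iso_rel K A = {(X, Y). X \<in> Amod K A \<and> Y \<in> Amod K A \<and> proj_equiv X Y}"
  unfolding stable_iso_rel_def
  using proj_equiv_if_stable_iso stable_iso_if_proj_equiv Amod_fd_module fd_module_left_module by blast

lemma equiv_stable_iso_rel: "equiv (Amod K A) (stable_iso_rel K A)"
  unfolding stable_iso_rel_eq
  by (rule equivI)
    (auto simp: refl_on_def sym_def trans_def intro: proj_equiv_refl proj_equiv_sym proj_equiv_trans)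

lemma st_le_respects: "st_le K A respects2 stable_iso_rel K A"
proof (rule congruent2I')
  have imp: "st_le K A X' Y'"
    if "(X, X') \<in> stable_iso_rel K A" "(Y, Y') \<in> stable_iso_rel K A" "st_le K A X Y" for X X' Y Y'
  proof -
    have X: "fd_module K A X" "fd_module K A X'" "proj_equiv X X'"
      and Y: "fd_module K A Y" "fd_module K A Y'" "proj_equiv Y Y'"
      using that(1,2) by (auto simp: stable_iso_rel_eq Amod_fd_module)
    have "st_le K A X' X" by (rule st_le_proj_equiv[OF X(2,1) proj_equiv_sym[OF X(3)]])
    moreover have "st_le K A Y Y'" by (rule st_le_proj_equiv[OF Y])
    ultimately show ?thesis
      using st_le_trans[OF X(2,1) Y(1) _ that(3)] st_le_trans[OF X(2) Y(1,2)] by blast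
  qed
  fix X X' Y Y' assume XY: "(X, X') \<in> stable_iso_rel K A" "(Y, Y') \<in> stable_iso_rel K A"
  then have "(X', X) \<in> stable_iso_rel K A" "(Y', Y) \<in> stable_iso_rel K A"
    by (auto simp: stable_iso_rel_eq intro: proj_equiv_sym)
  then show "st_le K A X Y = st_le K A X' Y'" using imp XY by blast
qed

end

section \<open>The partial order\<close>

theorem lemma2p5:
  fixes K :: "('k, 'q) ring_scheme" and A :: "('k, 'a, 'p) module_scheme"
  assumes "fd_algebra K A"
  shows "st_le K A respects2 stable_iso_rel K A \<and>
    partial_order_on (stable_classes K A) (stable_deg_rel K A)"
proof
  interpret fd_algebra K A by (rule assms)
  note eq = equiv_stable_iso_rel
  show "st_le K A respects2 stable_iso_rel K A" by (rule st_le_respects)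
  have class_Amod: "X \<in> Amod K A" if "C \<in> stable_classes K A" "X \<in> C" for C X
    using in_quotient_imp_subset[OF eq] that unfolding stable_classes_def by blast
  have class_related: "(X, X') \<in> stable_iso_rel K A"
    if "C \<in> stable_classes K A" "X \<in> C" "X' \<in> C" for C X X'
    using quotient_eq_iff[OF eq, of C C X X'] that unfolding stable_classes_def by blast
  have class_nonempty: "\<exists>X. X \<in> C" if "C \<in> stable_classes K A" for C
    using in_quotient_imp_non_empty[OF eq] that unfolding stable_classes_def by blast
  have le_iff: "(C, D) \<in> stable_deg_rel K A \<longleftrightarrow> st_le K A X Y"
    if CD: "C \<in> stable_classes K A" "D \<in> stable_classes K A" and XY: "X \<in> C" "Y \<in> D" for C D X Y
  proof
    assume "(C, D) \<in> stable_deg_rel K A"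
    then obtain X' Y' where "X' \<in> C" "Y' \<in> D" "st_le K A X' Y'" unfolding stable_deg_rel_def by blast
    then show "st_le K A X Y"
      using congruent2D[OF st_le_respects class_related[OF CD(1) XY(1)] class_related[OF CD(2) XY(2)]] by blast
  next
    assume "st_le K A X Y"
    then show "(C, D) \<in> stable_deg_rel K A" unfolding stable_deg_rel_def using CD XY by blast
  qed
  have in_classes: "C \<in> stable_classes K A" "D \<in> stable_classes K A" if "(C, D) \<in> stable_deg_rel K A" for C D
    using that unfolding stable_deg_rel_def by blast+
  show "partial_order_on (stable_classes K A) (stable_deg_rel K A)"
    unfolding partial_order_on_def preorder_on_def
  proof (intro conjI)
    show "stable_deg_rel K A \<subseteq> stable_classes K A \<times> stable_classes K A" using in_classes by auto
    show "refl_on (stable_classes K A) (stable_deg_rel K A)"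
    proof (rule refl_onI)
      fix C assume C: "C \<in> stable_classes K A"
      then obtain X where X: "X \<in> C" using class_nonempty by blast
      show "(C, C) \<in> stable_deg_rel K A"
        using le_iff[OF C C X X] st_le_refl[OF Amod_fd_module[OF class_Amod[OF C X]]] by blast
    qed
    show "trans (stable_deg_rel K A)"
    proof (rule transI)
      fix C D E assume CD: "(C, D) \<in> stable_deg_rel K A" and DE: "(D, E) \<in> stable_deg_rel K A"
      note C = in_classes(1)[OF CD] and D = in_classes(2)[OF CD] and E = in_classes(2)[OF DE]
      obtain X Y W where X: "X \<in> C" and Y: "Y \<in> D" and W: "W \<in> E"
        using class_nonempty[OF C] class_nonempty[OF D] class_nonempty[OF E] by blast
      have "st_le K A X W"
        using st_le_trans[OF Amod_fd_module[OF class_Amod[OF C X]] Amod_fd_module[OF class_Amod[OF D Y]]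
            Amod_fd_module[OF class_Amod[OF E W]]] le_iff[OF C D X Y] le_iff[OF D E Y W] CD DE by blast
      then show "(C, E) \<in> stable_deg_rel K A" using le_iff[OF C E X W] by blast
    qed
    show "antisym (stable_deg_rel K A)"
    proof (rule antisymI)
      fix C D assume CD: "(C, D) \<in> stable_deg_rel K A" and DC: "(D, C) \<in> stable_deg_rel K A"
      note C = in_classes(1)[OF CD] and D = in_classes(2)[OF CD]
      obtain X Y where X: "X \<in> C" and Y: "Y \<in> D" using class_nonempty[OF C] class_nonempty[OF D] by blast
      note XA = class_Amod[OF C X] and YA = class_Amod[OF D Y]
      have "proj_equiv X Y"
        using st_le_antisym[OF XA YA] le_iff[OF C D X Y] le_iff[OF D C Y X] CD DC by blast
      then have "(X, Y) \<in> stable_iso_rel K A" using XA YA by (simp add: stable_iso_rel_eq)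
      then show "C = D"
        using quotient_eqI[OF eq, of C D X Y] C D X Y unfolding stable_classes_def by blast
    qed
  qed
qed

end
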